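(* Let $(f,I,\mu)$ be a system as described in the context, and suppose that $\mu$ is an acip, i.e. $\mu$ is absolutely continuous with respect to Lebesgue measure. Then there exist constants $C\ge1$ and $\delta_0\in(0,1)$ such that for all $\epsilon\in(0,1)$ and all $\delta\in(0,\delta_0)$, $$\frac1C\,\delta^{-1}\log(1/\delta)\;\le\;\mathbb{E}_\mu\mathcal{B}_\delta^{1-\epsilon}\;\le\;\frac{C}{\epsilon^3}\,\delta^{-1}\log(1/\delta),$$ and in particular $$\frac1C\,\mathbb{E}_\mu\mathcal{C}_\delta\;\le\;\mathbb{E}_\mu\mathcal{B}_\delta^{1-\epsilon}\;\le\;\frac{C}{\epsilon^3}\,\mathbb{E}_\mu\mathcal{C}_\delta.$$
   Context: Setting. $I\subset\mathbb{R}$ is an interval with a finite partition $\mathcal{P}$ into intervals, and $f:I\to\mathbb{R}$ is a map such that for each $P\in\mathcal{P}$ the restriction $f:P\to I$ is $C^2$, uniformly expanding, and extends continuously to $\overline P$ so that $f:\overline P\to I$ is a diffeomorphism (full branches). For $n\in\mathbb{N}$ let $\mathcal{P}_n=\bigvee_{i=0}^{n-1}f^{-i}\mathcal{P}$, whose elements are called $n$-cylinders, and assume bounded distortion: $\sup_n\sup_{P\in\mathcal{P}_n}\sup_{x,y\in P}|Df^n(x)|/|Df^n(y)|<\infty$. (Boundary points of cylinders have measure zero and are ignored.) $\phi:I\to\mathbb{R}$ is a potential that is Hölder on each $P\in\mathcal{P}$, with $S_n\phi=\sum_{i=0}^{n-1}\phi\circ f^i$ and pressure $P(\phi)=\lim_{n\to\infty}\frac1n\log\sum_{f^nx=x}e^{S_n\phi(x)}$;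 replacing $\phi$ by $\phi-P(\phi)$ we assume $P(\phi)=0$. $\mu=\mu_\phi$ is the unique $f$-invariant Gibbs probability measure for $\phi$: there is $0<C'<\infty$ with $\frac1{C'}\le \mu(P)/e^{S_n\phi(x)}\le C'$ for all $n$, $P\in\mathcal{P}_n$, $x\in P$. The measure $\mu$ is fully supported on $I$. $B(x,\delta)$ is the ball of radius $\delta$ centred at $x$, and $\mathbb{E}_\mu$ is expectation with respect to $\mu$. Cover time. For $\delta\in(0,1)$, $\mathcal{C}_\delta(x)=\inf\{n\ge1:\{x,f(x),\dots,f^{n-1}(x)\}\text{ is }\delta\text{-dense in }I\}$. Blanket time. For $\epsilon,\delta\in(0,1)$, $$\mathcal{B}_\delta^{1-\epsilon}(x)=\min\Big\{N\ge1:\ \forall y\in\mathrm{supp}\,\mu,\ \frac1N\sum_{i=0}^{N-1}\mathbf{1}_{B(y,\delta)}(f^ix)\ge(1-\epsilon)\mu(B(y,\delta))\Big\}.$$ *)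

theory Defs
  imports "HOL-Probability.Probability"
begin

text \<open>
  Derivatives are taken within the set on which a map is considered (one-sided at endpoints
  that belong to it): a piecewise smooth map is only differentiable branch by branch.
\<close>

abbreviation deriv_on :: "real set \<Rightarrow> (real \<Rightarrow> real) \<Rightarrow> real \<Rightarrow> real" where
  "deriv_on S g x \<equiv> vector_derivative g (at x within S)"

definition C1_on :: "real set \<Rightarrow> (real \<Rightarrow> real) \<Rightarrow> bool" where
  "C1_on S g \<longleftrightarrow> g differentiable_on S \<and> continuous_on S (deriv_on S g)"

definition C2_on :: "real set \<Rightarrow> (real \<Rightarrow> real) \<Rightarrow> bool" where
  "C2_on S g \<longleftrightarrow> g differentiable_on S \<and> C1_on S (deriv_on S g)"

definition diffeomorphism_on :: "real set \<Rightarrow> real set \<Rightarrow> (real \<Rightarrow> real) \<Rightarrow> bool" where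
  "diffeomorphism_on S T g \<longleftrightarrow>
     bij_betw g S T \<and> C1_on S g \<and> C1_on T (inv_into S g)"

definition holder_on :: "real set \<Rightarrow> (real \<Rightarrow> real) \<Rightarrow> bool" where
  "holder_on S \<phi> \<longleftrightarrow>
     (\<exists>\<alpha> K. 0 < \<alpha> \<and> \<alpha> \<le> 1 \<and> (\<forall>x\<in>S. \<forall>y\<in>S. \<bar>\<phi> x - \<phi> y\<bar> \<le> K * \<bar>x - y\<bar> powr \<alpha>))"

text \<open>
  The nonempty elements of the join of the first \<open>n\<close> pullbacks of the partition \<open>\<P>\<close> of \<open>I\<close>.
\<close>

definition cylinders :: "real set \<Rightarrow> real set set \<Rightarrow> (real \<Rightarrow> real) \<Rightarrow> nat \<Rightarrow> real set set" where
  "cylinders I \<P> f n =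
     {{x \<in> I. \<forall>i<n. (f ^^ i) x \<in> w i} | w. \<forall>i<n. w i \<in> \<P>} - {{}}"

definition birkhoff_sum :: "(real \<Rightarrow> real) \<Rightarrow> (real \<Rightarrow> real) \<Rightarrow> nat \<Rightarrow> real \<Rightarrow> real" where
  "birkhoff_sum f \<phi> n x = (\<Sum>i<n. \<phi> ((f ^^ i) x))"

definition has_pressure :: "real set \<Rightarrow> (real \<Rightarrow> real) \<Rightarrow> (real \<Rightarrow> real) \<Rightarrow> real \<Rightarrow> bool" where
  "has_pressure I f \<phi> p \<longleftrightarrow>
     (\<lambda>n. 1 / real n * ln (\<Sum>x\<in>{x \<in> I. (f ^^ n) x = x}. exp (birkhoff_sum f \<phi> n x)))
       \<longlonglongrightarrow> p"

text \<open>
  Only the values of \<open>f\<close> on \<open>I\<close> matter. Compactness of \<open>I\<close> is not assumed separately; it is a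
  consequence of \<open>full_branch\<close> as soon as \<open>\<P>\<close> has more than one element or \<open>I\<close> is bounded.
\<close>

locale full_branch_map =
  fixes I :: "real set" and \<P> :: "real set set" and f :: "real \<Rightarrow> real"
  assumes interval: "is_interval I"
    and finite_partition: "finite \<P>" "partition_on I \<P>"
    and partition_intervals: "\<And>P. P \<in> \<P> \<Longrightarrow> is_interval P"
    and branch_into: "\<And>P. P \<in> \<P> \<Longrightarrow> f ` P \<subseteq> I"
    and branch_C2: "\<And>P. P \<in> \<P> \<Longrightarrow> C2_on P f"
    and expanding: "\<exists>c>1. \<forall>P\<in>\<P>. \<forall>x\<in>P. c \<le> \<bar>deriv_on P f x\<bar>"
    and full_branch: "\<And>P. P \<in> \<P> \<Longrightarrow>
          \<exists>g. (\<forall>x\<in>P. g x = f x) \<and> continuous_on (closure P) g \<and>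
              diffeomorphism_on (closure P) I g"
    and bounded_distortion: "\<exists>K. \<forall>n\<ge>1. \<forall>P\<in>cylinders I \<P> f n. \<forall>x\<in>P. \<forall>y\<in>P.
          \<bar>deriv_on P (f ^^ n) x\<bar> / \<bar>deriv_on P (f ^^ n) y\<bar> \<le> K"

definition measure_support :: "real measure \<Rightarrow> real set" where
  "measure_support \<mu> =
     {y \<in> space \<mu>. \<forall>U. open U \<and> y \<in> U \<longrightarrow> 0 < measure \<mu> (U \<inter> space \<mu>)}"

text \<open>
  \<open>\<mu>\<close> is a Borel probability measure whose underlying space is \<open>I\<close>, so subsets of the line are
  intersected with \<open>space \<mu>\<close> before being measured.
\<close>

locale gibbs_system = full_branch_map I \<P> f + prob_space \<mu>
  for I :: "real set" and \<P> :: "real set set" and f :: "real \<Rightarrow> real"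
    and \<mu> :: "real measure" +
  fixes \<phi> :: "real \<Rightarrow> real"
  assumes sets_borel: "sets \<mu> = sets (restrict_space borel I)"
    and potential_holder: "\<And>P. P \<in> \<P> \<Longrightarrow> holder_on P \<phi>"
    and pressure_zero: "has_pressure I f \<phi> 0"
    and invariant: "f \<in> measurable \<mu> \<mu>" "distr \<mu> \<mu> f = \<mu>"
    and gibbs: "\<exists>C'>0. \<forall>n\<ge>1. \<forall>P\<in>cylinders I \<P> f n. \<forall>x\<in>P.
          1 / C' \<le> measure \<mu> P / exp (birkhoff_sum f \<phi> n x) \<and>
          measure \<mu> P / exp (birkhoff_sum f \<phi> n x) \<le> C'"
    and fully_supported: "measure_support \<mu> = I"

definition delta_dense_in :: "real \<Rightarrow> real set \<Rightarrow> real set \<Rightarrow> bool" where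
  "delta_dense_in \<delta> A I \<longleftrightarrow> (\<forall>y\<in>I. \<exists>x\<in>A. x \<in> ball y \<delta>)"

text \<open>
  Both times are extended naturals: the infimum of the empty set is \<open>\<infinity>\<close>. The second one takes the
  whole proportion \<open>\<theta> = 1 - \<epsilon>\<close> as its parameter.
\<close>

definition cover_time :: "(real \<Rightarrow> real) \<Rightarrow> real set \<Rightarrow> real \<Rightarrow> real \<Rightarrow> enat" where
  "cover_time f I \<delta> x =
     (INF n\<in>{n. 1 \<le> n \<and> delta_dense_in \<delta> ((\<lambda>i. (f ^^ i) x) ` {..<n}) I}. enat n)"

definition blanket_time :: "(real \<Rightarrow> real) \<Rightarrow> real measure \<Rightarrow> real \<Rightarrow> real \<Rightarrow> real \<Rightarrow> enat" where
  "blanket_time f \<mu> \<theta> \<delta> x =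
     (INF N\<in>{N. 1 \<le> N \<and> (\<forall>y\<in>measure_support \<mu>.
          \<theta> * measure \<mu> (ball y \<delta> \<inter> space \<mu>)
            \<le> 1 / real N * (\<Sum>i<N. indicator (ball y \<delta>) ((f ^^ i) x)))}. enat N)"

definition expected_time :: "real measure \<Rightarrow> (real \<Rightarrow> enat) \<Rightarrow> ennreal" where
  "expected_time \<mu> T = (\<integral>\<^sup>+x. ennreal_of_enat (T x) \<partial>\<mu>)"

end

theory Submission
  imports Defs "HOL-Real_Asymp.Real_Asymp"
begin

text \<open>
  An absolutely continuous Gibbs measure is comparable with length, so a ball of radius \<open>\<delta>\<close> has
  measure of order \<open>\<delta>\<close> and both times behave like collecting about \<open>1 / \<delta>\<close> coupons, one trial per
  step of the orbit. The blanket time dominates the cover time pointwise, because a ball with a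
  positive proportion of visits has been visited. Hence it suffices to bound the expected cover
  time from below and the expected blanket time from above by multiples of
  \<open>\<delta>\<^sup>-\<^sup>1 ln (1 / \<delta>)\<close>; the comparison of the two expectations follows.

  Independence comes from a finitely supported substitute for \<open>\<mu>\<close>. For a fixed base point, give each
  \<open>N\<close>-th preimage \<open>x\<close> the weight \<open>exp (S\<^sub>N \<phi> x)\<close> and normalise; \<open>E N F\<close> is the resulting mean of \<open>F\<close>.
  Every \<open>N\<close>-cylinder contains one such preimage, so the Gibbs inequalities say that \<open>\<mu>\<close> and \<open>E N\<close>
  agree on unions of \<open>N\<close>-cylinders up to a constant factor, which costs nothing in the tail bounds
  below. On the other hand \<open>E N (F * (G \<circ> f^n))\<close> is computed exactly by the transfer operator \<open>L\<close>,
  and since the potential is Hoelder, \<open>L\<close> maps a cone of regular functions strictly into itself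
  and makes ratios of such functions constant exponentially fast (lemma \<open>cross_ratio\<close>). This gives
  multiplicative mixing under \<open>E N\<close> (lemma \<open>mixing\<close>) without a conformal measure or an eigenfunction.
  The blanket time compares visits with the true \<open>\<mu>\<close>-measure of a ball, so the one-time marginals of
  \<open>E N\<close> have to be identified with \<open>\<mu>\<close> up to a factor close to 1. By mixing, the average number
  of visits to a set has small variance under \<open>E N\<close>, hence also small mean square deviation under
  \<open>\<mu>\<close>; but its \<open>\<mu>\<close>-mean is the \<open>\<mu>\<close>-measure of the set by invariance (lemma \<open>marginal\<close>).

  For the upper bound, time is cut into blocks of length \<open>M\<close> of order \<open>\<epsilon>\<^sup>-\<^sup>1\<^sup>/\<^sup>2 \<delta>\<^sup>-\<^sup>1\<close>. Blocks of equal
  parity are separated by a gap long enough for mixing, and a Chernoff argument with the second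
  moment of the number of visits in one block shows that \<open>J\<close> blocks give too few visits with
  probability at most \<open>exp (- c \<epsilon>\<^sup>2 J)\<close> (lemma \<open>chernoff\<close>). A union bound over a net of spacing of
  order \<open>\<epsilon> \<delta>\<close> asks for \<open>J\<close> of order \<open>\<epsilon>\<^sup>-\<^sup>2 ln (1 / (\<epsilon> \<delta>))\<close>, at most of order
  \<open>\<epsilon>\<^sup>-\<^sup>5\<^sup>/\<^sup>2 ln (1 / \<delta>)\<close>, and \<open>J M\<close> gives the power \<open>\<epsilon>\<^sup>-\<^sup>3\<close>.

  For the lower bound, let \<open>R\<^sub>t\<close> be the number of cells, out of about \<open>n = const / \<delta>\<close> disjoint ones,
  not visited before time \<open>t\<close>. Conditionally on the past, each unvisited cell is entered with
  probability at most of order \<open>\<delta>\<close>, so the mean of \<open>ln R\<^sub>t\<close>, cut off at \<open>ln (sqrt n)\<close>, decreases by at most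
  a multiple of \<open>\<delta>\<close> per step (lemma \<open>log_drift\<close>). It therefore takes a time of order
  \<open>\<delta>\<^sup>-\<^sup>1 ln n\<close> before all cells can have been visited with probability more than a half.
\<close>

section \<open>Coding by full branches\<close>

text \<open>
  Branches, expansion and the Hoelder condition, with explicit constants. Preimages are only
  taken of points of the open interval \<open>{a<..<b}\<close>: every branch covers it exactly once, and
  preimages of its points lie in it again, so endpoints of branches, where a value may be
  missed, never occur.
\<close>

locale branch_coding =
  fixes a b :: real and \<P> :: "real set set" and f \<phi> :: "real \<Rightarrow> real" and c \<alpha> H :: real
  assumes ab: "a < b"
    and finite_P: "finite \<P>"
    and partition: "partition_on {a..b} \<P>"
    and f_into: "\<And>x. x \<in> {a..b} \<Longrightarrow> f x \<in> {a..b}"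
    and interior_back: "\<And>x. x \<in> {a..b} \<Longrightarrow> f x \<in> {a<..<b} \<Longrightarrow> x \<in> {a<..<b}"
    and branch: "\<And>P y. P \<in> \<P> \<Longrightarrow> y \<in> {a<..<b} \<Longrightarrow> \<exists>!x. x \<in> P \<and> f x = y"
    and c_gt_1: "1 < c"
    and expand: "\<And>P x y. P \<in> \<P> \<Longrightarrow> x \<in> P \<Longrightarrow> y \<in> P \<Longrightarrow> c * \<bar>x - y\<bar> \<le> \<bar>f x - f y\<bar>"
    and alpha_pos: "0 < \<alpha>"
    and H_nonneg: "0 \<le> H"
    and holder: "\<And>P x y. P \<in> \<P> \<Longrightarrow> x \<in> P \<Longrightarrow> y \<in> P \<Longrightarrow> \<bar>\<phi> x - \<phi> y\<bar> \<le> H * \<bar>x - y\<bar> powr \<alpha>"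
begin

text \<open>
  The relation of lying in the same \<open>n\<close>-cylinder. It replaces the sets of the join, whose
  nonempty members are its classes.
\<close>

definition same :: "nat \<Rightarrow> real \<Rightarrow> real \<Rightarrow> bool" where
  "same n x y \<longleftrightarrow> (\<forall>i<n. \<forall>P\<in>\<P>. (f ^^ i) x \<in> P \<longleftrightarrow> (f ^^ i) y \<in> P)"

definition cylfun :: "nat \<Rightarrow> (real \<Rightarrow> 'c) \<Rightarrow> bool" where
  "cylfun n F \<longleftrightarrow> (\<forall>x\<in>{a..b}. \<forall>y\<in>{a..b}. same n x y \<longrightarrow> F x = F y)"

definition pre :: "nat \<Rightarrow> real \<Rightarrow> real set" where
  "pre n y = {x \<in> {a..b}. (f ^^ n) x = y}"

definition L :: "nat \<Rightarrow> (real \<Rightarrow> real) \<Rightarrow> real \<Rightarrow> real" where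
  "L n v y = (\<Sum>x\<in>pre n y. exp (birkhoff_sum f \<phi> n x) * v x)"

definition \<psi> :: "real set \<Rightarrow> real \<Rightarrow> real" where
  "\<psi> P y = (THE x. x \<in> P \<and> f x = y)"

lemma orbit_in: "x \<in> {a..b} \<Longrightarrow> (f ^^ n) x \<in> {a..b}"
  by (induction n) (use f_into in auto)

lemma P_sub: "P \<in> \<P> \<Longrightarrow> P \<subseteq> {a..b}"
  using partition by (auto simp: partition_on_def)

lemma in_some_P: "x \<in> {a..b} \<Longrightarrow> \<exists>P\<in>\<P>. x \<in> P"
  using partition by (auto simp: partition_on_def)

lemma P_eq: "P \<in> \<P> \<Longrightarrow> Q \<in> \<P> \<Longrightarrow> x \<in> P \<Longrightarrow> x \<in> Q \<Longrightarrow> P = Q"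
  using partition by (auto simp: partition_on_def disjoint_def)

lemma \<psi>: assumes "P \<in> \<P>" "y \<in> {a<..<b}"
  shows "\<psi> P y \<in> P" "f (\<psi> P y) = y" "\<psi> P y \<in> {a<..<b}"
proof -
  show *: "\<psi> P y \<in> P" "f (\<psi> P y) = y"
    using theI'[OF branch[OF assms]] by (auto simp: \<psi>_def)
  show "\<psi> P y \<in> {a<..<b}"
    using interior_back[of "\<psi> P y"] * P_sub[OF assms(1)] assms(2) by auto
qed

lemma \<psi>_eq: "P \<in> \<P> \<Longrightarrow> x \<in> P \<Longrightarrow> f x \<in> {a<..<b} \<Longrightarrow> \<psi> P (f x) = x"
  using branch[of P "f x"] \<psi>[of P "f x"] by auto

lemma funpow_add_apply: "(f ^^ (n + m)) x = (f ^^ m) ((f ^^ n) x)"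
  by (simp add: add.commute[of n m] funpow_add)

lemma birkhoff_sum_add:
  "birkhoff_sum f \<phi> (n + m) x = birkhoff_sum f \<phi> n x + birkhoff_sum f \<phi> m ((f ^^ n) x)"
  unfolding birkhoff_sum_def
  by (induction m) (simp_all add: funpow_add_apply)

lemma pre_0 [simp]: "y \<in> {a<..<b} \<Longrightarrow> pre 0 y = {y}"
  by (auto simp: pre_def)

lemma pre_1: assumes "y \<in> {a<..<b}" shows "pre (Suc 0) y = (\<lambda>P. \<psi> P y) ` \<P>"
proof
  show "pre (Suc 0) y \<subseteq> (\<lambda>P. \<psi> P y) ` \<P>"
  proof
    fix x assume x: "x \<in> pre (Suc 0) y"
    then obtain P where "P \<in> \<P>" "x \<in> P" using in_some_P by (auto simp: pre_def)
    then show "x \<in> (\<lambda>P. \<psi> P y) ` \<P>" using \<psi>_eq[of P x] x assms by (force simp: pre_def)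
  qed
  show "(\<lambda>P. \<psi> P y) ` \<P> \<subseteq> pre (Suc 0) y"
    using \<psi> assms by (fastforce simp: pre_def)
qed

lemma inj_\<psi>: assumes "y \<in> {a<..<b}" shows "inj_on (\<lambda>P. \<psi> P y) \<P>"
proof (rule inj_onI)
  fix P Q assume "P \<in> \<P>" "Q \<in> \<P>" "\<psi> P y = \<psi> Q y"
  then show "P = Q" using P_eq[of P Q "\<psi> P y"] \<psi>(1)[of P y] \<psi>(1)[of Q y] assms by auto
qed

lemma interior_back_n: "x \<in> {a..b} \<Longrightarrow> (f ^^ n) x \<in> {a<..<b} \<Longrightarrow> x \<in> {a<..<b}"
proof (induction n arbitrary: x)
  case (Suc n)
  then have "f x \<in> {a<..<b}" using Suc.IH[of "f x"] f_into[of x] by (simp add: funpow_swap1)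
  then show ?case using interior_back Suc.prems by blast
qed auto

lemma pre_sub: "y \<in> {a<..<b} \<Longrightarrow> pre n y \<subseteq> {a<..<b}"
  using interior_back_n[of _ n] unfolding pre_def by blast

lemma pre_in: "x \<in> pre n y \<Longrightarrow> y \<in> {a<..<b} \<Longrightarrow> x \<in> {a<..<b}"
  using pre_sub by blast

lemma pre_add: "pre (n + m) y = (\<Union>z\<in>pre m y. pre n z)"
  using orbit_in[of _ n] unfolding pre_def by (auto simp: funpow_add_apply)

lemma finite_pre: "y \<in> {a<..<b} \<Longrightarrow> finite (pre n y)"
proof (induction n arbitrary: y)
  case (Suc n)
  have "pre (Suc n) y = (\<Union>z\<in>pre (Suc 0) y. pre n z)" using pre_add[of n 1 y] by simp
  moreover have "finite (pre (Suc 0) y)" using pre_1[OF Suc.prems] finite_P by auto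
  ultimately show ?case using Suc.IH pre_in[of _ "Suc 0" y] Suc.prems by auto
qed auto

lemma L_0 [simp]: "y \<in> {a<..<b} \<Longrightarrow> L 0 v y = v y"
  by (simp add: L_def birkhoff_sum_def)

lemma L_1: assumes "y \<in> {a<..<b}"
  shows "L (Suc 0) v y = (\<Sum>P\<in>\<P>. exp (\<phi> (\<psi> P y)) * v (\<psi> P y))"
  unfolding L_def pre_1[OF assms] by (subst sum.reindex[OF inj_\<psi>[OF assms]]) (simp add: birkhoff_sum_def)

text \<open>
  The preimages of order \<open>n + m\<close> are grouped by their image under \<open>f^n\<close>.
\<close>

lemma L_comp: assumes "y \<in> {a<..<b}" shows "L (n + m) v y = L m (L n v) y"
proof -
  have disj: "pre n z \<inter> pre n z' = {}" if "z \<noteq> z'" for z z' using that by (auto simp: pre_def)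
  have "L (n + m) v y = (\<Sum>z\<in>pre m y. \<Sum>x\<in>pre n z. exp (birkhoff_sum f \<phi> (n + m) x) * v x)"
    unfolding L_def pre_add using finite_pre[OF assms] finite_pre[OF pre_in[OF _ assms]] disj
    by (subst sum.UNION_disjoint) auto
  also have "\<dots> = L m (L n v) y"
    unfolding L_def sum_distrib_left
    by (intro sum.cong refl) (auto simp: birkhoff_sum_add exp_add pre_def)
  finally show ?thesis .
qed

lemma L_mono: assumes "y \<in> {a<..<b}" "\<And>x. x \<in> {a<..<b} \<Longrightarrow> v x \<le> u x" shows "L n v y \<le> L n u y"
  unfolding L_def using assms pre_in by (intro sum_mono mult_left_mono) auto

lemma L_cong: assumes "y \<in> {a<..<b}" "\<And>x. x \<in> {a<..<b} \<Longrightarrow> v x = u x" shows "L n v y = L n u y"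
  by (intro antisym L_mono) (simp_all add: assms del: greaterThanLessThan_iff)

lemma L_scale: "L n (\<lambda>x. s * v x) y = s * L n v y"
  unfolding L_def by (simp add: sum_distrib_left mult_ac)

lemma L_plus: "L n (\<lambda>x. v x + u x) y = L n v y + L n u y"
  unfolding L_def by (simp add: sum.distrib ring_distribs)

lemma L_diff: "L n (\<lambda>x. v x - u x) y = L n v y - L n u y"
  unfolding L_def by (simp add: sum_subtractf ring_distribs)

lemma L_sum: "L n (\<lambda>x. \<Sum>i\<in>A. v i x) y = (\<Sum>i\<in>A. L n (v i) y)"
  unfolding L_def sum_distrib_left by (rule sum.swap)

lemma L_pull: "L n (\<lambda>x. v x * G ((f ^^ n) x)) y = L n v y * G y"
  unfolding L_def sum_distrib_right by (intro sum.cong refl) (auto simp: pre_def)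

lemma same_refl [simp]: "same n x x" by (simp add: same_def)

lemma same_sym: "same n x y \<Longrightarrow> same n y x" by (auto simp: same_def)

lemma same_trans: "same n x y \<Longrightarrow> same n y z \<Longrightarrow> same n x z" by (auto simp: same_def)

lemma same_mono: "same n x y \<Longrightarrow> m \<le> n \<Longrightarrow> same m x y" by (auto simp: same_def)

lemma same_Suc: "same (Suc n) x y \<longleftrightarrow> (\<forall>P\<in>\<P>. x \<in> P \<longleftrightarrow> y \<in> P) \<and> same n (f x) (f y)"
  unfolding same_def All_less_Suc2 by (simp add: funpow_swap1)

lemma same_shift: "same (n + m) x y \<Longrightarrow> same m ((f ^^ n) x) ((f ^^ n) y)"
proof (unfold same_def, intro allI impI ballI)
  fix i P assume *: "\<forall>i<n + m. \<forall>P\<in>\<P>. ((f ^^ i) x \<in> P) = ((f ^^ i) y \<in> P)" "i < m" "P \<in> \<P>"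
  then have "((f ^^ (n+i)) x \<in> P) = ((f ^^ (n+i)) y \<in> P)" by simp
  then show "((f ^^ i) ((f ^^ n) x) \<in> P) = ((f ^^ i) ((f ^^ n) y) \<in> P)" by (simp add: funpow_add_apply)
qed

lemma same_contract:
  "x \<in> {a..b} \<Longrightarrow> y \<in> {a..b} \<Longrightarrow> same n x y \<Longrightarrow> c ^ n * \<bar>x - y\<bar> \<le> \<bar>(f ^^ n) x - (f ^^ n) y\<bar>"
proof (induction n arbitrary: x y)
  case (Suc n)
  obtain P where P: "P \<in> \<P>" "x \<in> P" using in_some_P Suc.prems by blast
  then have "y \<in> P" using Suc.prems by (auto simp: same_Suc)
  then have "c * \<bar>x - y\<bar> \<le> \<bar>f x - f y\<bar>" using expand P by blast
  then have "c ^ n * (c * \<bar>x - y\<bar>) \<le> c ^ n * \<bar>f x - f y\<bar>" using c_gt_1 by simp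
  also have "\<dots> \<le> \<bar>(f ^^ n) (f x) - (f ^^ n) (f y)\<bar>"
    using Suc.prems f_into by (intro Suc.IH) (auto simp: same_Suc)
  finally show ?case by (simp add: funpow_swap1 mult_ac)
qed auto

lemma same_dist: assumes "x \<in> {a..b}" "y \<in> {a..b}" "same n x y" shows "\<bar>x - y\<bar> \<le> (b - a) / c ^ n"
proof -
  have "c ^ n * \<bar>x - y\<bar> \<le> b - a"
    using same_contract[OF assms] orbit_in[OF assms(1), of n] orbit_in[OF assms(2), of n] by auto
  then show ?thesis using c_gt_1 by (simp add: field_simps)
qed

text \<open>
  Full branches make the \<open>n\<close>-cylinders correspond to the \<open>n\<close>-th preimages of any interior point,
  which is what allows \<open>\<mu>\<close> to be replaced by weights on preimages.
\<close>

lemma ex1_pre_same: "x \<in> {a..b} \<Longrightarrow> y \<in> {a<..<b} \<Longrightarrow> \<exists>!z. z \<in> pre n y \<and> same n x z"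
proof (induction n arbitrary: x)
  case 0 then show ?case by (auto simp: same_def)
next
  case (Suc n)
  obtain w where w: "w \<in> pre n y" "same n (f x) w" using Suc.IH[of "f x"] Suc.prems f_into by blast
  have wU: "w \<in> {a<..<b}" using pre_in w Suc.prems by blast
  obtain P where P: "P \<in> \<P>" "x \<in> P" using in_some_P Suc.prems by blast
  have iff: "(\<forall>Q\<in>\<P>. x \<in> Q \<longleftrightarrow> z \<in> Q) \<longleftrightarrow> z \<in> P" for z
    using P P_eq by blast
  show ?case
  proof (rule ex1I[of _ "\<psi> P w"])
    show "\<psi> P w \<in> pre (Suc n) y \<and> same (Suc n) x (\<psi> P w)"
      using \<psi>[OF P(1) wU] w unfolding same_Suc iff by (auto simp: pre_def funpow_swap1)
  next
    fix z assume z: "z \<in> pre (Suc n) y \<and> same (Suc n) x z"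
    then have "f z \<in> pre n y" "same n (f x) (f z)" "z \<in> P"
      using f_into unfolding same_Suc iff by (auto simp: pre_def funpow_swap1)
    moreover from this have "f z = w" using Suc.IH[of "f x"] Suc.prems f_into w by blast
    ultimately show "z = \<psi> P w" using \<psi>_eq[OF P(1), of z] wU by simp
  qed
qed

lemma pre_nonempty: "y \<in> {a<..<b} \<Longrightarrow> pre n y \<noteq> {}"
  using ex1_pre_same[of a y n] ab by fastforce

lemma L_pos: "y \<in> {a<..<b} \<Longrightarrow> (\<And>x. x \<in> {a<..<b} \<Longrightarrow> 0 < v x) \<Longrightarrow> 0 < L n v y"
  unfolding L_def using pre_in[of _ n y] pre_nonempty[of y n] finite_pre[of y n]
  by (intro sum_pos) simp_all

lemma cylfunI: "(\<And>x y. x \<in> {a..b} \<Longrightarrow> y \<in> {a..b} \<Longrightarrow> same n x y \<Longrightarrow> F x = F y) \<Longrightarrow> cylfun n F"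
  unfolding cylfun_def by blast

lemma cylfunD: "cylfun n F \<Longrightarrow> x \<in> {a..b} \<Longrightarrow> y \<in> {a..b} \<Longrightarrow> same n x y \<Longrightarrow> F x = F y"
  unfolding cylfun_def by blast

lemma cylfun_const [simp]: "cylfun n (\<lambda>x. k)" by (simp add: cylfun_def)

lemma cylfun_mono: assumes "cylfun n F" "n \<le> m" shows "cylfun m F"
  by (rule cylfunI, rule cylfunD[OF assms(1)]) (assumption | erule same_mono[OF _ assms(2)])+

lemma cylfun_comp: assumes "cylfun n F" shows "cylfun n (\<lambda>x. G (F x))"
  by (rule cylfunI, rule arg_cong[where f=G], rule cylfunD[OF assms])

lemma cylfun_comp2: assumes "cylfun n F" "cylfun n F'" shows "cylfun n (\<lambda>x. G (F x) (F' x))"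
proof (rule cylfunI)
  fix x y assume "x \<in> {a..b}" "y \<in> {a..b}" "same n x y"
  then show "G (F x) (F' x) = G (F y) (F' y)"
    using cylfunD[OF assms(1), of x y] cylfunD[OF assms(2), of x y] by simp
qed

lemma cylfun_shift: assumes "cylfun m F" shows "cylfun (n + m) (\<lambda>x. F ((f ^^ n) x))"
  by (rule cylfunI, rule cylfunD[OF assms]; (rule orbit_in same_shift)?; assumption)

lemma cylfun_shift': assumes "cylfun m F" "n + m \<le> k" shows "cylfun k (\<lambda>x. F ((f ^^ n) x))"
  by (rule cylfun_mono[OF cylfun_shift[of m F n, OF assms(1)] assms(2)])

lemma cylfun_sum: assumes "\<And>i. i \<in> A \<Longrightarrow> cylfun n (F i)" shows "cylfun n (\<lambda>x. \<Sum>i\<in>A. F i x)"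
  by (rule cylfunI, rule sum.cong[OF refl], rule cylfunD[OF assms])

end

section \<open>The transfer operator contracts ratios of regular functions\<close>

context branch_coding
begin

text \<open>
  The cone of positive functions whose logarithm is Hoelder with constant \<open>k\<close>, written
  multiplicatively so that the zero function belongs to it.
\<close>

definition reg :: "real \<Rightarrow> (real \<Rightarrow> real) \<Rightarrow> bool" where
  "reg k v \<longleftrightarrow> (\<forall>x\<in>{a<..<b}. 0 \<le> v x) \<and>
     (\<forall>x\<in>{a<..<b}. \<forall>y\<in>{a<..<b}. v x \<le> v y * exp (k * \<bar>x - y\<bar> powr \<alpha>))"

definition \<theta> :: real where "\<theta> = c powr (- \<alpha>)"
definition \<sigma> :: real where "\<sigma> = (1 + \<theta>) / 2"
text \<open>
  One step of \<open>L\<close> turns the constant \<open>k\<close> into \<open>\<theta> * (k + H)\<close>. The value \<open>\<kappa>\<close> lies above the fixed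
  point of this map, so the cone with constant \<open>\<kappa>\<close> goes into the smaller cone with constant
  \<open>\<sigma> * \<kappa>\<close>.
\<close>

definition \<kappa> :: real where "\<kappa> = 2 * H * \<theta> / (1 - \<theta>) + 1"

lemma \<theta>: "0 < \<theta>" "\<theta> < 1"
proof -
  have "1 < c powr \<alpha>" using powr_less_mono[OF alpha_pos c_gt_1] c_gt_1 by simp
  then show "0 < \<theta>" "\<theta> < 1" by (auto simp: \<theta>_def powr_minus inverse_less_1_iff)
qed

lemma \<sigma>: "0 < \<sigma>" "\<sigma> < 1" using \<theta> by (auto simp: \<sigma>_def)

lemma \<kappa>_pos: "0 < \<kappa>" using \<theta> H_nonneg by (auto simp: \<kappa>_def intro!: add_nonneg_pos)

lemma \<kappa>_step: "\<theta> * (\<kappa> + H) \<le> \<sigma> * \<kappa>"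
proof -
  have "\<sigma> * \<kappa> - \<theta> * (\<kappa> + H) = (1 - \<theta>) / 2 * \<kappa> - \<theta> * H" by (simp add: \<sigma>_def field_simps)
  also have "(1 - \<theta>) / 2 * \<kappa> = \<theta> * H + (1 - \<theta>) / 2" using \<theta> by (simp add: \<kappa>_def field_simps)
  finally show ?thesis using \<theta> by simp
qed

lemma regI: "(\<And>x. x \<in> {a<..<b} \<Longrightarrow> 0 \<le> v x) \<Longrightarrow>
   (\<And>x y. x \<in> {a<..<b} \<Longrightarrow> y \<in> {a<..<b} \<Longrightarrow> v x \<le> v y * exp (k * \<bar>x - y\<bar> powr \<alpha>)) \<Longrightarrow> reg k v"
  unfolding reg_def by blast

lemma regD: "reg k v \<Longrightarrow> x \<in> {a<..<b} \<Longrightarrow> y \<in> {a<..<b} \<Longrightarrow> v x \<le> v y * exp (k * \<bar>x - y\<bar> powr \<alpha>)"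
  unfolding reg_def by blast

lemma reg_nonneg: "reg k v \<Longrightarrow> x \<in> {a<..<b} \<Longrightarrow> 0 \<le> v x"
  unfolding reg_def by blast

lemma reg_cong: "reg k v \<Longrightarrow> (\<And>x. x \<in> {a<..<b} \<Longrightarrow> v x = u x) \<Longrightarrow> reg k u"
  unfolding reg_def by (simp del: greaterThanLessThan_iff)

lemma reg_mono: assumes "reg k v" "k \<le> k'" shows "reg k' v"
proof (rule regI)
  fix x y assume xy: "x \<in> {a<..<b}" "y \<in> {a<..<b}"
  have "v x \<le> v y * exp (k * \<bar>x - y\<bar> powr \<alpha>)" using regD[OF assms(1) xy] .
  also have "\<dots> \<le> v y * exp (k' * \<bar>x - y\<bar> powr \<alpha>)"
    using reg_nonneg[OF assms(1) xy(2)] assms(2) by (intro mult_left_mono) (auto intro: mult_right_mono)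
  finally show "v x \<le> v y * exp (k' * \<bar>x - y\<bar> powr \<alpha>)" .
qed (use reg_nonneg assms in blast)

lemma reg_one: "reg \<kappa> (\<lambda>x. 1)"
  using \<kappa>_pos by (intro regI) auto

lemma reg_sum: assumes "\<And>i. i \<in> A \<Longrightarrow> reg k (v i)" shows "reg k (\<lambda>x. \<Sum>i\<in>A. v i x)"
proof (rule regI)
  fix x assume "x \<in> {a<..<b}"
  then show "0 \<le> (\<Sum>i\<in>A. v i x)" using reg_nonneg[OF assms] by (intro sum_nonneg)
next
  fix x y assume "x \<in> {a<..<b}" "y \<in> {a<..<b}"
  then show "(\<Sum>i\<in>A. v i x) \<le> (\<Sum>i\<in>A. v i y) * exp (k * \<bar>x - y\<bar> powr \<alpha>)"
    unfolding sum_distrib_right using regD[OF assms] by (intro sum_mono)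
qed

lemma \<psi>_contract: assumes "P \<in> \<P>" "x \<in> {a<..<b}" "y \<in> {a<..<b}"
  shows "\<bar>\<psi> P x - \<psi> P y\<bar> powr \<alpha> \<le> \<theta> * \<bar>x - y\<bar> powr \<alpha>"
proof -
  have "c * \<bar>\<psi> P x - \<psi> P y\<bar> \<le> \<bar>x - y\<bar>"
    using expand[of P "\<psi> P x" "\<psi> P y"] \<psi>[OF assms(1,2)] \<psi>[OF assms(1,3)] assms(1) by simp
  then have "\<bar>\<psi> P x - \<psi> P y\<bar> \<le> \<bar>x - y\<bar> / c" using c_gt_1 by (simp add: field_simps)
  then have "\<bar>\<psi> P x - \<psi> P y\<bar> powr \<alpha> \<le> (\<bar>x - y\<bar> / c) powr \<alpha>"
    using alpha_pos by (intro powr_mono2) auto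
  also have "\<dots> = \<theta> * \<bar>x - y\<bar> powr \<alpha>"
    using c_gt_1 by (simp add: powr_divide \<theta>_def powr_minus field_simps)
  finally show ?thesis .
qed

lemma reg_branch: assumes "reg k v" "0 \<le> k" "P \<in> \<P>"
  shows "reg (\<theta> * (k + H)) (\<lambda>y. exp (\<phi> (\<psi> P y)) * v (\<psi> P y))"
proof (rule regI)
  fix x assume "x \<in> {a<..<b}"
  then show "0 \<le> exp (\<phi> (\<psi> P x)) * v (\<psi> P x)"
    using reg_nonneg[OF assms(1)] \<psi>(3)[OF assms(3)] by simp
next
  fix x y assume xy: "x \<in> {a<..<b}" "y \<in> {a<..<b}"
  let ?d = "\<bar>\<psi> P x - \<psi> P y\<bar> powr \<alpha>" and ?e = "\<bar>x - y\<bar> powr \<alpha>"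
  note 1 = \<psi>[OF assms(3) xy(1)] and 2 = \<psi>[OF assms(3) xy(2)]
  have d: "?d \<le> \<theta> * ?e" using \<psi>_contract assms(3) xy by blast
  have "\<phi> (\<psi> P x) \<le> \<phi> (\<psi> P y) + H * ?d" using holder[OF assms(3) 1(1) 2(1)] by simp
  moreover have "H * ?d \<le> H * (\<theta> * ?e)" using d H_nonneg by (rule mult_left_mono)
  ultimately have "exp (\<phi> (\<psi> P x)) \<le> exp (\<phi> (\<psi> P y)) * exp (H * (\<theta> * ?e))"
    by (simp flip: exp_add)
  moreover have "v (\<psi> P x) \<le> v (\<psi> P y) * exp (k * (\<theta> * ?e))"
  proof -
    have "v (\<psi> P x) \<le> v (\<psi> P y) * exp (k * ?d)" using regD[OF assms(1) 1(3) 2(3)] .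
    also have "\<dots> \<le> v (\<psi> P y) * exp (k * (\<theta> * ?e))"
      using reg_nonneg[OF assms(1) 2(3)] d assms(2) by (intro mult_left_mono) (auto intro: mult_left_mono)
    finally show ?thesis .
  qed
  ultimately have "exp (\<phi> (\<psi> P x)) * v (\<psi> P x)
      \<le> (exp (\<phi> (\<psi> P y)) * exp (H * (\<theta> * ?e))) * (v (\<psi> P y) * exp (k * (\<theta> * ?e)))"
    using reg_nonneg[OF assms(1) 1(3)] by (intro mult_mono) auto
  also have "\<dots> = exp (\<phi> (\<psi> P y)) * v (\<psi> P y) * (exp (H * (\<theta> * ?e)) * exp (k * (\<theta> * ?e)))"
    by (simp add: mult_ac)
  also have "exp (H * (\<theta> * ?e)) * exp (k * (\<theta> * ?e)) = exp (\<theta> * (k + H) * ?e)"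
    by (simp flip: exp_add) (simp add: algebra_simps)
  finally show "exp (\<phi> (\<psi> P x)) * v (\<psi> P x)
      \<le> exp (\<phi> (\<psi> P y)) * v (\<psi> P y) * exp (\<theta> * (k + H) * ?e)" .
qed

lemma reg_L1: assumes "reg \<kappa> v" shows "reg (\<sigma> * \<kappa>) (L (Suc 0) v)"
proof -
  have "reg (\<theta> * (\<kappa> + H)) (\<lambda>y. \<Sum>P\<in>\<P>. exp (\<phi> (\<psi> P y)) * v (\<psi> P y))"
    using assms \<kappa>_pos by (intro reg_sum reg_branch) auto
  then show ?thesis
    by (rule reg_cong[OF reg_mono[OF _ \<kappa>_step]]) (simp add: L_1)
qed

lemma \<sigma>\<kappa>_le: "\<sigma> * \<kappa> \<le> \<kappa>" using \<sigma> \<kappa>_pos by simp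

lemma same_\<psi>: assumes "P \<in> \<P>" "x \<in> {a<..<b}" "y \<in> {a<..<b}" "same n x y"
  shows "same (Suc n) (\<psi> P x) (\<psi> P y)"
  using \<psi>[OF assms(1,2)] \<psi>[OF assms(1,3)] assms P_eq unfolding same_Suc by auto

text \<open>
  Preimages of two points pair up along cylinders, and a function constant on \<open>n\<close>-cylinders
  takes the same value on both partners; multiplication by it before \<open>n\<close> steps of \<open>L\<close> therefore
  does not affect regularity. The induction peels off the first branch.
\<close>

lemma reg_L_cyl:
  assumes "reg \<kappa> v" "\<And>x. x \<in> {a<..<b} \<Longrightarrow> 0 \<le> F x"
    "\<And>x y. x \<in> {a<..<b} \<Longrightarrow> y \<in> {a<..<b} \<Longrightarrow> same n x y \<Longrightarrow> F x = F y"
  shows "reg \<kappa> (L n (\<lambda>x. F x * v x))"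
  using assms
proof (induction n arbitrary: F v)
  case 0
  have eq: "F x = F ((a+b)/2)" if "x \<in> {a<..<b}" for x
    using 0(3)[of x "(a+b)/2"] that ab by (simp add: same_def)
  have "reg \<kappa> (\<lambda>x. F x * v x)"
  proof (rule regI)
    fix x assume "x \<in> {a<..<b}"
    then show "0 \<le> F x * v x" using 0(2) reg_nonneg[OF 0(1)] by simp
  next
    fix x y assume xy: "x \<in> {a<..<b}" "y \<in> {a<..<b}"
    have "F x * v x \<le> F x * (v y * exp (\<kappa> * \<bar>x - y\<bar> powr \<alpha>))"
      using regD[OF 0(1) xy] 0(2)[OF xy(1)] by (rule mult_left_mono)
    then show "F x * v x \<le> F y * v y * exp (\<kappa> * \<bar>x - y\<bar> powr \<alpha>)"
      using eq[OF xy(1)] eq[OF xy(2)] by (simp add: mult_ac)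
  qed
  then show ?case by (rule reg_cong) simp
next
  case (Suc n)
  have "reg \<kappa> (\<lambda>y. \<Sum>P\<in>\<P>. L n (\<lambda>z. F (\<psi> P z) * (exp (\<phi> (\<psi> P z)) * v (\<psi> P z))) y)"
  proof (rule reg_sum, rule Suc.IH)
    fix P assume P: "P \<in> \<P>"
    show "reg \<kappa> (\<lambda>z. exp (\<phi> (\<psi> P z)) * v (\<psi> P z))"
      using \<kappa>_pos by (intro reg_mono[OF reg_branch[OF Suc.prems(1) _ P]] order_trans[OF \<kappa>_step \<sigma>\<kappa>_le]) auto
    show "0 \<le> F (\<psi> P x)" if "x \<in> {a<..<b}" for x using Suc.prems(2) \<psi>(3)[OF P that] by blast
    show "F (\<psi> P x) = F (\<psi> P y)" if "x \<in> {a<..<b}" "y \<in> {a<..<b}" "same n x y" for x y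
      using Suc.prems(3) \<psi>(3)[OF P that(1)] \<psi>(3)[OF P that(2)] same_\<psi>[OF P that] by blast
  qed
  then show ?case
  proof (rule reg_cong)
    fix y assume y: "y \<in> {a<..<b}"
    have "L (Suc n) (\<lambda>x. F x * v x) y = L n (L (Suc 0) (\<lambda>x. F x * v x)) y"
      using L_comp[OF y, of "Suc 0" n] by simp
    also have "\<dots> = L n (\<lambda>z. \<Sum>P\<in>\<P>. F (\<psi> P z) * (exp (\<phi> (\<psi> P z)) * v (\<psi> P z))) y"
      by (rule L_cong[OF y]) (simp add: L_1 mult_ac)
    also have "\<dots> = (\<Sum>P\<in>\<P>. L n (\<lambda>z. F (\<psi> P z) * (exp (\<phi> (\<psi> P z)) * v (\<psi> P z))) y)"
      by (rule L_sum)
    finally show "(\<Sum>P\<in>\<P>. L n (\<lambda>z. F (\<psi> P z) * (exp (\<phi> (\<psi> P z)) * v (\<psi> P z))) y)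
      = L (Suc n) (\<lambda>x. F x * v x) y" by simp
  qed
qed

lemma reg_L_cyl': assumes "reg \<kappa> v" "\<And>x. x \<in> {a..b} \<Longrightarrow> 0 \<le> F x" "cylfun n F"
  shows "reg \<kappa> (L n (\<lambda>x. F x * v x))"
proof (rule reg_L_cyl[OF assms(1)])
  show "0 \<le> F x" if "x \<in> {a<..<b}" for x using assms(2)[of x] that by simp
  show "F x = F y" if "x \<in> {a<..<b}" "y \<in> {a<..<b}" "same n x y" for x y
    by (rule cylfunD[OF assms(3)]) (use that in simp_all)
qed

lemma reg_L: assumes "reg \<kappa> v" shows "reg \<kappa> (L n v)"
  using reg_L_cyl[OF assms, of "\<lambda>_. 1" n] by simp

lemma reg_L_indep: assumes "cylfun n F" "\<And>x. x \<in> {a..b} \<Longrightarrow> 0 \<le> F x" shows "reg \<kappa> (L n F)"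
  using reg_L_cyl'[OF reg_one assms(2,1)] by simp

text \<open>
  The fraction of a function of the inner cone that may be replaced by another one without
  leaving the outer cone.
\<close>

definition \<rho> :: real where "\<rho> = (1 - \<sigma>) / (1 + \<sigma>)"

lemma \<rho>: "0 < \<rho>" "\<rho> < 1" using \<sigma> by (auto simp: \<rho>_def)

text \<open>
  Convexity of \<open>exp\<close>: the number \<open>\<sigma> * s\<close> is the convex combination of \<open>s\<close> and \<open>- \<sigma> * s\<close> with
  weights \<open>1 - \<rho>\<close> and \<open>\<rho>\<close>.
\<close>

lemma exp_cone: assumes "0 \<le> (s::real)"
  shows "\<rho> * (exp s - exp (- \<sigma> * s)) \<le> exp s - exp (\<sigma> * s)"
proof -
  have "exp ((1 - \<rho>) *\<^sub>R s + \<rho> *\<^sub>R (- \<sigma> * s)) \<le> (1 - \<rho>) * exp s + \<rho> * exp (- \<sigma> * s)"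
    using convex_onD[OF exp_convex, of \<rho> s "- \<sigma> * s"] \<rho> by simp
  moreover have "(1 - \<rho>) *\<^sub>R s + \<rho> *\<^sub>R (- \<sigma> * s) = \<sigma> * s"
  proof -
    have "\<rho> * (1 + \<sigma>) = 1 - \<sigma>" using \<sigma> by (simp add: \<rho>_def)
    moreover have "(1 - \<rho>) *\<^sub>R s + \<rho> *\<^sub>R (- \<sigma> * s) = s - \<rho> * (1 + \<sigma>) * s" by (simp add: algebra_simps)
    ultimately have "(1 - \<rho>) *\<^sub>R s + \<rho> *\<^sub>R (- \<sigma> * s) = s - (1 - \<sigma>) * s" by (simp only:)
    then show ?thesis by (simp add: left_diff_distrib)
  qed
  ultimately have "exp (\<sigma> * s) \<le> (1 - \<rho>) * exp s + \<rho> * exp (- \<sigma> * s)" by (simp only:)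
  then show ?thesis by (simp add: left_diff_distrib right_diff_distrib)
qed

lemma reg_subtract:
  assumes v: "reg (\<sigma> * \<kappa>) v" and u: "reg (\<sigma> * \<kappa>) u"
    and t: "0 \<le> t" "\<And>x. x \<in> {a<..<b} \<Longrightarrow> t * u x \<le> \<rho> * v x"
  shows "reg \<kappa> (\<lambda>x. v x - t * u x)"
proof (rule regI)
  fix x assume x: "x \<in> {a<..<b}"
  show "0 \<le> v x - t * u x"
    using t(2)[OF x] reg_nonneg[OF v x] \<rho> mult_right_mono[of \<rho> 1 "v x"] by auto
next
  fix x y assume xy: "x \<in> {a<..<b}" "y \<in> {a<..<b}"
  let ?s = "\<kappa> * \<bar>x - y\<bar> powr \<alpha>"
  have s: "0 \<le> ?s" using \<kappa>_pos by simp
  have 1: "v x \<le> v y * exp (\<sigma> * ?s)" using regD[OF v xy] by (simp add: mult_ac)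
  have "u y \<le> u x * exp (\<sigma> * ?s)" using regD[OF u xy(2,1)] by (simp add: mult_ac abs_minus_commute)
  then have 2: "u y * exp (- \<sigma> * ?s) \<le> u x" by (simp add: exp_minus field_simps)
  have "t * u y * (exp ?s - exp (- \<sigma> * ?s)) \<le> (\<rho> * v y) * (exp ?s - exp (- \<sigma> * ?s))"
  proof (rule mult_right_mono[OF t(2)[OF xy(2)]])
    have "0 \<le> \<sigma> * ?s" by (rule mult_nonneg_nonneg[OF less_imp_le[OF \<sigma>(1)] s])
    then have "- \<sigma> * ?s \<le> ?s" using s by linarith
    then show "0 \<le> exp ?s - exp (- \<sigma> * ?s)" by simp
  qed
  also have "\<dots> \<le> v y * (exp ?s - exp (\<sigma> * ?s))"
    using mult_left_mono[OF exp_cone[OF s] reg_nonneg[OF v xy(2)]] by (simp only: mult_ac)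
  finally have 3: "t * u y * (exp ?s - exp (- \<sigma> * ?s)) \<le> v y * (exp ?s - exp (\<sigma> * ?s))" .
  have "t * (u y * exp (- \<sigma> * ?s)) \<le> t * u x" using 2 t(1) by (rule mult_left_mono)
  then show "v x - t * u x \<le> (v y - t * u y) * exp ?s"
    using 1 3 by (simp add: algebra_simps)
qed

definition ratio_bound :: real where "ratio_bound = exp (2 * \<kappa> * (b - a) powr \<alpha>)"
definition \<gamma> :: real where "\<gamma> = 1 - \<rho> / ratio_bound\<^sup>2"
definition K where "K = ratio_bound\<^sup>2"

lemma ratio_bound: "1 \<le> ratio_bound"
proof -
  have "0 \<le> 2 * \<kappa> * (b - a) powr \<alpha>" using less_imp_le[OF \<kappa>_pos] by (intro mult_nonneg_nonneg) simp_all
  then show ?thesis unfolding ratio_bound_def by (subst one_le_exp_iff)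
qed

lemma K: "1 \<le> K" unfolding K_def using ratio_bound by (rule one_le_power)

lemma \<gamma>: "0 < \<gamma>" "\<gamma> < 1"
proof -
  have B: "1 \<le> ratio_bound\<^sup>2" using ratio_bound by (rule one_le_power)
  have "\<rho> / ratio_bound\<^sup>2 < 1" using \<rho> B by (subst divide_less_eq_1_pos; linarith)
  moreover have "0 < \<rho> / ratio_bound\<^sup>2" using \<rho>(1) B by (rule divide_pos_pos[OF _ less_le_trans[OF zero_less_one]])
  ultimately show "0 < \<gamma>" "\<gamma> < 1" by (simp_all add: \<gamma>_def)
qed

lemma reg_ratio: assumes v: "reg \<kappa> v" and u: "reg \<kappa> u" and xy: "x \<in> {a<..<b}" "y \<in> {a<..<b}"
  shows "v x * u y \<le> ratio_bound * (v y * u x)"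
proof -
  define d where "d = \<kappa> * \<bar>x - y\<bar> powr \<alpha>"
  have "\<bar>x - y\<bar> \<le> b - a" using xy by (simp add: abs_if)
  then have "\<bar>x - y\<bar> powr \<alpha> \<le> (b - a) powr \<alpha>" using alpha_pos by (intro powr_mono2) simp_all
  then have "d \<le> \<kappa> * (b - a) powr \<alpha>" unfolding d_def by (rule mult_left_mono[OF _ less_imp_le[OF \<kappa>_pos]])
  then have "2 * d \<le> 2 * (\<kappa> * (b - a) powr \<alpha>)" by (rule mult_left_mono) simp
  then have ratio_bound': "exp (2 * d) \<le> ratio_bound" unfolding ratio_bound_def mult.assoc by (subst exp_le_cancel_iff)
  have 1: "v x \<le> v y * exp d" using regD[OF v xy] by (simp add: d_def)
  have 2: "u y \<le> u x * exp d" using regD[OF u xy(2,1)] by (simp add: abs_minus_commute d_def)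
  note nn = reg_nonneg[OF v xy(1)] reg_nonneg[OF v xy(2)] reg_nonneg[OF u xy(1)] reg_nonneg[OF u xy(2)]
  have "v x * u y \<le> (v y * exp d) * (u x * exp d)"
    by (rule mult_mono[OF 1 2]) (simp_all add: nn)
  also have "\<dots> = (v y * u x) * exp (2 * d)" unfolding mult_2 exp_add by (simp only: mult_ac)
  also have "\<dots> \<le> (v y * u x) * ratio_bound"
    by (rule mult_left_mono[OF ratio_bound' mult_nonneg_nonneg[OF nn(2,3)]])
  finally show ?thesis by (simp only: mult_ac)
qed

text \<open>
  After each step a fixed fraction of what is left of \<open>v\<close> can be split off as a multiple of the
  image of \<open>u\<close>: the remainder is in the inner cone, where it is comparable with that image, and
  \<open>reg_subtract\<close> keeps the difference in the outer cone. So the part not proportional to the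
  image of \<open>u\<close> shrinks by the factor \<open>\<gamma>\<close> per step.
\<close>

lemma decay:
  assumes v: "reg \<kappa> v" and u: "reg \<kappa> u" "\<And>x. x \<in> {a<..<b} \<Longrightarrow> 0 < u x"
    and T: "0 \<le> T" "\<And>x. x \<in> {a<..<b} \<Longrightarrow> v x \<le> T * u x"
  shows "\<exists>s\<ge>0. reg \<kappa> (\<lambda>x. L n v x - s * L n u x) \<and>
           (\<forall>x\<in>{a<..<b}. L n v x - s * L n u x \<le> T * \<gamma> ^ n * L n u x)"
proof (induction n)
  case 0
  have "reg \<kappa> (\<lambda>x. L 0 v x - 0 * L 0 u x)" by (rule reg_cong[OF v]) simp
  then show ?case using T by (intro exI[of _ 0]) auto
next
  case (Suc n)
  then obtain s where s: "0 \<le> s" "reg \<kappa> (\<lambda>x. L n v x - s * L n u x)"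
    "\<forall>x\<in>{a<..<b}. L n v x - s * L n u x \<le> T * \<gamma> ^ n * L n u x" by blast
  define y0 where "y0 = (a + b) / 2"
  have y0: "y0 \<in> {a<..<b}" using ab by (simp add: y0_def)
  define r where "r = L (Suc 0) (\<lambda>x. L n v x - s * L n u x)"
  define w where "w = L (Suc n) u"
  have LS: "L (Suc 0) (L n q) x = L (Suc n) q x" if "x \<in> {a<..<b}" for x q
    using L_comp[OF that, of n "Suc 0" q] by simp
  have r_eq: "r x = L (Suc n) v x - s * w x" if "x \<in> {a<..<b}" for x
    unfolding r_def w_def L_diff L_scale using LS that by simp
  have rr: "reg (\<sigma> * \<kappa>) r" unfolding r_def by (rule reg_L1[OF s(2)])
  have rw: "reg (\<sigma> * \<kappa>) w"
    by (rule reg_cong[OF reg_L1[OF reg_L[OF u(1), of n]]]) (simp add: LS w_def)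
  have wpos: "0 < w x" if "x \<in> {a<..<b}" for x unfolding w_def by (rule L_pos[OF that u(2)])
  have rle: "r x \<le> T * \<gamma> ^ n * w x" if x: "x \<in> {a<..<b}" for x
  proof -
    have "r x \<le> L (Suc 0) (\<lambda>x. T * \<gamma> ^ n * L n u x) x"
      unfolding r_def using s(3) by (intro L_mono[OF x]) blast
    then show ?thesis using LS[OF x] by (simp add: L_scale w_def)
  qed
  \<comment> \<open>The quotient at the midpoint stands in for the infimum of \<open>r / w\<close>, from which it
      differs at most by the factor given by \<open>reg_ratio\<close>.\<close>
  define q where "q = r y0 / w y0"
  have q: "0 \<le> q" unfolding q_def using wpos[OF y0] reg_nonneg[OF rr y0] by simp
  define t where "t = \<rho> * q / ratio_bound"
  have t0: "0 \<le> t" using q \<rho> ratio_bound by (simp add: t_def)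
  have rq: "q * w x \<le> ratio_bound * r x" "r x \<le> ratio_bound * q * w x" if x: "x \<in> {a<..<b}" for x
    using reg_ratio[OF reg_mono[OF rr \<sigma>\<kappa>_le] reg_mono[OF rw \<sigma>\<kappa>_le] y0 x]
      reg_ratio[OF reg_mono[OF rr \<sigma>\<kappa>_le] reg_mono[OF rw \<sigma>\<kappa>_le] x y0] wpos[OF y0]
    by (auto simp: q_def field_simps)
  have t1: "t * w x \<le> \<rho> * r x" if x: "x \<in> {a<..<b}" for x
    using mult_left_mono[OF rq(1)[OF x], of \<rho>] \<rho> ratio_bound by (simp add: t_def field_simps)
  have reg': "reg \<kappa> (\<lambda>x. r x - t * w x)"
    by (rule reg_subtract[OF rr rw t0 t1])
  have le': "r x - t * w x \<le> T * \<gamma> ^ Suc n * w x" if x: "x \<in> {a<..<b}" for x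
  proof -
    have "\<rho> / ratio_bound\<^sup>2 * r x \<le> \<rho> / ratio_bound\<^sup>2 * (ratio_bound * q * w x)" using rq(2)[OF x] \<rho> by (intro mult_left_mono) auto
    also have "\<dots> = t * w x" using ratio_bound by (simp add: t_def power2_eq_square)
    finally have "r x - t * w x \<le> \<gamma> * r x" by (simp add: \<gamma>_def algebra_simps)
    also have "\<dots> \<le> \<gamma> * (T * \<gamma> ^ n * w x)" using rle[OF x] \<gamma> by (intro mult_left_mono) auto
    finally show ?thesis by (simp add: mult_ac)
  qed
  have eq: "r x - t * w x = L (Suc n) v x - (s + t) * L (Suc n) u x" if "x \<in> {a<..<b}" for x
    using r_eq[OF that] by (simp add: w_def algebra_simps)
  show ?case
  proof (intro exI[of _ "s + t"] conjI ballI)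
    show "0 \<le> s + t" using s t0 by simp
    show "reg \<kappa> (\<lambda>x. L (Suc n) v x - (s + t) * L (Suc n) u x)"
      by (rule reg_cong[OF reg' eq])
    show "L (Suc n) v x - (s + t) * L (Suc n) u x \<le> T * \<gamma> ^ Suc n * L (Suc n) u x" if "x \<in> {a<..<b}" for x
      using le'[OF that] eq[OF that] by (simp add: w_def)
  qed
qed

text \<open>
  The quotient of the images of \<open>v\<close> and \<open>u\<close> is constant up to a factor \<open>1 + K * \<gamma> ^ n\<close>. The
  product form avoids division and is symmetric in the two points, so that it can be summed over
  pairs of preimages.
\<close>

lemma cross_ratio:
  assumes v: "reg \<kappa> v" and u: "reg \<kappa> u" "\<And>x. x \<in> {a<..<b} \<Longrightarrow> 0 < u x"
    and xy: "x \<in> {a<..<b}" "y \<in> {a<..<b}"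
  shows "L n v x * L n u y \<le> (1 + K * \<gamma> ^ n) * (L n v y * L n u x)"
proof -
  define q where "q = v y / u y"
  have q: "0 \<le> q" using reg_nonneg[OF v xy(2)] u(2)[OF xy(2)] by (simp add: q_def)
  have qv: "q * u z \<le> ratio_bound * v z" "v z \<le> ratio_bound * q * u z" if "z \<in> {a<..<b}" for z
    using reg_ratio[OF v u(1) xy(2) that] reg_ratio[OF v u(1) that xy(2)] u(2)[OF xy(2)]
    by (auto simp: q_def field_simps)
  obtain s where s: "0 \<le> s" "reg \<kappa> (\<lambda>x. L n v x - s * L n u x)"
    "\<forall>x\<in>{a<..<b}. L n v x - s * L n u x \<le> ratio_bound * q * \<gamma> ^ n * L n u x"
    using decay[OF v u, of "ratio_bound * q" n] qv q ratio_bound by force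
  let ?X = "L n u x" and ?Y = "L n u y"
  have pos: "0 < ?X" "0 < ?Y" using L_pos u(2) xy by blast+
  have up: "L n v x \<le> (s + ratio_bound * q * \<gamma> ^ n) * ?X" using s(3) xy by (simp add: algebra_simps)
  have lo1: "s * ?Y \<le> L n v y" using reg_nonneg[OF s(2) xy(2)] by simp
  have lo2: "q * ?Y \<le> ratio_bound * L n v y"
    using L_mono[OF xy(2), of "\<lambda>z. q * u z" "\<lambda>z. ratio_bound * v z" n] qv(1) by (simp add: L_scale)
  have "L n v x * ?Y \<le> (s + ratio_bound * q * \<gamma> ^ n) * ?X * ?Y" using up pos by (intro mult_right_mono) auto
  also have "\<dots> = (s * ?Y) * ?X + (ratio_bound * \<gamma> ^ n * ?X) * (q * ?Y)" by (simp add: algebra_simps)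
  also have "\<dots> \<le> L n v y * ?X + (ratio_bound * \<gamma> ^ n * ?X) * (ratio_bound * L n v y)"
    using lo1 lo2 pos ratio_bound \<gamma> by (intro add_mono mult_right_mono mult_left_mono mult_nonneg_nonneg) auto
  also have "\<dots> = (1 + K * \<gamma> ^ n) * (L n v y * ?X)" by (simp add: K_def power2_eq_square algebra_simps)
  finally show ?thesis .
qed

definition \<eta> :: "nat \<Rightarrow> real" where "\<eta> g = K * \<gamma> ^ g"

lemma \<eta>_nonneg: "0 \<le> \<eta> g" using K \<gamma> by (simp add: \<eta>_def)

lemma \<eta>_0: "\<eta> 0 = K" by (simp add: \<eta>_def)

lemma \<eta>_le_K: "\<eta> g \<le> K" using K \<gamma> power_le_one[of \<gamma> g] by (simp add: \<eta>_def mult_left_le)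

definition y0 :: real where "y0 = (a + b) / 2"

lemma y0: "y0 \<in> {a<..<b}" using ab by (simp add: y0_def)

text \<open>
  The mean over the \<open>N\<close>-th preimages of the base point with weights
  \<open>exp (birkhoff_sum f \<phi> N x)\<close>.
\<close>

definition E :: "nat \<Rightarrow> (real \<Rightarrow> real) \<Rightarrow> real" where
  "E N F = L N F y0 / L N (\<lambda>x. 1) y0"

lemma Z_pos: "0 < L N (\<lambda>x. 1) y0" by (rule L_pos[OF y0]) simp

lemma E_mono: "(\<And>x. x \<in> {a<..<b} \<Longrightarrow> F x \<le> G x) \<Longrightarrow> E N F \<le> E N G"
  unfolding E_def by (intro divide_right_mono L_mono[OF y0]) (use Z_pos[of N] in auto)

lemma E_const [simp]: "E N (\<lambda>x. k) = k"
  using L_scale[of N k "\<lambda>_. 1" y0] Z_pos[of N] by (simp add: E_def)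

lemma E_plus: "E N (\<lambda>x. F x + G x) = E N F + E N G" by (simp add: E_def L_plus add_divide_distrib)
lemma E_diff: "E N (\<lambda>x. F x - G x) = E N F - E N G" by (simp add: E_def L_diff diff_divide_distrib)
lemma E_scale: "E N (\<lambda>x. s * F x) = s * E N F" by (simp add: E_def L_scale)
lemma E_sum: "E N (\<lambda>x. \<Sum>i\<in>A. F i x) = (\<Sum>i\<in>A. E N (F i))" by (simp add: E_def L_sum sum_divide_distrib)
lemma E_nonneg: "(\<And>x. x \<in> {a<..<b} \<Longrightarrow> 0 \<le> F x) \<Longrightarrow> 0 \<le> E N F"
  using E_mono[of "\<lambda>_. 0" F N] by simp
lemma E_cong: "(\<And>x. x \<in> {a<..<b} \<Longrightarrow> F x = G x) \<Longrightarrow> E N F = E N G"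
  by (intro antisym E_mono) (simp_all del: greaterThanLessThan_iff)

lemma L_double:
  assumes y: "y \<in> {a<..<b}"
    and le: "\<And>x z. x \<in> {a<..<b} \<Longrightarrow> z \<in> {a<..<b} \<Longrightarrow> A x * B z \<le> C x * D z"
  shows "L k A y * L m B y \<le> L k C y * L m D y"
proof -
  have "L k A y * L m B y = (\<Sum>x\<in>pre k y. \<Sum>z\<in>pre m y.
      (exp (birkhoff_sum f \<phi> k x) * exp (birkhoff_sum f \<phi> m z)) * (A x * B z))"
    unfolding L_def sum_product by (simp add: mult_ac)
  also have "\<dots> \<le> (\<Sum>x\<in>pre k y. \<Sum>z\<in>pre m y.
      (exp (birkhoff_sum f \<phi> k x) * exp (birkhoff_sum f \<phi> m z)) * (C x * D z))"
    using le pre_in[OF _ y] by (intro sum_mono mult_left_mono) auto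
  also have "\<dots> = L k C y * L m D y"
    unfolding L_def sum_product by (simp add: mult_ac)
  finally show ?thesis .
qed

lemma L_shift: assumes y: "y \<in> {a<..<b}"
  shows "L (n + k) (\<lambda>x. F x * G ((f ^^ n) x)) y = L k (\<lambda>x. L n F x * G x) y"
proof -
  have "L n (\<lambda>x. F x * G ((f ^^ n) x)) = (\<lambda>x. L n F x * G x)" by (rule ext) (rule L_pull)
  then show ?thesis by (simp only: L_comp[OF y])
qed

lemma L_one_pos: "x \<in> {a<..<b} \<Longrightarrow> 0 < L n (\<lambda>x. 1) x" by (rule L_pos) auto

text \<open>
  With the normalisation cleared, both sides are double sums over preimages of order \<open>N - n - g\<close>
  of the base point, and they are compared term by term with \<open>cross_ratio\<close>: the factor \<open>F\<close>
  enters through \<open>L n F\<close> and is forgotten after \<open>g\<close> further steps. For \<open>g = 0\<close> this is the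
  statement that past and future are independent up to a constant factor.
\<close>

lemma mixing:
  assumes F: "cylfun n F" "\<And>x. x \<in> {a..b} \<Longrightarrow> 0 \<le> F x"
    and G: "\<And>x. x \<in> {a<..<b} \<Longrightarrow> 0 \<le> G x" and N: "n + g \<le> N"
  shows "E N (\<lambda>x. F x * G ((f ^^ (n + g)) x)) \<le> (1 + \<eta> g) * (E N F * E N (\<lambda>x. G ((f ^^ (n + g)) x)))"
    and "E N F * E N (\<lambda>x. G ((f ^^ (n + g)) x)) \<le> (1 + \<eta> g) * E N (\<lambda>x. F x * G ((f ^^ (n + g)) x))"
proof -
  define k where "k = N - (n + g)"
  have N': "N = (n + g) + k" using N by (simp add: k_def)
  let ?v = "L (n + g) F" and ?u = "L (n + g) (\<lambda>x. 1)"
  have v: "reg \<kappa> (L n F)" by (rule reg_L_indep[OF F])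
  have u: "reg \<kappa> (L n (\<lambda>x. 1))" by (rule reg_L[OF reg_one])
  have cr: "?v x * ?u z \<le> (1 + \<eta> g) * (?v z * ?u x)" if "x \<in> {a<..<b}" "z \<in> {a<..<b}" for x z
    using cross_ratio[OF v u L_one_pos that, of g] that by (simp add: L_comp \<eta>_def)
  have 1: "L N (\<lambda>x. F x * G ((f ^^ (n + g)) x)) y0 = L k (\<lambda>x. ?v x * G x) y0"
    and 2: "L N (\<lambda>x. G ((f ^^ (n + g)) x)) y0 = L k (\<lambda>x. ?u x * G x) y0"
    and 3: "L N F y0 = L k ?v y0" and 4: "L N (\<lambda>x. 1) y0 = L k ?u y0"
    unfolding N' using L_shift[OF y0, of "n+g" k F G] L_shift[OF y0, of "n+g" k "\<lambda>_. 1" G]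
    by (simp_all add: L_comp[OF y0, of "n + g" k])
  have Z: "0 < L k ?u y0" using Z_pos[of N] 4 by simp
  have "L k (\<lambda>x. ?v x * G x) y0 * L k ?u y0 \<le> L k (\<lambda>x. ?u x * G x) y0 * L k (\<lambda>z. (1 + \<eta> g) * ?v z) y0"
  proof (rule L_double[OF y0])
    fix x z assume xz: "x \<in> {a<..<b}" "z \<in> {a<..<b}"
    show "?v x * G x * ?u z \<le> ?u x * G x * ((1 + \<eta> g) * ?v z)"
      using mult_left_mono[OF cr[OF xz] G[OF xz(1)]] by (simp add: mult_ac)
  qed
  then show "E N (\<lambda>x. F x * G ((f ^^ (n + g)) x)) \<le> (1 + \<eta> g) * (E N F * E N (\<lambda>x. G ((f ^^ (n + g)) x)))"
    unfolding E_def 1 2 3 4 L_scale using Z by (simp add: field_simps)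
  have "L k ?v y0 * L k (\<lambda>x. ?u x * G x) y0 \<le> L k ?u y0 * L k (\<lambda>z. (1 + \<eta> g) * (?v z * G z)) y0"
  proof (rule L_double[OF y0])
    fix x z assume xz: "x \<in> {a<..<b}" "z \<in> {a<..<b}"
    show "?v x * (?u z * G z) \<le> ?u x * ((1 + \<eta> g) * (?v z * G z))"
      using mult_left_mono[OF cr[OF xz] G[OF xz(2)]] by (simp add: mult_ac)
  qed
  then show "E N F * E N (\<lambda>x. G ((f ^^ (n + g)) x)) \<le> (1 + \<eta> g) * E N (\<lambda>x. F x * G ((f ^^ (n + g)) x))"
    unfolding E_def 1 2 3 4 L_scale using Z by (simp add: field_simps)
qed

text \<open>
  The distribution of the orbit at a time that is at least \<open>g\<close> away from both ends of the window
  hardly depends on where the ends are: changing the number of steps before it is a comparison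
  of \<open>L i 1\<close> with \<open>L i' 1\<close>, changing the number of steps after it compares values at different
  base points.
\<close>

lemma marginal_compare:
  assumes A: "cylfun q A" "\<And>x. x \<in> {a..b} \<Longrightarrow> 0 \<le> A x"
    and i: "g \<le> i" "g \<le> i'" and n: "q + g \<le> n" "q + g \<le> n'"
  shows "E (i + n) (\<lambda>x. A ((f ^^ i) x)) \<le> (1 + \<eta> g)\<^sup>2 * E (i' + n') (\<lambda>x. A ((f ^^ i') x))"
proof -
  let ?\<beta> = "\<lambda>n i. L n (\<lambda>x. L i (\<lambda>x. 1) x * A x) y0 / L n (L i (\<lambda>x. 1)) y0"
  have E\<beta>: "E (i + n) (\<lambda>x. A ((f ^^ i) x)) = ?\<beta> n i" for i n
    unfolding E_def using L_shift[OF y0, of i n "\<lambda>_. 1" A] by (simp add: L_comp[OF y0])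
  have pos: "0 < L n (L i (\<lambda>x. 1)) y0" for n i by (intro L_pos y0 L_one_pos)
  have A': "0 \<le> A x" if "x \<in> {a<..<b}" for x using A that by auto
  have reg1: "reg \<kappa> (L m (\<lambda>x. 1))" for m by (rule reg_L[OF reg_one])
  have A1: "?\<beta> n i \<le> (1 + \<eta> g) * ?\<beta> n i'"
  proof -
    have "L n (\<lambda>x. L i (\<lambda>x. 1) x * A x) y0 * L n (L i' (\<lambda>x. 1)) y0
        \<le> L n (\<lambda>x. L i' (\<lambda>x. 1) x * A x) y0 * L n (\<lambda>x. (1 + \<eta> g) * L i (\<lambda>x. 1) x) y0"
    proof (rule L_double[OF y0])
      fix x z assume xz: "x \<in> {a<..<b}" "z \<in> {a<..<b}"
      have "L i (\<lambda>x. 1) x * L i' (\<lambda>x. 1) z \<le> (1 + \<eta> g) * (L i (\<lambda>x. 1) z * L i' (\<lambda>x. 1) x)"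
        using cross_ratio[OF reg1[of "i - g"] reg1[of "i' - g"] L_one_pos xz, of g] i
        by (simp add: L_comp[symmetric] xz \<eta>_def del: greaterThanLessThan_iff)
      from mult_left_mono[OF this A'[OF xz(1)]]
      show "L i (\<lambda>x. 1) x * A x * L i' (\<lambda>x. 1) z \<le> L i' (\<lambda>x. 1) x * A x * ((1 + \<eta> g) * L i (\<lambda>x. 1) z)"
        by (simp add: mult_ac)
    qed
    note this[unfolded L_scale]
    then show ?thesis using pos[of n i] pos[of n i'] by (simp add: field_simps)
  qed
  have A2: "?\<beta> n i' \<le> (1 + \<eta> g) * ?\<beta> n' i'"
  proof -
    let ?v = "L q (\<lambda>x. L i' (\<lambda>x. 1) x * A x)" and ?u = "L q (L i' (\<lambda>x. 1))"
    have v: "reg \<kappa> ?v" using reg_L_cyl'[OF reg1[of i'] A(2,1)] by (simp add: mult.commute)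
    have u: "reg \<kappa> ?u" by (rule reg_L[OF reg1])
    have upos: "0 < ?u x" if "x \<in> {a<..<b}" for x by (intro L_pos that L_one_pos)
    have split: "L m w y0 = L (m - (q + g)) (L g (L q w)) y0" if "q + g \<le> m" for m w
    proof -
      have "L m w y0 = L ((q + g) + (m - (q + g))) w y0" using that by simp
      also have "\<dots> = L (m - (q + g)) (L (q + g) w) y0" by (rule L_comp[OF y0])
      also have "\<dots> = L (m - (q + g)) (L g (L q w)) y0" by (rule L_cong[OF y0]) (rule L_comp)
      finally show ?thesis .
    qed
    have "L (n - (q + g)) (L g ?v) y0 * L (n' - (q + g)) (L g ?u) y0
        \<le> L (n - (q + g)) (L g ?u) y0 * L (n' - (q + g)) (\<lambda>x. (1 + \<eta> g) * L g ?v x) y0"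
      by (rule L_double[OF y0]) (use cross_ratio[OF v u upos, of _ _ g] in \<open>simp add: \<eta>_def mult_ac\<close>)
    then have "L n (\<lambda>x. L i' (\<lambda>x. 1) x * A x) y0 * L n' (L i' (\<lambda>x. 1)) y0
       \<le> L n (L i' (\<lambda>x. 1)) y0 * ((1 + \<eta> g) * L n' (\<lambda>x. L i' (\<lambda>x. 1) x * A x) y0)"
      using split[OF n(1)] split[OF n(2)] by (simp add: L_scale)
    then show ?thesis using pos[of n i'] pos[of n' i'] by (simp add: field_simps)
  qed
  have "?\<beta> n i \<le> (1 + \<eta> g) * ((1 + \<eta> g) * ?\<beta> n' i')"
    using A1 mult_left_mono[OF A2, of "1 + \<eta> g"] \<eta>_nonneg[of g] by linarith
  then show ?thesis by (simp add: E\<beta> power2_eq_square mult.assoc)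
qed

end

section \<open>The Gibbs measure and the functionals of the transfer operator\<close>

lemma funpow_measure_preserving:
  assumes "f \<in> measurable M M" "distr M M f = M"
  shows "f ^^ n \<in> measurable M M" "distr M M (f ^^ n) = M"
proof -
  have "f ^^ n \<in> measurable M M \<and> distr M M (f ^^ n) = M"
  proof (induction n)
    case 0 then show ?case by (simp add: id_def distr_id)
  next
    case (Suc n)
    then show ?case
      using measurable_comp[of "f ^^ n" M M f M] distr_distr[of f M M "f ^^ n" M] assms
      by (simp only: funpow.simps)
  qed
  then show "f ^^ n \<in> measurable M M" "distr M M (f ^^ n) = M" by auto
qed

text \<open>
  The Gibbs inequalities are stated for the classes of \<open>same\<close>, including \<open>n = 0\<close>, where the
  class is the whole interval.
\<close>

locale gibbs_measure = branch_coding a b \<P> f \<phi> c \<alpha> H + prob_space \<mu>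
  for a b :: real and \<P> :: "real set set" and f \<phi> :: "real \<Rightarrow> real" and c \<alpha> H :: real
    and \<mu> :: "real measure" +
  fixes Cg :: real
  assumes sets_\<mu>: "sets \<mu> = sets (restrict_space borel {a..b})"
    and P_sets: "\<And>P. P \<in> \<P> \<Longrightarrow> P \<in> sets \<mu>"
    and f_meas: "f \<in> measurable \<mu> \<mu>"
    and inv: "distr \<mu> \<mu> f = \<mu>"
    and Cg: "1 \<le> Cg"
    and gibbs_lower: "\<And>x n. x \<in> {a..b} \<Longrightarrow>
        exp (birkhoff_sum f \<phi> n x) \<le> Cg * measure \<mu> {z \<in> {a..b}. same n x z}"
    and gibbs_upper: "\<And>x n. x \<in> {a..b} \<Longrightarrow>
        measure \<mu> {z \<in> {a..b}. same n x z} \<le> Cg * exp (birkhoff_sum f \<phi> n x)"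
begin

lemma space_\<mu>: "space \<mu> = {a..b}"
  using sets_eq_imp_space_eq[OF sets_\<mu>] by (simp add: space_restrict_space)

lemma borel_sets_\<mu>: "S \<in> sets borel \<Longrightarrow> S \<inter> {a..b} \<in> sets \<mu>"
  unfolding sets_\<mu> sets_restrict_space by auto

definition cell :: "nat \<Rightarrow> real \<Rightarrow> real set" where
  "cell n x = {z \<in> {a..b}. same n x z}"

definition cylset :: "nat \<Rightarrow> real set \<Rightarrow> bool" where
  "cylset n S \<longleftrightarrow> S \<subseteq> {a..b} \<and> cylfun n (\<lambda>x. x \<in> S)"

lemmas fn_meas = funpow_measure_preserving(1)[OF f_meas inv]
  and fn_inv = funpow_measure_preserving(2)[OF f_meas inv]

lemma cell_Int: "cell n x \<inter> {a..b} = cell n x" by (auto simp: cell_def)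

lemma cell_sets: "cell n x \<in> sets \<mu>"
proof -
  have "cell n x = {z \<in> space \<mu>. \<forall>i\<in>{..<n}. \<forall>P\<in>\<P>. ((f ^^ i) x \<in> P) = ((f ^^ i) z \<in> P)}"
    by (auto simp: cell_def same_def space_\<mu>)
  also have "\<dots> \<in> sets \<mu>"
  proof (intro sets.sets_Collect_finite_All)
    fix i P assume "P \<in> \<P>"
    then have "{z \<in> space \<mu>. (f ^^ i) z \<in> P} \<in> sets \<mu>"
      using measurable_sets[OF fn_meas P_sets, of P i] by (simp add: vimage_def Int_def conj_commute)
    then show "{z \<in> space \<mu>. ((f ^^ i) x \<in> P) = ((f ^^ i) z \<in> P)} \<in> sets \<mu>"
      by (cases "(f ^^ i) x \<in> P") (auto intro: sets.sets_Collect_neg)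
  qed (use finite_P in auto)
  finally show ?thesis .
qed

lemma cyl_decomp:
  fixes F :: "real \<Rightarrow> real"
  assumes F: "cylfun n F" and z: "z \<in> {a..b}"
  shows "F z = (\<Sum>x\<in>pre n y0. F x * indicator (cell n x) z)"
proof -
  obtain x where x: "x \<in> pre n y0" "same n z x" "\<And>x'. x' \<in> pre n y0 \<Longrightarrow> same n z x' \<Longrightarrow> x' = x"
    using ex1_pre_same[OF z y0, of n] by blast
  have xI: "x \<in> {a..b}" using x(1) by (simp add: pre_def)
  have "(\<Sum>x\<in>pre n y0. F x * indicator (cell n x) z) = (\<Sum>x'\<in>{x}. F x' * indicator (cell n x') z)"
    using x(1,3) by (intro sum.mono_neutral_right finite_pre y0)
      (auto simp: indicator_def cell_def dest: same_sym)
  also have "\<dots> = F x" using z same_sym[OF x(2)] by (simp add: cell_def)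
  also have "\<dots> = F z" using cylfunD[OF F z xI x(2)] by simp
  finally show ?thesis by simp
qed

lemma cyl_integral:
  fixes F :: "real \<Rightarrow> real"
  assumes F: "cylfun n F"
  shows "integrable \<mu> F" "integral\<^sup>L \<mu> F = (\<Sum>x\<in>pre n y0. F x * measure \<mu> (cell n x))"
proof -
  have i: "integrable \<mu> (\<lambda>z. F x * indicator (cell n x) z)" for x
    using cell_sets by (intro integrable_mult_right integrable_real_indicator) (auto simp: emeasure_eq_measure)
  have "integrable \<mu> (\<lambda>z. \<Sum>x\<in>pre n y0. F x * indicator (cell n x) z)" using i by (intro Bochner_Integration.integrable_sum) 
  then show "integrable \<mu> F"
    by (rule Bochner_Integration.integrable_cong[THEN iffD1, rotated 2]) (use cyl_decomp[OF F] space_\<mu> in auto)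
  have "integral\<^sup>L \<mu> F = integral\<^sup>L \<mu> (\<lambda>z. \<Sum>x\<in>pre n y0. F x * indicator (cell n x) z)"
    by (rule Bochner_Integration.integral_cong[OF refl]) (use cyl_decomp[OF F] space_\<mu> in auto)
  also have "\<dots> = (\<Sum>x\<in>pre n y0. F x * measure \<mu> (cell n x))"
    using i by (subst Bochner_Integration.integral_sum) (simp_all add: space_\<mu> cell_Int)
  finally show "integral\<^sup>L \<mu> F = (\<Sum>x\<in>pre n y0. F x * measure \<mu> (cell n x))" .
qed

lemma cell_gibbs: assumes "x \<in> pre n y0"
  shows "exp (birkhoff_sum f \<phi> n x) \<le> Cg * measure \<mu> (cell n x)"
    "measure \<mu> (cell n x) \<le> Cg * exp (birkhoff_sum f \<phi> n x)"
  using gibbs_lower[of x n] gibbs_upper[of x n] assms by (auto simp: cell_def pre_def)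

lemma L_vs_integral:
  assumes F: "cylfun n F" "\<And>x. x \<in> {a..b} \<Longrightarrow> 0 \<le> F x"
  shows "L n F y0 \<le> Cg * integral\<^sup>L \<mu> F" "integral\<^sup>L \<mu> F \<le> Cg * L n F y0"
proof -
  have F0: "0 \<le> F x" if "x \<in> pre n y0" for x using F(2) that by (simp add: pre_def)
  show "L n F y0 \<le> Cg * integral\<^sup>L \<mu> F"
    unfolding L_def cyl_integral(2)[OF F(1)] sum_distrib_left
  proof (rule sum_mono)
    fix x assume x: "x \<in> pre n y0"
    show "exp (birkhoff_sum f \<phi> n x) * F x \<le> Cg * (F x * measure \<mu> (cell n x))"
      using mult_right_mono[OF cell_gibbs(1)[OF x] F0[OF x]] by (simp add: mult_ac)
  qed
  show "integral\<^sup>L \<mu> F \<le> Cg * L n F y0"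
    unfolding L_def cyl_integral(2)[OF F(1)] sum_distrib_left
  proof (rule sum_mono)
    fix x assume x: "x \<in> pre n y0"
    show "F x * measure \<mu> (cell n x) \<le> Cg * (exp (birkhoff_sum f \<phi> n x) * F x)"
      using mult_right_mono[OF cell_gibbs(2)[OF x] F0[OF x]] by (simp add: mult_ac)
  qed
qed

text \<open>
  Both means are sums over cylinders with comparable weights. The constant is squared because
  the normalisation of \<open>E n\<close> is itself only known up to the factor \<open>Cg\<close>.
\<close>

lemma E_vs_integral:
  assumes F: "cylfun n F" "\<And>x. x \<in> {a..b} \<Longrightarrow> 0 \<le> F x"
  shows "integral\<^sup>L \<mu> F \<le> Cg\<^sup>2 * E n F" "E n F \<le> Cg\<^sup>2 * integral\<^sup>L \<mu> F"
proof -
  let ?Z = "L n (\<lambda>x. 1) y0"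
  have Z: "?Z \<le> Cg" "1 \<le> Cg * ?Z" "0 < ?Z"
    using L_vs_integral[of n "\<lambda>_. 1"] Z_pos[of n] prob_space by auto
  have LF: "L n F y0 = ?Z * E n F" using Z by (simp add: E_def)
  have E0: "0 \<le> E n F" by (rule E_nonneg) (use F(2) in auto)
  have I0: "0 \<le> integral\<^sup>L \<mu> F" by (rule integral_nonneg_AE) (use F(2) space_\<mu> in auto)
  have "integral\<^sup>L \<mu> F \<le> Cg * (?Z * E n F)" using L_vs_integral(2)[OF F] LF by simp
  also have "\<dots> \<le> Cg * (Cg * E n F)" using Z E0 Cg by (intro mult_left_mono mult_right_mono) auto
  finally show "integral\<^sup>L \<mu> F \<le> Cg\<^sup>2 * E n F" by (simp add: power2_eq_square)
  have "E n F \<le> (Cg * ?Z) * E n F" using Z E0 mult_right_mono[of 1 "Cg * ?Z" "E n F"] by simp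
  also have "\<dots> = Cg * L n F y0" using LF by simp
  also have "\<dots> \<le> Cg * (Cg * integral\<^sup>L \<mu> F)" using L_vs_integral(1)[OF F] Cg by (intro mult_left_mono) auto
  finally show "E n F \<le> Cg\<^sup>2 * integral\<^sup>L \<mu> F" by (simp add: power2_eq_square)
qed

lemma cylset_indicator: "cylset n S \<Longrightarrow> cylfun n (indicator S :: real \<Rightarrow> real)"
  unfolding cylset_def indicator_def by (rule cylfun_comp) simp

lemma cylset_mono: "cylset n S \<Longrightarrow> n \<le> m \<Longrightarrow> cylset m S"
  unfolding cylset_def using cylfun_mono by blast

lemma cylset_Collect: assumes "cylfun n Q" shows "cylset n {x \<in> {a..b}. Q x}"
  unfolding cylset_def
proof (intro conjI cylfunI)
  fix x y assume "x \<in> {a..b}" "y \<in> {a..b}" "same n x y"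
  then show "(x \<in> {x \<in> {a..b}. Q x}) = (y \<in> {x \<in> {a..b}. Q x})"
    using cylfunD[OF assms] by blast
qed blast

lemma cylset_shift: "cylset m S \<Longrightarrow> n + m \<le> k \<Longrightarrow> cylset k {x \<in> {a..b}. (f ^^ n) x \<in> S}"
proof -
  assume *: "cylset m S" "n + m \<le> k"
  have "cylfun k (\<lambda>x. (f ^^ n) x \<in> S)"
    using cylfun_shift'[of m "\<lambda>x. x \<in> S" n k] * by (simp add: cylset_def)
  then show ?thesis by (rule cylset_Collect)
qed

lemma cylset_UN: assumes S: "cylset n S" shows "S = (\<Union>x\<in>pre n y0 \<inter> S. cell n x)"
proof (intro set_eqI iffI)
  fix z assume z: "z \<in> S"
  then have zI: "z \<in> {a..b}" using S by (auto simp: cylset_def)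
  obtain x where x: "x \<in> pre n y0" "same n z x" using ex1_pre_same[OF zI y0, of n] by blast
  have "x \<in> S" using cylfunD[of n "\<lambda>x. x \<in> S" z x] S z zI x by (auto simp: cylset_def pre_def)
  then show "z \<in> (\<Union>x\<in>pre n y0 \<inter> S. cell n x)" using x zI by (auto simp: cell_def dest: same_sym)
next
  fix z assume "z \<in> (\<Union>x\<in>pre n y0 \<inter> S. cell n x)"
  then obtain x where x: "x \<in> S" "z \<in> {a..b}" "same n x z" by (auto simp: cell_def)
  then show "z \<in> S" using cylfunD[of n "\<lambda>x. x \<in> S" x z] S by (auto simp: cylset_def)
qed

lemma cylset_sets: assumes S: "cylset n S" shows "S \<in> sets \<mu>"
proof -
  have "(\<Union>x\<in>pre n y0 \<inter> S. cell n x) \<in> sets \<mu>"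
    using finite_pre[OF y0] cell_sets by (intro sets.finite_UN) auto
  then show ?thesis using cylset_UN[OF S] by simp
qed

lemma cylset_measure: assumes "cylset n S" shows "integral\<^sup>L \<mu> (indicator S) = measure \<mu> S"
  using cylset_sets[OF assms] assms by (simp add: cylset_def space_\<mu> Int_absorb2)

lemma E_vs_measure: assumes "cylset n S"
  shows "measure \<mu> S \<le> Cg\<^sup>2 * E n (indicator S)" "E n (indicator S) \<le> Cg\<^sup>2 * measure \<mu> S"
  using E_vs_integral[OF cylset_indicator[OF assms]] cylset_measure[OF assms] by auto

lemma measure_shift: assumes "S \<in> sets \<mu>"
  shows "measure \<mu> {x \<in> {a..b}. (f ^^ n) x \<in> S} = measure \<mu> S"
proof -
  have "measure \<mu> S = measure (distr \<mu> \<mu> (f ^^ n)) S" by (simp only: fn_inv)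
  also have "\<dots> = measure \<mu> ((f ^^ n) -` S \<inter> space \<mu>)" by (rule measure_distr[OF fn_meas assms])
  also have "(f ^^ n) -` S \<inter> space \<mu> = {x \<in> {a..b}. (f ^^ n) x \<in> S}" by (auto simp: space_\<mu>)
  finally show ?thesis ..
qed

definition hit :: "real set \<Rightarrow> nat \<Rightarrow> real \<Rightarrow> real" where
  "hit A i x = indicator A ((f ^^ i) x)"

lemma hit_nonneg: "0 \<le> hit A i x" by (simp add: hit_def)
lemma hit_le: "hit A i x \<le> 1" by (simp add: hit_def indicator_def)

lemma hit_cyl: "cylset q A \<Longrightarrow> i + q \<le> n \<Longrightarrow> cylfun n (hit A i)"
  unfolding hit_def by (rule cylfun_shift'[OF cylset_indicator])

lemma hit_integral: assumes "cylset q A" shows "integral\<^sup>L \<mu> (hit A i) = measure \<mu> A"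
proof -
  have "integral\<^sup>L \<mu> (hit A i) = integral\<^sup>L \<mu> (indicator {x \<in> {a..b}. (f ^^ i) x \<in> A})"
    by (rule Bochner_Integration.integral_cong) (auto simp: hit_def space_\<mu> indicator_def)
  also have "\<dots> = measure \<mu> {x \<in> {a..b}. (f ^^ i) x \<in> A}"
    by (rule cylset_measure[OF cylset_shift[OF assms order_refl]])
  also have "\<dots> = measure \<mu> A" by (rule measure_shift[OF cylset_sets[OF assms]])
  finally show ?thesis .
qed

lemma E_hit_le: assumes "cylset q A" "i + q \<le> N" shows "E N (hit A i) \<le> Cg\<^sup>2 * measure \<mu> A"
  using E_vs_integral(2)[OF hit_cyl[OF assms] hit_nonneg] hit_integral[OF assms(1)] by simp

lemma jensen_square: fixes F :: "real \<Rightarrow> real" assumes "cylfun n F"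
  shows "(integral\<^sup>L \<mu> F)\<^sup>2 \<le> integral\<^sup>L \<mu> (\<lambda>x. (F x)\<^sup>2)"
proof -
  have i: "integrable \<mu> F" "integrable \<mu> (\<lambda>x. (F x)\<^sup>2)"
    by (rule cyl_integral(1)[OF assms]) (rule cyl_integral(1)[OF cylfun_comp[OF assms, where G="\<lambda>x. x\<^sup>2"]])
  show ?thesis using variance_eq[OF i] variance_positive[of F] by simp
qed

lemma tendsto_\<eta>: "\<eta> \<longlonglongrightarrow> 0"
proof -
  have "(\<lambda>g. K * \<gamma> ^ g) \<longlonglongrightarrow> K * 0" using \<gamma> by (intro tendsto_mult tendsto_const LIMSEQ_power_zero) auto
  then show ?thesis by (simp add: \<eta>_def[abs_def])
qed

text \<open>
  A Chebyshev argument. The visits at \<open>J\<close> times spaced by \<open>q + g\<close> are nearly uncorrelated under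
  \<open>E N\<close> and have nearly the same mean, so their average is close to that mean in mean square,
  also under \<open>\<mu>\<close> since \<open>\<mu>\<close> is at most \<open>Cg\<^sup>2\<close> times \<open>E N\<close>; and the \<open>\<mu>\<close>-mean of the average is
  \<open>\<mu> A\<close> by invariance.
\<close>

lemma marginal_variance:
  fixes g J :: nat
  assumes A: "cylset q A" and J: "0 < J"
  defines "s \<equiv> q + g" and "u \<equiv> 1 + \<eta> g"
  shows "\<exists>i n. g \<le> i \<and> q + g \<le> n \<and>
    (measure \<mu> A - E (i + n) (hit A i))\<^sup>2 \<le> Cg\<^sup>2 * (1 / real J + (u ^ 5 + 1 - 2 / u\<^sup>2))"
proof -
  \<comment> \<open>Two spare gaps keep all visit times \<open>t j\<close> away from both ends of the window.\<close>
  define N where "N = (J + 2) * s"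
  define t where "t j = (j + 1) * s" for j
  have t: "g \<le> t j" "t j \<le> J * s" "q + g \<le> N - t j" "t j + (N - t j) = N" if "j < J" for j
  proof -
    show 1: "g \<le> t j" by (simp add: t_def s_def)
    show 2: "t j \<le> J * s" unfolding t_def using that by (intro mult_right_mono) auto
    have "N = J * s + 2 * s" by (simp add: N_def algebra_simps)
    then show "q + g \<le> N - t j" "t j + (N - t j) = N" using 2 by (auto simp: s_def)
  qed
  define \<beta> where "\<beta> = E N (hit A (t 0))"
  have u1: "1 \<le> u" using \<eta>_nonneg by (simp add: u_def)
  have hitA: "E N (hit A (t i)) \<le> u\<^sup>2 * E N (hit A (t j))" if "i < J" "j < J" for i j
    using marginal_compare[OF cylset_indicator[OF A], of g "t i" "t j" "N - t i" "N - t j"]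
      t[OF that(1)] t[OF that(2)] by (simp add: hit_def[abs_def] u_def)
  have \<beta>: "0 \<le> \<beta>" "\<beta> \<le> 1"
    unfolding \<beta>_def using E_mono[of "hit A (t 0)" "\<lambda>_. 1" N] hit_le by (auto intro!: E_nonneg hit_nonneg)
  have up: "E N (hit A (t j)) \<le> u\<^sup>2 * \<beta>" and lo: "\<beta> / u\<^sup>2 \<le> E N (hit A (t j))" if "j < J" for j
    using hitA[OF that J] hitA[OF J that] u1 by (auto simp: \<beta>_def field_simps)
  have cov: "E N (\<lambda>x. hit A (t i) x * hit A (t j) x) \<le> u ^ 5 * \<beta>\<^sup>2" if ij: "i < j" "j < J" for i j
  proof -
    have le: "t i + s \<le> t j" using ij(1) mult_right_mono[of "i + 2" "j + 1" s] by (simp add: t_def algebra_simps)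
    have tj: "(t j - g) + g = t j" using le by (simp add: s_def)
    have c1: "cylfun (t j - g) (hit A (t i))" using le by (intro hit_cyl[OF A]) (simp add: s_def)
    have c2: "(t j - g) + g \<le> N" using t[OF ij(2)] tj by linarith
    have "E N (\<lambda>x. hit A (t i) x * hit A (t j) x) \<le> u * (E N (hit A (t i)) * E N (hit A (t j)))"
      using mixing(1)[OF c1 hit_nonneg _ c2, of "indicator A"] unfolding tj
      by (simp add: hit_def[abs_def] u_def)
    also have "\<dots> \<le> u * ((u\<^sup>2 * \<beta>) * (u\<^sup>2 * \<beta>))"
      using up[of i] up[of j] ij u1 by (intro mult_left_mono mult_mono) (auto intro!: E_nonneg hit_nonneg simp: \<beta>)
    finally show ?thesis by (simp add: power2_eq_square power_numeral_reduce mult_ac)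
  qed
  have cov': "E N (\<lambda>x. hit A (t i) x * hit A (t j) x) \<le> u ^ 5 * \<beta>\<^sup>2 + (if i = j then 1 else 0)"
    if "i < J" "j < J" for i j
  proof -
    consider "i < j" | "j < i" | "i = j" by linarith
    then show ?thesis
    proof cases
      case 2 then show ?thesis using cov[of j i] that by (simp add: mult.commute)
    next
      case 3
      have "E N (\<lambda>x. hit A (t i) x * hit A (t j) x) \<le> E N (\<lambda>_. 1)"
        using hit_le hit_nonneg by (intro E_mono mult_le_one) auto
      then show ?thesis using 3 u1 by (simp add: add_increasing)
    qed (use cov that in auto)
  qed
  define F where "F x = (\<Sum>j<J. hit A (t j) x) - real J * \<beta>" for x
  have Fcyl: "cylfun N F"
    unfolding F_def
  proof (rule cylfun_comp[where G="\<lambda>s. s - real J * \<beta>"], rule cylfun_sum, rule hit_cyl[OF A])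
    fix j assume "j \<in> {..<J}"
    then show "t j + q \<le> N" using t[of j] by simp
  qed
  have "E N (\<lambda>x. (F x)\<^sup>2) = E N (\<lambda>x. ((\<Sum>i<J. \<Sum>j<J. hit A (t i) x * hit A (t j) x)
      - 2 * real J * \<beta> * (\<Sum>j<J. hit A (t j) x)) + (real J * \<beta>)\<^sup>2)"
  proof (rule E_cong)
    fix x
    have sq: "(\<Sum>j<J. hit A (t j) x)\<^sup>2 = (\<Sum>i<J. \<Sum>j<J. hit A (t i) x * hit A (t j) x)"
      by (simp only: power2_eq_square sum_product)
    show "(F x)\<^sup>2 = ((\<Sum>i<J. \<Sum>j<J. hit A (t i) x * hit A (t j) x)
      - 2 * real J * \<beta> * (\<Sum>j<J. hit A (t j) x)) + (real J * \<beta>)\<^sup>2"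
      unfolding F_def power2_diff sq by (simp only: mult_ac diff_add_eq)
  qed
  also have "\<dots> = (\<Sum>i<J. \<Sum>j<J. E N (\<lambda>x. hit A (t i) x * hit A (t j) x))
      - 2 * real J * \<beta> * (\<Sum>j<J. E N (hit A (t j))) + (real J * \<beta>)\<^sup>2"
    by (simp only: E_plus E_diff E_scale E_sum E_const)
  also have "\<dots> \<le> (\<Sum>i<J. \<Sum>j<J. u ^ 5 * \<beta>\<^sup>2 + (if i = j then 1 else 0))
      - 2 * real J * \<beta> * (\<Sum>j<J. \<beta> / u\<^sup>2) + (real J * \<beta>)\<^sup>2"
    using cov' lo \<beta> by (intro add_mono diff_mono sum_mono mult_left_mono order_refl) auto
  also have "\<dots> = (real J)\<^sup>2 * (1 / real J + \<beta>\<^sup>2 * (u ^ 5 + 1 - 2 / u\<^sup>2))"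
    using J by (simp add: sum.distrib power2_eq_square field_simps)
  also have "\<dots> \<le> (real J)\<^sup>2 * (1 / real J + 1 * (u ^ 5 + 1 - 2 / u\<^sup>2))"
  proof (intro mult_left_mono add_left_mono mult_right_mono)
    show "\<beta>\<^sup>2 \<le> 1" using \<beta> by (simp add: power_le_one)
    have "1 \<le> u ^ 5" "2 / u\<^sup>2 \<le> 2" using u1 one_le_power[of u 2] one_le_power[of u 5] by (auto simp: divide_le_eq)
    then show "0 \<le> u ^ 5 + 1 - 2 / u\<^sup>2" by linarith
  qed auto
  finally have EF: "E N (\<lambda>x. (F x)\<^sup>2) \<le> (real J)\<^sup>2 * (1 / real J + (u ^ 5 + 1 - 2 / u\<^sup>2))" by simp
  have intF: "integral\<^sup>L \<mu> F = real J * (measure \<mu> A - \<beta>)"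
  proof -
    have i: "integrable \<mu> (hit A (t j))" for j by (rule cyl_integral(1)[OF hit_cyl[OF A order_refl]])
    have "integral\<^sup>L \<mu> F = (\<Sum>j<J. integral\<^sup>L \<mu> (hit A (t j))) - real J * \<beta>"
      unfolding F_def using i prob_space
      by (subst Bochner_Integration.integral_diff) (auto simp: Bochner_Integration.integral_sum)
    then show ?thesis by (simp add: hit_integral[OF A] algebra_simps)
  qed
  have "(real J)\<^sup>2 * (measure \<mu> A - \<beta>)\<^sup>2 = (integral\<^sup>L \<mu> F)\<^sup>2" by (simp add: intF power_mult_distrib)
  also have "\<dots> \<le> integral\<^sup>L \<mu> (\<lambda>x. (F x)\<^sup>2)" by (rule jensen_square[OF Fcyl])
  also have "\<dots> \<le> Cg\<^sup>2 * E N (\<lambda>x. (F x)\<^sup>2)"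
    by (rule E_vs_integral(1)[OF cylfun_comp[OF Fcyl, where G="\<lambda>x. x\<^sup>2"]]) simp
  also have "\<dots> \<le> Cg\<^sup>2 * ((real J)\<^sup>2 * (1 / real J + (u ^ 5 + 1 - 2 / u\<^sup>2)))"
    using EF by (rule mult_left_mono) simp
  finally have "(real J)\<^sup>2 * (measure \<mu> A - \<beta>)\<^sup>2 \<le> (real J)\<^sup>2 * (Cg\<^sup>2 * (1 / real J + (u ^ 5 + 1 - 2 / u\<^sup>2)))"
    by (simp only: mult_ac)
  then have "(measure \<mu> A - \<beta>)\<^sup>2 \<le> Cg\<^sup>2 * (1 / real J + (u ^ 5 + 1 - 2 / u\<^sup>2))"
    using J by (simp add: mult_le_cancel_left)
  then show ?thesis
    using t[OF J] unfolding \<beta>_def by (intro exI[of _ "t 0"] exI[of _ "N - t 0"]) simp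
qed

text \<open>
  By \<open>marginal_compare\<close> the mean on the right is bounded below in terms of means over ever
  longer windows, and by \<open>marginal_variance\<close> these come arbitrarily close to the measure of \<open>A\<close>.
\<close>

lemma marginal:
  assumes A: "cylset q A" and i: "g \<le> i" and n: "i + q + g \<le> N"
  shows "measure \<mu> A \<le> (1 + \<eta> g)\<^sup>2 * E N (hit A i)"
proof (rule field_le_epsilon)
  fix e :: real assume e: "0 < e"
  let ?b = "\<lambda>h. Cg\<^sup>2 * (1 / real (Suc h) + ((1 + \<eta> h) ^ 5 + 1 - 2 / (1 + \<eta> h)\<^sup>2))"
  have "?b \<longlonglongrightarrow> Cg\<^sup>2 * (0 + ((1 + 0) ^ 5 + 1 - 2 / (1 + 0)\<^sup>2))"
    by (intro tendsto_intros tendsto_\<eta> LIMSEQ_Suc[OF lim_1_over_n]) auto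
  then have "\<forall>\<^sub>F h in sequentially. ?b h < e\<^sup>2" using e by (intro order_tendstoD(2)) auto
  moreover have "\<forall>\<^sub>F h in sequentially. g \<le> h" by (rule eventually_ge_at_top)
  ultimately have "\<forall>\<^sub>F h in sequentially. ?b h < e\<^sup>2 \<and> g \<le> h" by (rule eventually_conj)
  then obtain h where h: "?b h < e\<^sup>2" "g \<le> h" by (auto simp: eventually_sequentially)
  obtain i' n' where i': "h \<le> i'" "q + h \<le> n'" and b: "(measure \<mu> A - E (i' + n') (hit A i'))\<^sup>2 \<le> ?b h"
    using marginal_variance[OF A zero_less_Suc[of h], of h] by blast
  from b h(1) have "(measure \<mu> A - E (i' + n') (hit A i'))\<^sup>2 < e\<^sup>2" by (rule le_less_trans)
  then have "measure \<mu> A - E (i' + n') (hit A i') < e"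
    by (rule power2_less_imp_less[OF _ less_imp_le[OF e]])
  moreover have "E (i' + n') (hit A i') \<le> (1 + \<eta> g)\<^sup>2 * E (i + (N - i)) (hit A i)"
    using marginal_compare[OF cylset_indicator[OF A], of g i' i n' "N - i"] i i' h(2) n
    by (simp add: hit_def[abs_def])
  ultimately show "measure \<mu> A \<le> (1 + \<eta> g)\<^sup>2 * E N (hit A i) + e" using n by simp
qed

end

text \<open>
  Adds that intervals have measure comparable with their length. Near an endpoint of the
  interval only half of a ball counts, so the lower bound is stated for balls centred in the
  interval.
\<close>

locale gibbs_coding = gibbs_measure +
  fixes dens :: real
  assumes dens: "1 \<le> dens"
    and dens_upper: "\<And>s t. s \<le> t \<Longrightarrow> measure \<mu> ({s..t} \<inter> {a..b}) \<le> dens * (t - s)"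
    and dens_lower: "\<And>y d. y \<in> {a..b} \<Longrightarrow> 0 < d \<Longrightarrow> d \<le> b - a \<Longrightarrow>
        d \<le> dens * measure \<mu> (ball y d \<inter> {a..b})"
begin

definition return_const :: real where "return_const = Cg ^ 6 * (1 + K) * 2 * dens * (1 + (b - a))"

lemma return_const_pos: "0 < return_const" using Cg K dens ab by (auto simp: return_const_def intro!: mult_pos_pos)

text \<open>
  The set \<open>A\<close> is covered by the \<open>k\<close>-cylinders that meet it. Their union has measure of order
  \<open>d + c ^ - k\<close>, as it lies in a slightly longer interval, and return to \<open>A\<close> after \<open>k\<close> steps is
  independent of the choice of the \<open>k\<close>-cylinder up to a constant. Thus visits come in clusters
  of bounded mean size.
\<close>

lemma self_return:
  assumes A: "cylset q A" "A \<subseteq> ball y d" and d: "0 < d"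
  shows "measure \<mu> {x \<in> A. (f ^^ k) x \<in> A} \<le> return_const * measure \<mu> A * (d + (1 / c) ^ k)"
proof -
  define S where "S = {x \<in> {a..b}. \<exists>z\<in>A. same k x z}"
  have AI: "A \<subseteq> {a..b}" using A by (simp add: cylset_def)
  have S: "cylset k S"
    unfolding cylset_def
  proof (intro conjI cylfunI)
    show "S \<subseteq> {a..b}" by (auto simp: S_def)
    show "(x \<in> S) = (x' \<in> S)" if "x \<in> {a..b}" "x' \<in> {a..b}" "same k x x'" for x x'
      using that same_trans[OF that(3)] same_trans[OF same_sym[OF that(3)]] unfolding S_def by blast
  qed
  have AS: "A \<subseteq> S" using AI same_refl unfolding S_def by blast
  have Sm: "measure \<mu> S \<le> dens * (2 * (1 + (b - a)) * (d + (1 / c) ^ k))"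
  proof -
    let ?r = "d + (b - a) * (1 / c) ^ k"
    have "S \<subseteq> {y - ?r .. y + ?r} \<inter> {a..b}"
    proof
      fix x assume x: "x \<in> S"
      then obtain z where z: "z \<in> A" "same k x z" by (auto simp: S_def)
      then have "\<bar>x - z\<bar> \<le> (b - a) * (1 / c) ^ k"
        using same_dist[of x z k] x AI by (auto simp: S_def power_divide)
      moreover have "\<bar>y - z\<bar> < d" using A(2) z by (auto simp: dist_real_def)
      ultimately show "x \<in> {y - ?r .. y + ?r} \<inter> {a..b}" using x by (auto simp: S_def)
    qed
    then have "measure \<mu> S \<le> measure \<mu> ({y - ?r .. y + ?r} \<inter> {a..b})"
      by (intro finite_measure_mono borel_sets_\<mu>) auto
    also have "\<dots> \<le> dens * ((y + ?r) - (y - ?r))"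
      using d ab c_gt_1 by (intro dens_upper) (simp add: add_nonneg_nonneg)
    also have "\<dots> \<le> dens * (2 * (1 + (b - a)) * (d + (1 / c) ^ k))"
    proof -
      have "0 \<le> (b - a) * d" "0 \<le> (1/c) ^ k" using ab d c_gt_1 by simp_all
      then show ?thesis using dens by (intro mult_left_mono) (auto simp: algebra_simps)
    qed
    finally show ?thesis .
  qed
  let ?N = "k + q"
  have cyl: "cylfun ?N (\<lambda>x. indicator S x * hit A k x)"
    by (rule cylfun_comp2[OF cylfun_mono[OF cylset_indicator[OF S]] hit_cyl[OF A(1)]]) simp_all
  have set1: "cylset ?N {x \<in> {a..b}. x \<in> S \<and> (f ^^ k) x \<in> A}"
  proof -
    have "cylfun ?N (\<lambda>x. x \<in> S \<and> (f ^^ k) x \<in> A)"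
      using cylfun_comp2[where G="(\<and>)", OF cylfun_mono[of k "\<lambda>x. x \<in> S" ?N] cylfun_shift[of q "\<lambda>x. x \<in> A" k]] S A(1)
      by (simp add: cylset_def)
    then show ?thesis by (rule cylset_Collect)
  qed
  have "measure \<mu> {x \<in> A. (f ^^ k) x \<in> A} \<le> measure \<mu> {x \<in> {a..b}. x \<in> S \<and> (f ^^ k) x \<in> A}"
    using AS AI by (intro finite_measure_mono cylset_sets[OF set1]) auto
  also have "\<dots> \<le> Cg\<^sup>2 * E ?N (indicator {x \<in> {a..b}. x \<in> S \<and> (f ^^ k) x \<in> A})"
    by (rule E_vs_measure(1)[OF set1])
  also have "E ?N (indicator {x \<in> {a..b}. x \<in> S \<and> (f ^^ k) x \<in> A}) = E ?N (\<lambda>x. indicator S x * hit A k x)"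
    by (rule E_cong) (auto simp: indicator_def hit_def)
  also have "\<dots> \<le> (1 + K) * (E ?N (indicator S) * E ?N (hit A k))"
    using mixing(1)[OF cylset_indicator[OF S], of "indicator A" 0 ?N] by (simp add: hit_def[abs_def] \<eta>_0)
  also have "\<dots> \<le> (1 + K) * ((Cg\<^sup>2 * measure \<mu> S) * (Cg\<^sup>2 * measure \<mu> A))"
    using K E_vs_measure(2)[OF cylset_mono[OF S, of ?N]] E_hit_le[OF A(1), of k ?N]
    by (intro mult_left_mono mult_mono) (auto intro!: E_nonneg hit_nonneg)
  also have "\<dots> \<le> (1 + K) * ((Cg\<^sup>2 * (dens * (2 * (1 + (b - a)) * (d + (1 / c) ^ k)))) * (Cg\<^sup>2 * measure \<mu> A))"
    using K Sm by (intro mult_left_mono mult_right_mono) auto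
  finally have "measure \<mu> {x \<in> A. (f ^^ k) x \<in> A}
    \<le> Cg\<^sup>2 * ((1 + K) * ((Cg\<^sup>2 * (dens * (2 * (1 + (b - a)) * (d + (1 / c) ^ k)))) * (Cg\<^sup>2 * measure \<mu> A)))"
    by (simp add: mult_left_mono)
  also have "\<dots> = return_const * measure \<mu> A * (d + (1 / c) ^ k)"
  proof -
    have "G\<^sup>2 * (k1 * ((G\<^sup>2 * (dn * (2 * w * r))) * (G\<^sup>2 * m))) = G ^ 6 * k1 * 2 * dn * w * m * r"
      for G k1 dn w r m :: real by (simp add: power_numeral_reduce mult_ac)
    then show ?thesis unfolding return_const_def .
  qed
  finally show ?thesis .
qed

lemma hit_pair:
  assumes A: "cylset q A" "A \<subseteq> ball y d" and d: "0 < d" and ij: "i \<le> j" "j + q \<le> N"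
  shows "E N (\<lambda>x. hit A i x * hit A j x) \<le> Cg\<^sup>2 * (return_const * measure \<mu> A * (d + (1 / c) ^ (j - i)))"
proof -
  have AI: "A \<subseteq> {a..b}" using A by (simp add: cylset_def)
  let ?B = "{x \<in> A. (f ^^ (j - i)) x \<in> A}"
  have B: "cylset ((j - i) + q) ?B"
  proof -
    have "cylfun ((j - i) + q) (\<lambda>x. x \<in> A \<and> (f ^^ (j - i)) x \<in> A)"
      using cylfun_comp2[where G="(\<and>)", OF cylfun_mono[of q "\<lambda>x. x \<in> A" "(j - i) + q"] cylfun_shift[of q "\<lambda>x. x \<in> A" "j - i"]] A(1)
      by (simp add: cylset_def)
    moreover have "?B = {x \<in> {a..b}. x \<in> A \<and> (f ^^ (j - i)) x \<in> A}" using AI by blast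
    ultimately show ?thesis using cylset_Collect by simp
  qed
  have eq: "hit A i x * hit A j x = hit ?B i x" for x
  proof -
    have "(f ^^ j) x = (f ^^ (j - i)) ((f ^^ i) x)" using ij(1) funpow_add_apply[of i "j - i" x] by simp
    then show ?thesis by (simp add: hit_def indicator_def)
  qed
  have "E N (\<lambda>x. hit A i x * hit A j x) = E N (hit ?B i)" by (simp only: eq)
  also have "\<dots> \<le> Cg\<^sup>2 * measure \<mu> ?B" using ij by (intro E_hit_le[OF B]) simp
  also have "\<dots> \<le> Cg\<^sup>2 * (return_const * measure \<mu> A * (d + (1 / c) ^ (j - i)))"
    using self_return[OF A d] by (intro mult_left_mono) auto
  finally show ?thesis .
qed

definition moment_const :: real where "moment_const = Cg\<^sup>2 * return_const * (2 * c / (c - 1))"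

lemma moment_const_pos: "0 < moment_const" using Cg return_const_pos c_gt_1 by (auto simp: moment_const_def intro!: mult_pos_pos divide_pos_pos)

lemma geometric_le: "(\<Sum>k<m. (1 / c) ^ k) \<le> c / (c - 1)"
proof -
  have "(\<Sum>k<m. (1 / c) ^ k) \<le> (\<Sum>k. (1 / c) ^ k)"
    using c_gt_1 by (intro sum_le_suminf summable_geometric) auto
  also have "\<dots> = c / (c - 1)" using c_gt_1 by (subst suminf_geometric) (auto simp: field_simps)
  finally show ?thesis .
qed

lemma geometric_two_sided: "(\<Sum>j<m. (1 / c) ^ (if i \<le> j then j - i else i - j)) \<le> 2 * c / (c - 1)"
proof -
  have pos: "0 \<le> (1 / c) ^ k" for k using c_gt_1 by simp
  have "(\<Sum>j<m. (1 / c) ^ (if i \<le> j then j - i else i - j))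
     = (\<Sum>j\<in>{..<m} \<inter> {j. i \<le> j}. (1 / c) ^ (j - i)) + (\<Sum>j\<in>{..<m} \<inter> - {j. i \<le> j}. (1 / c) ^ (i - j))"
    by (simp add: if_distrib[where f="\<lambda>k. (1 / c) ^ k"] sum.If_cases)
  also have "(\<Sum>j\<in>{..<m} \<inter> {j. i \<le> j}. (1 / c) ^ (j - i)) = (\<Sum>k\<in>(\<lambda>j. j - i) ` ({..<m} \<inter> {j. i \<le> j}). (1 / c) ^ k)"
    by (subst sum.reindex) (auto simp: inj_on_def)
  also have "\<dots> \<le> (\<Sum>k<m. (1 / c) ^ k)" using pos by (intro sum_mono2) auto
  also have "(\<Sum>j\<in>{..<m} \<inter> - {j. i \<le> j}. (1 / c) ^ (i - j)) = (\<Sum>k\<in>(\<lambda>j. i - j) ` ({..<m} \<inter> - {j. i \<le> j}). (1 / c) ^ k)"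
    by (subst sum.reindex) (auto simp: inj_on_def)
  also have "\<dots> \<le> (\<Sum>k<Suc i. (1 / c) ^ k)" using pos by (intro sum_mono2) auto
  finally show ?thesis using geometric_le[of m] geometric_le[of "Suc i"] by simp
qed

text \<open>
  By \<open>hit_pair\<close> the double sum splits into a part of independent visits, of order \<open>m * d\<close> per
  visit, and a geometric series of rapid returns.
\<close>

lemma second_moment:
  assumes A: "cylset q A" "A \<subseteq> ball y d" and d: "0 < d" and N: "t + m + q \<le> N"
  shows "E N (\<lambda>x. (\<Sum>i<m. hit A (t + i) x)\<^sup>2) \<le> moment_const * (measure \<mu> A * real m * (real m * d + 1))"
proof -
  let ?W = "Cg\<^sup>2 * (return_const * measure \<mu> A)"
  have W: "0 \<le> ?W" using return_const_pos by simp
  have pair: "E N (\<lambda>x. hit A (t + i) x * hit A (t + j) x)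
      \<le> ?W * (d + (1 / c) ^ (if i \<le> j then j - i else i - j))" if "i < m" "j < m" for i j
  proof (cases "i \<le> j")
    case True
    then show ?thesis using hit_pair[OF A d, of "t + i" "t + j" N] that N by (simp add: mult_ac)
  next
    case False
    then show ?thesis using hit_pair[OF A d, of "t + j" "t + i" N] that N by (simp add: mult_ac)
  qed
  have "E N (\<lambda>x. (\<Sum>i<m. hit A (t + i) x)\<^sup>2) = (\<Sum>i<m. \<Sum>j<m. E N (\<lambda>x. hit A (t + i) x * hit A (t + j) x))"
    by (simp only: power2_eq_square sum_product E_sum)
  also have "\<dots> \<le> (\<Sum>i<m. \<Sum>j<m. ?W * (d + (1 / c) ^ (if i \<le> j then j - i else i - j)))"
    using pair by (intro sum_mono) auto
  also have "\<dots> = ?W * (\<Sum>i<m. real m * d + (\<Sum>j<m. (1 / c) ^ (if i \<le> j then j - i else i - j)))"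
    by (simp add: sum_distrib_left[symmetric] sum.distrib)
  also have "\<dots> \<le> ?W * (\<Sum>i<m. real m * d + 2 * c / (c - 1))"
    using W by (intro mult_left_mono sum_mono add_left_mono geometric_two_sided)
  also have "\<dots> = ?W * (real m * (real m * d + 2 * c / (c - 1)))" by simp
  also have "\<dots> \<le> ?W * (real m * ((2 * c / (c - 1)) * (real m * d + 1)))"
  proof -
    have "1 \<le> 2 * c / (c - 1)" using c_gt_1 by (simp add: field_simps)
    then have "1 * (real m * d) \<le> (2 * c / (c - 1)) * (real m * d)" using d by (intro mult_right_mono) auto
    then show ?thesis using W by (intro mult_left_mono) (auto simp: distrib_left)
  qed
  also have "\<dots> = moment_const * (measure \<mu> A * real m * (real m * d + 1))" by (simp add: moment_const_def mult_ac)
  finally show ?thesis .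
qed

end

section \<open>Deviations of visit counts\<close>

lemma exp_minus_le: assumes "0 \<le> (z::real)" shows "exp (- z) \<le> 1 - z + z\<^sup>2"
proof -
  have "1 \<le> (1 - z + z\<^sup>2) * (1 + z)" using assms by (simp add: algebra_simps power2_eq_square)
  also have "\<dots> \<le> (1 - z + z\<^sup>2) * exp z"
  proof (rule mult_left_mono[OF exp_ge_add_one_self])
    have "1 - z + z\<^sup>2 = (1/2 - z)\<^sup>2 + 3 / 4" by (simp add: power2_eq_square algebra_simps)
    then show "0 \<le> 1 - z + z\<^sup>2" by simp
  qed
  finally show ?thesis by (simp add: exp_minus field_simps)
qed

lemma sum_lessThan_plus:
  fixes h :: "nat \<Rightarrow> 'a :: comm_monoid_add"
  shows "(\<Sum>i<n + m. h i) = (\<Sum>i<n. h i) + (\<Sum>i<m. h (n + i))"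
  by (induction m) (simp_all add: add_ac)

text \<open>
  Splitting into blocks of odd and even index. Block 0 is left out: close to time 0 the
  marginals of \<open>E N\<close> are not those of \<open>\<mu>\<close>.
\<close>

lemma sum_blocks:
  fixes h :: "nat \<Rightarrow> real"
  assumes "\<And>i. 0 \<le> h i"
  shows "(\<Sum>j<J. \<Sum>i<M. h ((2 * j + 1) * M + i)) + (\<Sum>j<J. \<Sum>i<M. h ((2 * j + 2) * M + i))
     \<le> (\<Sum>i<(2 * J + 1) * M. h i)"
proof (induction J)
  case 0 show ?case using assms by (simp add: sum_nonneg)
next
  case (Suc J)
  have "(2 * Suc J + 1) * M = ((2 * J + 1) * M + M) + M" by simp
  then have "(\<Sum>i<(2 * Suc J + 1) * M. h i) = (\<Sum>i<(2 * J + 1) * M. h i)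
     + (\<Sum>i<M. h ((2 * J + 1) * M + i)) + (\<Sum>i<M. h (((2 * J + 1) * M + M) + i))"
    by (simp only: sum_lessThan_plus)
  moreover have "((2 * J + 1) * M + M) = (2 * J + 2) * M" by simp
  ultimately show ?case using Suc by (simp only: sum.lessThan_Suc)
qed

lemma power_below:
  fixes r x :: real assumes r: "0 < r" "r < 1" and x: "0 < x"
  shows "\<exists>n. r ^ n \<le> x \<and> real n \<le> \<bar>ln x\<bar> / ln (1 / r) + 1"
proof -
  define l where "l = ln (1 / r)"
  have l: "0 < l" using r by (simp add: l_def)
  define n where "n = nat \<lceil>\<bar>ln x\<bar> / l\<rceil>"
  have n: "\<bar>ln x\<bar> / l \<le> real n" "real n \<le> \<bar>ln x\<bar> / l + 1"
    using l by (auto simp: n_def of_nat_nat intro!: le_of_int_ceiling of_int_ceiling_le_add_one)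
  have "\<bar>ln x\<bar> \<le> real n * l" using n(1) l by (simp add: field_simps)
  then have "ln (r ^ n) \<le> ln x" using r by (simp add: l_def ln_realpow ln_div)
  then have "r ^ n \<le> x" using r x by simp
  then show ?thesis using n(2) l_def by auto
qed

lemma interval_net:
  fixes a b r :: real assumes "a < b" "0 < r"
  shows "\<exists>Z. finite Z \<and> Z \<subseteq> {a..b} \<and> (\<forall>y\<in>{a..b}. \<exists>z\<in>Z. \<bar>y - z\<bar> \<le> r) \<and> real (card Z) \<le> (b - a) / r + 1"
proof -
  define n where "n = nat \<lfloor>(b - a) / r\<rfloor>"
  define Z where "Z = (\<lambda>k. a + real k * r) ` {..n}"
  have n: "real n \<le> (b - a) / r" using assms by (simp add: n_def)
  have "real (card Z) \<le> real (Suc n)" unfolding Z_def using card_image_le[of "{..n}" "\<lambda>k. a + real k * r"]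
    by (simp add: of_nat_le_iff del: of_nat_Suc)
  then have card: "real (card Z) \<le> (b - a) / r + 1" using n by simp
  have Zs: "Z \<subseteq> {a..b}"
  proof
    fix z assume "z \<in> Z"
    then obtain k where k: "k \<le> n" "z = a + real k * r" by (auto simp: Z_def)
    have "real k \<le> (b - a) / r" using k(1) n by linarith
    then have "real k * r \<le> b - a" using assms by (simp add: field_simps)
    then show "z \<in> {a..b}" using k assms by simp
  qed
  have "\<exists>z\<in>Z. \<bar>y - z\<bar> \<le> r" if y: "y \<in> {a..b}" for y
  proof -
    define k where "k = nat \<lfloor>(y - a) / r\<rfloor>"
    have 0: "0 \<le> (y - a) / r" using y assms by simp
    have k: "real k \<le> (y - a) / r" "(y - a) / r < real k + 1" using 0 by (auto simp: k_def)
    have "(y - a) / r \<le> (b - a) / r" using y assms by (intro divide_right_mono) auto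
    then have "k \<le> n" unfolding k_def n_def by (intro nat_mono floor_mono)
    moreover have "real k * r \<le> y - a" "y - a < (real k + 1) * r" using k assms by (auto simp: field_simps)
    then have "\<bar>y - (a + real k * r)\<bar> \<le> r" by (simp add: algebra_simps abs_le_iff)
    ultimately show ?thesis by (auto simp: Z_def)
  qed
  then show ?thesis using card Zs by (intro exI[of _ Z]) (auto simp: Z_def)
qed

context gibbs_coding
begin

text \<open>
  The constant in the exponent of \<open>chernoff\<close>, from the optimisation over the exponential
  parameter there.
\<close>

definition deviation_rate :: real where "deviation_rate = 1 / (256 * (1 + K) * moment_const * dens)"

lemma deviation_rate_pos: "0 < deviation_rate" using K moment_const_pos dens by (auto simp: deviation_rate_def intro!: mult_pos_pos)

text \<open>
  Between two blocks of the same parity there is a whole block, of which \<open>q\<close> steps are needed to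
  decide membership in \<open>A\<close> and the remaining \<open>M - q \<ge> g\<close> steps serve as a mixing gap. So each
  block contributes a factor \<open>1 - lam * mean + lam\<^sup>2 * second moment\<close>, whatever happened before.
\<close>

lemma exp_moment:
  fixes J M :: nat
  assumes A: "cylset q A" "A \<subseteq> ball y d" and d: "0 < d" and M: "q + g \<le> M"
    and s: "1 \<le> s" "s \<le> 2" and g: "\<eta> g \<le> e / 12" and lam: "0 \<le> lam"
  defines "N \<equiv> (2 * J + 4) * M" and "p \<equiv> real M * measure \<mu> A"
    and "V \<equiv> (1 + K) * (moment_const * (measure \<mu> A * real M * (real M * d + 1)))"
  shows "E N (\<lambda>x. exp (- lam * (\<Sum>j<J. \<Sum>i<M. hit A ((2 * j + s) * M + i) x)))
     \<le> exp (- (lam * (1 - e / 4) * p - lam\<^sup>2 * V)) ^ J"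
proof -
  define t where "t j = (2 * j + s) * M" for j
  define Y where "Y j x = (\<Sum>i<M. hit A (t j + i) x)" for j x
  define F where "F j x = exp (- lam * (\<Sum>i<j. Y i x))" for j x
  define w where "w = 1 - lam * (1 - e / 4) * p + lam\<^sup>2 * V"
  have Y0: "0 \<le> Y j x" for j x unfolding Y_def by (intro sum_nonneg hit_nonneg)
  have p0: "0 \<le> p" by (simp add: p_def)
  have "E N (F j) \<le> exp (- (lam * (1 - e / 4) * p - lam\<^sup>2 * V)) ^ j" if "j \<le> J" for j
    using that
  proof (induction j)
    case 0 then show ?case by (simp add: F_def)
  next
    case (Suc j)
    have tM: "M \<le> t j" using s mult_right_mono[of 1 "2 * j + s" M] by (simp add: t_def)
    then have tj: "M \<le> t j" "(t j - g) + g = t j" using M by linarith+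
    have tN: "t j + M + q + g \<le> N"
    proof -
      have "t j + M + M \<le> (2 * J + 4) * M"
        unfolding t_def using s Suc.prems mult_right_mono[of "2 * j + s + 2" "2 * J + 4" M] by (simp add: algebra_simps)
      then show ?thesis using M by (simp add: N_def)
    qed
    have tp: "t i + M + q \<le> t j - g" if "i < j" for i
    proof -
      have "t i + M + M \<le> t j"
        unfolding t_def using that mult_right_mono[of "2 * i + s + 2" "2 * j + s" M] by (simp add: algebra_simps)
      then show ?thesis using M by linarith
    qed
    have Fcyl: "cylfun (t j - g) (F j)"
      unfolding F_def Y_def
    proof (rule cylfun_comp[where G="\<lambda>s. exp (- lam * s)"], rule cylfun_sum, rule cylfun_sum, rule hit_cyl[OF A(1)])
      fix i k assume "i \<in> {..<j}" "k \<in> {..<M}"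
      then show "t i + k + q \<le> t j - g" using tp[of i] by simp
    qed
    have F0: "0 \<le> F j x" for x by (simp add: F_def)
    have EF0: "0 \<le> E N (F j)" by (rule E_nonneg) (rule F0)
    have Nle: "(t j - g) + g \<le> N" using tj tN by simp
    have Ysh: "Y j x = (\<Sum>i<M. hit A i ((f ^^ t j) x))" for x
      by (simp add: Y_def hit_def funpow_add_apply)
    have EY: "p \<le> (1 + \<eta> g)\<^sup>2 * E N (Y j)"
    proof -
      have "p = (\<Sum>i<M. measure \<mu> A)" by (simp add: p_def)
      also have "\<dots> \<le> (\<Sum>i<M. (1 + \<eta> g)\<^sup>2 * E N (hit A (t j + i)))"
      proof (intro sum_mono marginal[OF A(1)])
        fix i assume "i \<in> {..<M}"
        then show "g \<le> t j + i" "t j + i + q + g \<le> N" using tN tj(1) M by auto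
      qed
      also have "\<dots> = (1 + \<eta> g)\<^sup>2 * E N (Y j)" unfolding Y_def by (simp only: E_sum sum_distrib_left)
      finally show ?thesis .
    qed
    have EFY: "E N (F j) * (p * (1 - e / 4)) \<le> E N (\<lambda>x. F j x * Y j x)"
    proof -
      have m: "E N (F j) * E N (Y j) \<le> (1 + \<eta> g) * E N (\<lambda>x. F j x * Y j x)"
        using mixing(2)[OF Fcyl F0 _ Nle, of "\<lambda>x. \<Sum>i<M. hit A i x"] unfolding tj Ysh
        by (simp add: sum_nonneg hit_nonneg)
      let ?u = "1 + \<eta> g"
      have u: "1 \<le> ?u" using \<eta>_nonneg by simp
      have "E N (F j) * p \<le> E N (F j) * (?u\<^sup>2 * E N (Y j))" using EY EF0 by (rule mult_left_mono)
      also have "\<dots> = ?u\<^sup>2 * (E N (F j) * E N (Y j))" by (simp only: mult_ac)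
      also have "\<dots> \<le> ?u\<^sup>2 * (?u * E N (\<lambda>x. F j x * Y j x))" using m by (rule mult_left_mono) simp
      finally have 1: "E N (F j) * p \<le> ?u ^ 3 * E N (\<lambda>x. F j x * Y j x)"
        by (simp only: power2_eq_square power3_eq_cube mult_ac)
      \<comment> \<open>One factor \<open>1 + \<eta> g\<close> comes from mixing and two from the marginals;
          \<open>\<eta> g \<le> e / 12\<close> absorbs all three.\<close>
      have 2: "(1 - e / 4) * ?u ^ 3 \<le> 1"
      proof -
        have "(1 - e / 4) * ?u ^ 3 \<le> (1 - 3 * \<eta> g) * ?u ^ 3" using g u by (intro mult_right_mono) auto
        also have "\<dots> = 1 - 6 * (\<eta> g)\<^sup>2 - 8 * (\<eta> g) ^ 3 - 3 * (\<eta> g) ^ 4"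
          by (simp add: power_numeral_reduce algebra_simps)
        also have "\<dots> \<le> 1"
          using zero_le_power[OF \<eta>_nonneg[of g], of 3] zero_le_power[OF \<eta>_nonneg[of g], of 4]
            zero_le_power2[of "\<eta> g"] by linarith
        finally show ?thesis .
      qed
      have FY0: "0 \<le> E N (\<lambda>x. F j x * Y j x)" using F0 Y0 by (intro E_nonneg mult_nonneg_nonneg)
      show ?thesis
      proof (cases "0 \<le> 1 - e / 4")
        case True
        have "E N (F j) * (p * (1 - e / 4)) = (1 - e / 4) * (E N (F j) * p)" by (simp only: mult_ac)
        also have "\<dots> \<le> (1 - e / 4) * (?u ^ 3 * E N (\<lambda>x. F j x * Y j x))" using 1 True by (rule mult_left_mono)
        also have "\<dots> = ((1 - e / 4) * ?u ^ 3) * E N (\<lambda>x. F j x * Y j x)" by (simp only: mult_ac)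
        also have "\<dots> \<le> 1 * E N (\<lambda>x. F j x * Y j x)" using 2 FY0 by (rule mult_right_mono)
        finally show ?thesis by simp
      next
        case False
        then have "E N (F j) * (p * (1 - e / 4)) \<le> 0" using EF0 p0 by (intro mult_nonneg_nonpos) auto
        then show ?thesis using FY0 by linarith
      qed
    qed
    have EFY2: "E N (\<lambda>x. F j x * (Y j x)\<^sup>2) \<le> E N (F j) * V"
    proof -
      have "E N (\<lambda>x. F j x * (Y j x)\<^sup>2) \<le> (1 + \<eta> g) * (E N (F j) * E N (\<lambda>x. (Y j x)\<^sup>2))"
        using mixing(1)[OF Fcyl F0 _ Nle, of "\<lambda>x. (\<Sum>i<M. hit A i x)\<^sup>2"] unfolding tj Ysh by simp
      also have "\<dots> \<le> (1 + K) * (E N (F j) * (moment_const * (measure \<mu> A * real M * (real M * d + 1))))"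
      proof (rule mult_mono)
        show "1 + \<eta> g \<le> 1 + K" using \<eta>_le_K by simp
        show "E N (F j) * E N (\<lambda>x. (Y j x)\<^sup>2) \<le> E N (F j) * (moment_const * (measure \<mu> A * real M * (real M * d + 1)))"
          unfolding Y_def using tN by (intro mult_left_mono EF0 second_moment[OF A d]) simp
        show "0 \<le> E N (F j) * E N (\<lambda>x. (Y j x)\<^sup>2)" by (intro mult_nonneg_nonneg EF0 E_nonneg) simp
      qed (use K in simp)
      finally show ?thesis by (simp only: V_def mult_ac)
    qed
    have "E N (F (Suc j)) \<le> E N (\<lambda>x. F j x - lam * (F j x * Y j x) + lam\<^sup>2 * (F j x * (Y j x)\<^sup>2))"
    proof (rule E_mono)
      fix x
      have "F (Suc j) x = F j x * exp (- (lam * Y j x))" by (simp add: F_def distrib_left exp_diff exp_minus field_simps exp_add)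
      also have "\<dots> \<le> F j x * (1 - lam * Y j x + (lam * Y j x)\<^sup>2)"
        using F0 Y0 lam by (intro mult_left_mono exp_minus_le) auto
      finally show "F (Suc j) x \<le> F j x - lam * (F j x * Y j x) + lam\<^sup>2 * (F j x * (Y j x)\<^sup>2)"
        by (simp add: power_mult_distrib algebra_simps)
    qed
    also have "\<dots> = E N (F j) - lam * E N (\<lambda>x. F j x * Y j x) + lam\<^sup>2 * E N (\<lambda>x. F j x * (Y j x)\<^sup>2)"
      by (simp only: E_plus E_diff E_scale)
    also have "\<dots> \<le> E N (F j) - lam * (E N (F j) * (p * (1 - e / 4))) + lam\<^sup>2 * (E N (F j) * V)"
      using EFY EFY2 lam by (intro add_mono diff_mono mult_left_mono order_refl) auto
    also have "\<dots> = E N (F j) * w" by (simp add: w_def algebra_simps)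
    also have "\<dots> \<le> E N (F j) * exp (- (lam * (1 - e / 4) * p - lam\<^sup>2 * V))"
    proof (rule mult_left_mono[OF _ EF0])
      have "w = 1 + (- (lam * (1 - e / 4) * p - lam\<^sup>2 * V))" by (simp add: w_def)
      then show "w \<le> exp (- (lam * (1 - e / 4) * p - lam\<^sup>2 * V))"
        using exp_ge_add_one_self by (simp only:)
    qed
    also have "\<dots> \<le> exp (- (lam * (1 - e / 4) * p - lam\<^sup>2 * V)) ^ j * exp (- (lam * (1 - e / 4) * p - lam\<^sup>2 * V))"
      using Suc by (intro mult_right_mono) auto
    finally show ?case by (simp only: power_Suc mult.commute)
  qed
  from this[of J] show ?thesis by (simp add: F_def[abs_def] Y_def t_def)
qed

text \<open>
  Markov's inequality applied to \<open>exp_moment\<close>. The second moment of a block is of order \<open>p * m\<close>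
  where \<open>p\<close> is the mean number of visits and \<open>m = M * d\<close>, so the best parameter is of order
  \<open>e / m\<close>.
\<close>

lemma chernoff:
  fixes J M :: nat
  assumes A: "cylset q A" "A \<subseteq> ball y d" and d: "0 < d" and M: "q + g \<le> M"
    and s: "1 \<le> s" "s \<le> 2" and g: "\<eta> g \<le> e / 12" and e: "0 < e"
    and Md: "1 \<le> real M * d" and low: "d \<le> 2 * dens * measure \<mu> A"
  shows "E ((2 * J + 4) * M) (indicator {x \<in> {a..b}.
       (\<Sum>j<J. \<Sum>i<M. hit A ((2 * j + s) * M + i) x) < (1 - e / 2) * (real J * (real M * measure \<mu> A))})
     \<le> exp (- (deviation_rate * e\<^sup>2 * real J))"
proof -
  define N where "N = (2 * J + 4) * M"
  define p where "p = real M * measure \<mu> A"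
  define V where "V = (1 + K) * (moment_const * (measure \<mu> A * real M * (real M * d + 1)))"
  define W where "W = 2 * (1 + K) * moment_const"
  define m where "m = real M * d"
  define lam where "lam = e / (8 * W * m)"
  define S where "S x = (\<Sum>j<J. \<Sum>i<M. hit A ((2 * j + s) * M + i) x)" for x
  have W: "0 < W" using K moment_const_pos by (simp add: W_def)
  have m: "1 \<le> m" using Md by (simp add: m_def)
  have lam: "0 \<le> lam" using e W m by (simp add: lam_def)
  have pm: "m \<le> 2 * dens * p" using mult_left_mono[OF low, of "real M"] by (simp add: p_def m_def mult_ac)
  have p0: "0 \<le> p" by (simp add: p_def)
  have VW: "V \<le> W * p * m"
  proof -
    have "V = (1 + K) * moment_const * p * (m + 1)" by (simp add: V_def p_def m_def mult_ac)
    also have "\<dots> \<le> (1 + K) * moment_const * p * (2 * m)" using K moment_const_pos p0 m by (intro mult_left_mono) auto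
    finally show ?thesis unfolding W_def by (simp only: mult_ac)
  qed
  have "E N (indicator {x \<in> {a..b}. S x < (1 - e / 2) * (real J * p)})
     \<le> E N (\<lambda>x. exp (lam * ((1 - e / 2) * (real J * p))) * exp (- lam * S x))"
  proof (rule E_mono)
    fix x
    show "indicator {x \<in> {a..b}. S x < (1 - e / 2) * (real J * p)} x
        \<le> exp (lam * ((1 - e / 2) * (real J * p))) * exp (- lam * S x)"
    proof (cases "S x < (1 - e / 2) * (real J * p)")
      case True
      then have "lam * S x \<le> lam * ((1 - e / 2) * (real J * p))" using lam by (intro mult_left_mono) auto
      then have "1 \<le> exp (lam * ((1 - e / 2) * (real J * p)) + (- lam * S x))" by (subst one_le_exp_iff) simp
      then show ?thesis by (simp only: exp_add) (simp add: indicator_def)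
    qed (simp add: indicator_def)
  qed
  also have "\<dots> = exp (lam * ((1 - e / 2) * (real J * p))) * E N (\<lambda>x. exp (- lam * S x))" by (rule E_scale)
  also have "\<dots> \<le> exp (lam * ((1 - e / 2) * (real J * p))) * exp (- (lam * (1 - e / 4) * p - lam\<^sup>2 * V)) ^ J"
    unfolding S_def N_def p_def V_def by (intro mult_left_mono exp_moment[OF A d M s g lam]) simp
  also have "\<dots> = exp (real J * (lam\<^sup>2 * V - lam * e * p / 4))"
    by (simp add: exp_of_nat_mult[symmetric] exp_add[symmetric] algebra_simps)
  also have "\<dots> \<le> exp (real J * (- (deviation_rate * e\<^sup>2)))"
  proof (subst exp_le_cancel_iff, rule mult_left_mono)
    have "lam\<^sup>2 * V \<le> lam\<^sup>2 * (W * p * m)" using VW by (rule mult_left_mono) simp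
    also have "\<dots> = e\<^sup>2 * p / (64 * W * m)" using W m by (simp add: lam_def power2_eq_square field_simps)
    finally have 1: "lam\<^sup>2 * V \<le> e\<^sup>2 * p / (64 * W * m)" .
    have 2: "lam * e * p / 4 = 2 * (e\<^sup>2 * p / (64 * W * m))" by (simp add: lam_def power2_eq_square)
    have "deviation_rate * e\<^sup>2 = e\<^sup>2 / (64 * W) * (1 / (2 * dens))" by (simp add: deviation_rate_def W_def)
    also have "\<dots> \<le> e\<^sup>2 / (64 * W) * (p / m)"
      using pm m dens W by (intro mult_left_mono) (auto simp: field_simps)
    also have "\<dots> = e\<^sup>2 * p / (64 * W * m)" by simp
    finally show "lam\<^sup>2 * V - lam * e * p / 4 \<le> - (deviation_rate * e\<^sup>2)" using 1 2 by linarith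
  qed simp
  finally show ?thesis by (simp add: N_def S_def p_def mult_ac)
qed

text \<open>
  The union of the \<open>q\<close>-cylinders contained in a ball.
\<close>

definition core :: "nat \<Rightarrow> real \<Rightarrow> real \<Rightarrow> real set" where
  "core q z r = {x \<in> {a..b}. \<forall>x'\<in>{a..b}. same q x x' \<longrightarrow> \<bar>x' - z\<bar> < r}"

lemma core_cylset: "cylset q (core q z r)"
  unfolding core_def
proof (rule cylset_Collect, rule cylfunI)
  fix x y assume "x \<in> {a..b}" "y \<in> {a..b}" and xy: "same q x y"
  show "(\<forall>x'\<in>{a..b}. same q x x' \<longrightarrow> \<bar>x' - z\<bar> < r) = (\<forall>x'\<in>{a..b}. same q y x' \<longrightarrow> \<bar>x' - z\<bar> < r)"
    using same_trans[OF xy] same_trans[OF same_sym[OF xy]] by blast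
qed

text \<open>
  A ball of radius \<open>d\<close> contains the cylinder approximation of a ball of radius \<open>(1 - t) * d\<close>
  around a nearby net point, and what is lost lies in two intervals of length \<open>3 * t * d\<close>.
\<close>

lemma core_approx:
  assumes y: "y \<in> {a..b}" and d: "0 < d" "d \<le> b - a" and t: "0 < t" "3 * t \<le> 1"
    and yz: "\<bar>y - z\<bar> \<le> t * d" and q: "(b - a) / c ^ q \<le> t * d"
  defines "A \<equiv> core q z ((1 - t) * d)"
  shows "A \<subseteq> ball y d"
    "(1 - 6 * dens\<^sup>2 * t) * measure \<mu> (ball y d \<inter> {a..b}) \<le> measure \<mu> A"
proof -
  show "A \<subseteq> ball y d"
  proof
    fix x assume "x \<in> A"
    then have "\<bar>x - z\<bar> < (1 - t) * d" using same_refl unfolding A_def core_def by blast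
    then show "x \<in> ball y d" using yz by (auto simp: dist_real_def algebra_simps)
  qed
  let ?L = "{y - d .. y - (1 - 3 * t) * d} \<inter> {a..b}" and ?R = "{y + (1 - 3 * t) * d .. y + d} \<inter> {a..b}"
  have td: "0 \<le> t * d" using t d by simp
  have Am: "A \<in> sets \<mu>" unfolding A_def by (rule cylset_sets[OF core_cylset])
  have LR: "?L \<in> sets \<mu>" "?R \<in> sets \<mu>" by (intro borel_sets_\<mu>; simp)+
  have "ball y d \<inter> {a..b} \<subseteq> A \<union> (?L \<union> ?R)"
  proof
    fix x assume x: "x \<in> ball y d \<inter> {a..b}"
    show "x \<in> A \<union> (?L \<union> ?R)"
    proof (cases "\<bar>x - y\<bar> < (1 - 3 * t) * d")
      case True
      have "\<bar>x' - z\<bar> < (1 - t) * d" if x': "x' \<in> {a..b}" "same q x x'" for x'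
      proof -
        have "\<bar>x - x'\<bar> \<le> t * d" using same_dist[of x x' q] x x' q by simp
        then show ?thesis using True yz by (simp add: algebra_simps)
      qed
      then show ?thesis using x by (simp add: A_def core_def)
    next
      case False
      then show ?thesis using x by (auto simp: dist_real_def)
    qed
  qed
  then have "measure \<mu> (ball y d \<inter> {a..b}) \<le> measure \<mu> (A \<union> (?L \<union> ?R))"
    using Am LR by (intro finite_measure_mono) auto
  also have "\<dots> \<le> measure \<mu> A + measure \<mu> (?L \<union> ?R)" using Am LR by (intro measure_Un_le) auto
  also have "\<dots> \<le> measure \<mu> A + (measure \<mu> ?L + measure \<mu> ?R)"
    using LR by (intro add_left_mono measure_Un_le) auto
  also have "\<dots> \<le> measure \<mu> A + (dens * (3 * t * d) + dens * (3 * t * d))"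
    using dens_upper[of "y - d" "y - (1 - 3 * t) * d"] dens_upper[of "y + (1 - 3 * t) * d" "y + d"] td
    by (simp add: algebra_simps)
  also have "\<dots> = measure \<mu> A + (6 * dens * t) * d" by simp
  also have "\<dots> \<le> measure \<mu> A + (6 * dens * t) * (dens * measure \<mu> (ball y d \<inter> {a..b}))"
    using dens_lower[OF y d] dens t by (intro add_left_mono mult_left_mono) auto
  finally show "(1 - 6 * dens\<^sup>2 * t) * measure \<mu> (ball y d \<inter> {a..b}) \<le> measure \<mu> A"
    by (simp add: power2_eq_square algebra_simps)
qed

text \<open>
  Off a set of small measure, every net point receives at least the proportion \<open>1 - e / 2\<close> of
  the expected visits in the blocks of either parity. The omitted block 0 and the passage from
  balls to cylinder sets cost a factor \<open>1 - e / 4\<close> each, and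
  \<open>(1 - e / 2) * (1 - e / 4)\<^sup>2 \<ge> 1 - e\<close>.
\<close>

lemma blanket_tail:
  fixes J M :: nat
  assumes e: "0 < e" "e < 1" and d: "0 < d" "d \<le> b - a"
    and t: "t = e / (24 * dens\<^sup>2)" and q: "(b - a) / c ^ q \<le> t * d" and g: "\<eta> g \<le> e / 12"
    and M: "q + g \<le> M" "1 \<le> real M * d" and J: "4 \<le> e * (2 * real J + 1)"
  shows "\<exists>B\<in>sets \<mu>. measure \<mu> B \<le> 2 * Cg\<^sup>2 * ((b - a) / (t * d) + 1) * exp (- (deviation_rate * e\<^sup>2 * real J)) \<and>
     (\<forall>x\<in>{a..b} - B. \<forall>y\<in>{a..b}. (1 - e) * measure \<mu> (ball y d \<inter> {a..b})
        \<le> 1 / real ((2 * J + 1) * M) * (\<Sum>i<(2 * J + 1) * M. indicator (ball y d) ((f ^^ i) x)))"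
proof -
  have dens2: "1 \<le> dens\<^sup>2" using dens by simp
  have t0: "0 < t" using e dens by (simp add: t)
  have "e / (24 * dens\<^sup>2) \<le> 1 / 3" using e dens2 by (simp add: divide_le_eq)
  then have t1: "3 * t \<le> 1" by (simp add: t)
  have t6: "6 * dens\<^sup>2 * t = e / 4" using dens by (simp add: t)
  have td: "0 < t * d" using t0 d by simp
  obtain Z where Z: "finite Z" "Z \<subseteq> {a..b}" "\<And>y. y \<in> {a..b} \<Longrightarrow> \<exists>z\<in>Z. \<bar>y - z\<bar> \<le> t * d"
    "real (card Z) \<le> (b - a) / (t * d) + 1"
    using interval_net[OF ab td] by blast
  define A where "A z = core q z ((1 - t) * d)" for z
  define S where "S s z x = (\<Sum>j<J. \<Sum>i<M. hit (A z) ((2 * j + s) * M + i) x)" for s z x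
  define B where "B s z = {x \<in> {a..b}. S s z x < (1 - e / 2) * (real J * (real M * measure \<mu> (A z)))}" for s z
  have Acyl: "cylset q (A z)" for z unfolding A_def by (rule core_cylset)
  have approx: "A z \<subseteq> ball y d" "(1 - e / 4) * measure \<mu> (ball y d \<inter> {a..b}) \<le> measure \<mu> (A z)"
    if "y \<in> {a..b}" "\<bar>y - z\<bar> \<le> t * d" for y z
    using core_approx[OF that(1) d t0 t1 that(2) q] unfolding A_def t6 by blast+
  have Bcyl: "cylset ((2 * J + 4) * M) (B s z)" if s: "s \<in> {1, 2}" for s z
    unfolding B_def S_def
  proof (rule cylset_Collect, rule cylfun_comp[where G="\<lambda>w. w < _"], rule cylfun_sum, rule cylfun_sum, rule hit_cyl[OF Acyl])
    fix j i assume ji: "j \<in> {..<J}" "i \<in> {..<M}"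
    have "(2 * j + s) * M + M + M \<le> (2 * J + 4) * M"
      using s ji mult_right_mono[of "2 * j + s + 2" "2 * J + 4" M] by (auto simp: algebra_simps)
    then show "(2 * j + s) * M + i + q \<le> (2 * J + 4) * M" using ji M by simp
  qed
  have Bm: "measure \<mu> (B s z) \<le> Cg\<^sup>2 * exp (- (deviation_rate * e\<^sup>2 * real J))" if s: "s \<in> {1, 2}" and z: "z \<in> Z" for s z
  proof -
    have zI: "z \<in> {a..b}" using Z z by blast
    have zz: "\<bar>z - z\<bar> \<le> t * d" using td by simp
    have "d \<le> dens * measure \<mu> (ball z d \<inter> {a..b})" by (rule dens_lower[OF zI d])
    also have "\<dots> \<le> dens * (2 * measure \<mu> (A z))"
    proof (rule mult_left_mono)
      have "1 / 2 * measure \<mu> (ball z d \<inter> {a..b}) \<le> (1 - e / 4) * measure \<mu> (ball z d \<inter> {a..b})"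
        using e by (intro mult_right_mono) auto
      then show "measure \<mu> (ball z d \<inter> {a..b}) \<le> 2 * measure \<mu> (A z)" using approx(2)[OF zI zz] by linarith
    qed (use dens in simp)
    finally have low: "d \<le> 2 * dens * measure \<mu> (A z)" by simp
    have "measure \<mu> (B s z) \<le> Cg\<^sup>2 * E ((2 * J + 4) * M) (indicator (B s z))" by (rule E_vs_measure(1)[OF Bcyl[OF s]])
    also have "\<dots> \<le> Cg\<^sup>2 * exp (- (deviation_rate * e\<^sup>2 * real J))"
      unfolding B_def S_def
      by (intro mult_left_mono chernoff[OF Acyl approx(1)[OF zI zz] d(1) M(1) _ _ g e(1) M(2) low]) (use s in auto)
    finally show ?thesis .
  qed
  define BB where "BB = (\<Union>z\<in>Z. B 1 z \<union> B 2 z)"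
  have Bs: "B s z \<in> sets \<mu>" if "s \<in> {1, 2}" for s z by (rule cylset_sets[OF Bcyl[OF that]])
  have BBs: "BB \<in> sets \<mu>" unfolding BB_def using Bs Z(1) by (intro sets.finite_UN sets.Un) auto
  have "measure \<mu> BB \<le> (\<Sum>z\<in>Z. measure \<mu> (B 1 z \<union> B 2 z))"
    unfolding BB_def using Bs Z(1) by (intro finite_measure_subadditive_finite) auto
  also have "\<dots> \<le> (\<Sum>z\<in>Z. 2 * (Cg\<^sup>2 * exp (- (deviation_rate * e\<^sup>2 * real J))))"
  proof (rule sum_mono)
    fix z assume z: "z \<in> Z"
    have "measure \<mu> (B 1 z \<union> B 2 z) \<le> measure \<mu> (B 1 z) + measure \<mu> (B 2 z)"
      using Bs by (intro measure_Un_le) auto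
    then show "measure \<mu> (B 1 z \<union> B 2 z) \<le> 2 * (Cg\<^sup>2 * exp (- (deviation_rate * e\<^sup>2 * real J)))"
      using Bm[OF _ z, of 1] Bm[OF _ z, of 2] by simp
  qed
  also have "\<dots> = real (card Z) * (2 * (Cg\<^sup>2 * exp (- (deviation_rate * e\<^sup>2 * real J))))" by simp
  also have "\<dots> \<le> ((b - a) / (t * d) + 1) * (2 * (Cg\<^sup>2 * exp (- (deviation_rate * e\<^sup>2 * real J))))"
    using Z(4) by (intro mult_right_mono) auto
  finally have BBm: "measure \<mu> BB \<le> 2 * Cg\<^sup>2 * ((b - a) / (t * d) + 1) * exp (- (deviation_rate * e\<^sup>2 * real J))"
    by (simp only: mult_ac)
  have main: "(1 - e) * measure \<mu> (ball y d \<inter> {a..b})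
        \<le> 1 / real ((2 * J + 1) * M) * (\<Sum>i<(2 * J + 1) * M. indicator (ball y d) ((f ^^ i) x))"
    if x: "x \<in> {a..b} - BB" and y: "y \<in> {a..b}" for x y
  proof -
    obtain z where z: "z \<in> Z" "\<bar>y - z\<bar> \<le> t * d" using Z(3)[OF y] by blast
    let ?m = "measure \<mu> (ball y d \<inter> {a..b})" and ?T = "real ((2 * J + 1) * M)"
    let ?X = "(1 - e / 2) * (real J * (real M * measure \<mu> (A z)))"
    have M0: "0 < real M" using M(2) d by (cases "M = 0") auto
    have S12: "?X \<le> S 1 z x" "?X \<le> S 2 z x" using x z(1) by (auto simp: BB_def B_def not_less)
    have "2 * ?X \<le> S 1 z x + S 2 z x" using S12 by simp
    also have "\<dots> \<le> (\<Sum>i<(2 * J + 1) * M. hit (A z) i x)"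
      unfolding S_def by (rule sum_blocks[of "\<lambda>i. hit (A z) i x", OF hit_nonneg])
    also have "\<dots> \<le> (\<Sum>i<(2 * J + 1) * M. indicator (ball y d) ((f ^^ i) x))"
      unfolding hit_def using approx(1)[OF y z(2)] by (intro sum_mono) (auto simp: indicator_def)
    finally have vis: "2 * ?X \<le> (\<Sum>i<(2 * J + 1) * M. indicator (ball y d) ((f ^^ i) x))" .
    have T0: "0 < ?T" using M0 by (simp only: of_nat_0_less_iff nat_0_less_mult_iff) simp
    have JT: "(1 - e / 4) * ?T \<le> 2 * real J * real M"
    proof -
      have "(1 - e / 4) * (2 * real J + 1) \<le> 2 * real J" using J by (simp add: algebra_simps)
      from mult_right_mono[OF this, of "real M"] show ?thesis by (simp add: algebra_simps)
    qed
    have m0: "0 \<le> ?m" by simp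
    have "(1 - e) * ?m \<le> ((1 - e / 2) * ((1 - e / 4) * (1 - e / 4))) * ?m"
    proof (rule mult_right_mono[OF _ m0])
      have "(1 - e / 2) * ((1 - e / 4) * (1 - e / 4)) = 1 - e + e\<^sup>2 * (5 / 16 - e / 32)"
        by (simp add: algebra_simps power2_eq_square add_divide_distrib diff_divide_distrib)
      moreover have "0 \<le> e\<^sup>2 * (5 / 16 - e / 32)" using e by (intro mult_nonneg_nonneg) auto
      ultimately show "1 - e \<le> (1 - e / 2) * ((1 - e / 4) * (1 - e / 4))" by linarith
    qed
    then have "?T * ((1 - e) * ?m) \<le> ?T * (((1 - e / 2) * ((1 - e / 4) * (1 - e / 4))) * ?m)"
      using T0 by (intro mult_left_mono) auto
    also have "\<dots> = (1 - e / 2) * (((1 - e / 4) * ?T) * ((1 - e / 4) * ?m))" by (simp only: mult_ac)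
    also have "\<dots> \<le> (1 - e / 2) * ((2 * real J * real M) * measure \<mu> (A z))"
      by (rule mult_left_mono[OF mult_mono[OF JT approx(2)[OF y z(2)]]]) (use e in simp_all)
    also have "\<dots> = 2 * ?X" by simp
    finally have "?T * ((1 - e) * ?m) \<le> (\<Sum>i<(2 * J + 1) * M. indicator (ball y d) ((f ^^ i) x))"
      using vis by linarith
    from mult_left_mono[OF this, of "1 / ?T"] show ?thesis using T0 by simp
  qed
  show ?thesis using BBs BBm main by (intro bexI[of _ BB]) auto
qed

end

section \<open>The expected blanket time\<close>

context gibbs_coding
begin

text \<open>
  With \<open>l = 1 + ln (1 / e) + ln (1 / d)\<close>, the cylinder depth \<open>q\<close>, the gap \<open>g\<close> and the logarithm
  of the size of the net are all of order \<open>l\<close>. Blocks of length \<open>M\<close> of order \<open>1 / (sqrt e * d)\<close>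
  are long enough, and after multiples of \<open>J0\<close>, of order \<open>l / e\<^sup>2\<close>, the tail bounds decrease
  geometrically. Since \<open>l \<le> 4 / sqrt e * ln (1 / d)\<close>, the product of \<open>J0\<close> and \<open>M\<close> has the right
  order.
\<close>

lemma blanket_expectation:
  assumes supp: "measure_support \<mu> = {a..b}"
  shows "\<exists>C\<ge>1. \<forall>e d. 0 < e \<longrightarrow> e < 1 \<longrightarrow> 0 < d \<longrightarrow> d \<le> exp (-1) \<longrightarrow> d \<le> b - a \<longrightarrow>
     expected_time \<mu> (blanket_time f \<mu> (1 - e) d) \<le> ennreal (C / e ^ 3 * (1 / d * ln (1 / d)))"
proof -
  define w where "w = 24 * dens\<^sup>2 * (b - a)"
  define C1 where "C1 = 1 / ln c + 1 / ln (1 / \<gamma>) + \<bar>ln w\<bar> / ln c + \<bar>ln (12 * K)\<bar> / ln (1 / \<gamma>) + 2"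
  define C3 where "C3 = 1 + ln (2 * Cg\<^sup>2 * (w + 1))"
  define C4 where "C4 = (1 + C3) / deviation_rate + 2"
  define C where "C = 120 * (C4 + 1) * C1"
  have w0: "0 < w" using dens ab by (simp add: w_def)
  have lc: "0 < ln c" "0 < ln (1 / \<gamma>)" using c_gt_1 \<gamma> by auto
  have C1: "2 \<le> C1" using lc by (auto simp: C1_def intro!: add_nonneg_nonneg)
  have Cw: "2 * Cg\<^sup>2 * (w + 1) \<ge> 1"
  proof -
    have "1 * 1 \<le> Cg\<^sup>2 * (w + 1)" using Cg w0 by (intro mult_mono) auto
    then show ?thesis by simp
  qed
  have C3: "1 \<le> C3" using Cw by (simp add: C3_def)
  have C4: "2 \<le> C4" using C3 deviation_rate_pos by (simp add: C4_def)
  have "120 * 1 * 1 \<le> C" unfolding C_def using C1 C4 by (intro mult_mono) auto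
  then have C: "1 \<le> C" by simp
  show ?thesis
  proof (intro exI[of _ C] conjI C allI impI)
    fix e d :: real assume e: "0 < e" "e < 1" and d: "0 < d" "d \<le> exp (-1)" "d \<le> b - a"
    have d1: "d < 1" 
    proof -
      have "exp (-1) < (1::real)" by simp
      then show ?thesis using d(2) by linarith
    qed
    define l where "l = 1 + ln (1 / e) + ln (1 / d)"
    have lne: "0 \<le> ln (1 / e)" "0 \<le> ln (1 / d)" using e d d1 by (auto simp: ln_div)
    have D1: "1 \<le> ln (1 / d)" using d ln_mono[of d "exp (-1)"] by (simp add: ln_div)
    have l: "1 \<le> l" using lne by (simp add: l_def)
    have se: "0 < sqrt e" "sqrt e \<le> 1" "sqrt e * sqrt e = e" using e by auto
    have le: "ln (1 / e) \<le> 2 / sqrt e"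
    proof -
      have "ln (1 / sqrt e) \<le> 1 / sqrt e" using se ln_le_minus_one[of "1 / sqrt e"] by simp
      moreover have "ln (1 / e) = 2 * ln (1 / sqrt e)" using e by (simp add: ln_div ln_sqrt)
      ultimately show ?thesis by simp
    qed
    have s1: "1 \<le> 1 / sqrt e" using se by simp
    have ld: "ln (1 / d) \<le> 1 / d" using d ln_le_minus_one[of "1 / d"] by simp
    have id1: "1 \<le> 1 / d" using d d1 by simp
    have l_le1: "l \<le> 4 / (sqrt e * d)"
    proof -
      have "1 / sqrt e * 1 \<le> 1 / sqrt e * (1 / d)" using se id1 by (intro mult_left_mono) auto
      moreover have "1 * (1 / d) \<le> 1 / sqrt e * (1 / d)" using s1 d by (intro mult_right_mono) auto
      ultimately have "l \<le> 4 * (1 / sqrt e * (1 / d))" using le ld id1 s1 unfolding l_def by linarith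
      then show ?thesis by simp
    qed
    have l_le2: "l \<le> 4 / sqrt e * ln (1 / d)"
    proof -
      have "1 / sqrt e * 1 \<le> 1 / sqrt e * ln (1 / d)" using se D1 by (intro mult_left_mono) auto
      moreover have "1 * ln (1 / d) \<le> 1 / sqrt e * ln (1 / d)" using s1 D1 by (intro mult_right_mono) auto
      ultimately have "l \<le> 4 * (1 / sqrt e * ln (1 / d))" using le D1 s1 unfolding l_def by linarith
      then show ?thesis by simp
    qed
    define t where "t = e / (24 * dens\<^sup>2)"
    have t0: "0 < t" using e dens by (simp add: t_def)
    have tw: "t * d / (b - a) = e * d / w" by (simp add: t_def w_def)
    obtain q where q: "(1 / c) ^ q \<le> e * d / w" "real q \<le> \<bar>ln (e * d / w)\<bar> / ln (1 / (1 / c)) + 1"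
      using power_below[of "1 / c" "e * d / w"] c_gt_1 e d w0 by auto
    have q': "(b - a) / c ^ q \<le> t * d"
    proof -
      have "(1 / c) ^ q \<le> t * d / (b - a)" using q(1) tw by simp
      from mult_left_mono[OF this, of "b - a"] show ?thesis using ab by (simp add: power_divide)
    qed
    obtain g where g: "\<gamma> ^ g \<le> e / (12 * K)" "real g \<le> \<bar>ln (e / (12 * K))\<bar> / ln (1 / \<gamma>) + 1"
      using power_below[of \<gamma> "e / (12 * K)"] \<gamma> e K by auto
    have g': "\<eta> g \<le> e / 12" using mult_left_mono[OF g(1), of K] K by (simp add: \<eta>_def)
    have qg: "real (q + g) \<le> C1 * l"
    proof -
      have "ln (e * d / w) = - ln (1 / e) - ln (1 / d) - ln w" using e d w0 by (simp add: ln_div ln_mult)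
      then have "\<bar>ln (e * d / w)\<bar> \<le> l + \<bar>ln w\<bar> * l"
        using lne l mult_left_mono[OF l, of "\<bar>ln w\<bar>"] unfolding l_def by linarith
      then have "\<bar>ln (e * d / w)\<bar> / ln c \<le> (l + \<bar>ln w\<bar> * l) / ln c" using lc by (intro divide_right_mono) auto
      then have 1: "real q \<le> (l + \<bar>ln w\<bar> * l) / ln c + l" using q(2) l by simp
      have "ln (e / (12 * K)) = - ln (1 / e) - ln (12 * K)" using e K by (simp add: ln_div)
      then have "\<bar>ln (e / (12 * K))\<bar> \<le> l + \<bar>ln (12 * K)\<bar> * l"
        using lne l mult_left_mono[OF l, of "\<bar>ln (12 * K)\<bar>"] unfolding l_def by linarith
      then have "\<bar>ln (e / (12 * K))\<bar> / ln (1 / \<gamma>) \<le> (l + \<bar>ln (12 * K)\<bar> * l) / ln (1 / \<gamma>)"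
        using lc by (intro divide_right_mono) auto
      then have 2: "real g \<le> (l + \<bar>ln (12 * K)\<bar> * l) / ln (1 / \<gamma>) + l" using g(2) l by simp
      have "C1 * l = ((l + \<bar>ln w\<bar> * l) / ln c + l) + ((l + \<bar>ln (12 * K)\<bar> * l) / ln (1 / \<gamma>) + l)"
        by (simp add: C1_def distrib_right add_divide_distrib)
      then show ?thesis using 1 2 by simp
    qed
    define M where "M = nat \<lceil>4 * C1 / (sqrt e * d)\<rceil>"
    have sed: "0 < sqrt e * d" using se d by simp
    have sed1: "1 \<le> 1 / (sqrt e * d)" using se d d1 mult_le_one[of "sqrt e" d] by (simp add: field_simps)
    have M: "4 * C1 / (sqrt e * d) \<le> real M" "real M \<le> 5 * C1 / (sqrt e * d)"
    proof -
      have p: "0 \<le> 4 * C1 / (sqrt e * d)" using C1 sed by simp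
      then show "4 * C1 / (sqrt e * d) \<le> real M" unfolding M_def by (simp add: real_nat_ceiling_ge)
      have "real M \<le> 4 * C1 / (sqrt e * d) + 1" unfolding M_def using p by (simp add: of_nat_nat)
      moreover have "1 \<le> C1 * (1 / (sqrt e * d))" using C1 sed1 mult_mono[of 1 C1 1 "1 / (sqrt e * d)"] by simp
      moreover have "5 * C1 / (sqrt e * d) = 4 * C1 / (sqrt e * d) + C1 * (1 / (sqrt e * d))"
        by (simp flip: add_divide_distrib)
      ultimately show "real M \<le> 5 * C1 / (sqrt e * d)" by linarith
    qed
    have Mqg: "q + g \<le> M"
    proof -
      have "C1 * l \<le> C1 * (4 / (sqrt e * d))" using l_le1 C1 by (intro mult_left_mono) auto
      then have "real (q + g) \<le> real M" using qg M(1) by (simp add: mult.commute)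
      then show ?thesis by simp
    qed
    have Md: "1 \<le> real M * d"
    proof -
      have "1 * 1 \<le> 4 * C1 * (1 / sqrt e)" using C1 s1 by (intro mult_mono) auto
      also have "\<dots> = 4 * C1 / (sqrt e * d) * d" using d by simp
      also have "\<dots> \<le> real M * d" using M(1) d by (intro mult_right_mono) auto
      finally show ?thesis by simp
    qed
    define J0 where "J0 = nat \<lceil>C4 * l / e\<^sup>2\<rceil>"
    have ie: "1 \<le> 1 / e" "1 / e \<le> 1 / e\<^sup>2" using e by (auto simp: field_simps power2_eq_square)
    have le2: "1 \<le> l / e\<^sup>2" using mult_mono[OF l, of 1 "1 / e\<^sup>2"] ie l by simp
    have J0: "C4 * l / e\<^sup>2 \<le> real J0" "real J0 \<le> (C4 + 1) * l / e\<^sup>2"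
    proof -
      have p: "0 \<le> C4 * l / e\<^sup>2" using C4 l by simp
      then show "C4 * l / e\<^sup>2 \<le> real J0" unfolding J0_def by (simp add: real_nat_ceiling_ge)
      have "real J0 \<le> C4 * l / e\<^sup>2 + 1" unfolding J0_def using p by (simp add: of_nat_nat)
      then show "real J0 \<le> (C4 + 1) * l / e\<^sup>2" using le2 by (simp add: distrib_right add_divide_distrib)
    qed
    have J0e: "2 \<le> e * real J0"
    proof -
      have "2 * 1 \<le> C4 * l" using C4 l by (intro mult_mono) auto
      then have "2 * (1 / e) \<le> C4 * l * (1 / e\<^sup>2)" using ie C4 l e by (intro mult_mono) auto
      then have "2 / e \<le> real J0" using J0(1) by simp
      then show ?thesis using e by (simp add: field_simps)
    qed
    have J0c: "l * (1 + C3) \<le> deviation_rate * e\<^sup>2 * real J0"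
    proof -
      have "(1 + C3) / deviation_rate * l \<le> C4 * l" using l by (intro mult_right_mono) (auto simp: C4_def)
      also have "\<dots> = e\<^sup>2 * (C4 * l / e\<^sup>2)" using e by simp
      also have "\<dots> \<le> e\<^sup>2 * real J0" using J0(1) by (rule mult_left_mono) simp
      finally have "deviation_rate * ((1 + C3) / deviation_rate * l) \<le> deviation_rate * (e\<^sup>2 * real J0)" using deviation_rate_pos by (intro mult_left_mono) auto
      then show ?thesis using deviation_rate_pos by (simp add: mult_ac)
    qed
    \<comment> \<open>One block more than twice the number of blocks of one parity, for the omitted
        block 0.\<close>
    define T where "T i = (2 * (Suc i * J0) + 1) * M" for i
    let ?good = "\<lambda>i x. \<forall>y\<in>{a..b}. (1 - e) * measure \<mu> (ball y d \<inter> {a..b})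
        \<le> 1 / real (T i) * (\<Sum>i<T i. indicator (ball y d) ((f ^^ i) x))"
    have "\<exists>B\<in>sets \<mu>. measure \<mu> B \<le> (1 / 2) ^ Suc i \<and> (\<forall>x\<in>{a..b} - B. ?good i x)" for i
    proof -
      have J: "4 \<le> e * (2 * real (Suc i * J0) + 1)"
      proof -
        have "real J0 \<le> real (Suc i * J0)" by (subst of_nat_le_iff) simp
        then have "e * real J0 \<le> e * real (Suc i * J0)" using e by (intro mult_left_mono) auto
        moreover have "e * (2 * X + 1) = 2 * (e * X) + e" for X :: real by (simp add: algebra_simps)
        ultimately show ?thesis using J0e e by (simp only:)
      qed
      obtain B where B: "B \<in> sets \<mu>"
        "measure \<mu> B \<le> 2 * Cg\<^sup>2 * ((b - a) / (t * d) + 1) * exp (- (deviation_rate * e\<^sup>2 * real (Suc i * J0)))"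
        "\<forall>x\<in>{a..b} - B. ?good i x"
        using blanket_tail[OF e d(1,3) t_def q' g' Mqg Md J] unfolding T_def by blast
      have "2 * Cg\<^sup>2 * ((b - a) / (t * d) + 1) \<le> exp (l * C3)"
      proof -
        have "(b - a) / (t * d) = w / (e * d)" using e d dens by (simp add: t_def w_def)
        moreover have "1 \<le> 1 / (e * d)" using e d d1 mult_le_one[of e d] by (simp add: field_simps)
        ultimately have "(b - a) / (t * d) + 1 \<le> (w + 1) * (1 / (e * d))" by (simp add: add_divide_distrib)
        then have "2 * Cg\<^sup>2 * ((b - a) / (t * d) + 1) \<le> 2 * Cg\<^sup>2 * ((w + 1) * (1 / (e * d)))"
          by (intro mult_left_mono) auto
        also have "\<dots> = exp (ln (2 * Cg\<^sup>2 * (w + 1)) + ln (1 / e) + ln (1 / d))"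
        proof -
          have "0 < 2 * Cg\<^sup>2 * (w + 1)" using Cw by linarith
          moreover have "0 < 1 / e" "0 < 1 / d" using e d by simp_all
          ultimately show ?thesis by (simp only: exp_add exp_ln) simp
        qed
        also have "\<dots> \<le> exp (l * C3)"
        proof (subst exp_le_cancel_iff)
          have "l * (C3 - 1) \<ge> 1 * (C3 - 1)" using l C3 by (intro mult_right_mono) auto
          then show "ln (2 * Cg\<^sup>2 * (w + 1)) + ln (1 / e) + ln (1 / d) \<le> l * C3"
            unfolding C3_def l_def by (simp add: algebra_simps)
        qed
        finally show ?thesis .
      qed
      then have "measure \<mu> B \<le> exp (l * C3) * exp (- (deviation_rate * e\<^sup>2 * real (Suc i * J0)))"
        using B(2) by (meson exp_ge_zero mult_right_mono order_trans)
      also have "\<dots> \<le> exp (- real (Suc i))"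
      proof -
        define n where "n = real (Suc i)"
        have n: "1 \<le> n" by (simp add: n_def)
        have gen: "A + - Y \<le> - m" if "u \<le> v" "u = x + z" "m \<le> x" "A \<le> z" "Y = v" for A Y m u v x z :: real
          using that by linarith
        have "l * C3 + - (deviation_rate * e\<^sup>2 * real (Suc i * J0)) \<le> - n"
        proof (rule gen)
          show "n * (l * (1 + C3)) \<le> n * (deviation_rate * e\<^sup>2 * real J0)" using J0c n by (intro mult_left_mono) auto
          show "n * (l * (1 + C3)) = n * l + n * (l * C3)" by (simp add: distrib_left)
          show "n \<le> n * l" using mult_left_mono[OF l, of n] n by simp
          show "l * C3 \<le> n * (l * C3)" using mult_right_mono[OF n, of "l * C3"] l C3 by simp
          show "deviation_rate * e\<^sup>2 * real (Suc i * J0) = n * (deviation_rate * e\<^sup>2 * real J0)"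
            by (simp only: n_def of_nat_mult mult_ac)
        qed
        note this[unfolded n_def]
        then show ?thesis by (simp only: exp_add[symmetric] exp_le_cancel_iff)
      qed
      also have "\<dots> = exp (-1) ^ Suc i" using exp_of_nat_mult[of "Suc i" "-1::real"] by simp
      also have "\<dots> \<le> (1 / 2) ^ Suc i"
      proof (rule power_mono)
        have "(2::real) \<le> exp 1" using exp_ge_add_one_self[of 1] by simp
        then show "exp (-1) \<le> (1 / 2 :: real)" by (simp add: exp_minus field_simps)
      qed simp
      finally show ?thesis using B by blast
    qed
    then obtain B where B: "\<And>i. B i \<in> sets \<mu>" "\<And>i. measure \<mu> (B i) \<le> (1 / 2) ^ Suc i"
      "\<And>i x. x \<in> {a..b} - B i \<Longrightarrow> ?good i x" by metis
    define W where "W = real (3 * J0 * M)"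
    have M0: "0 < M" using Md d by (cases "M = 0") auto
    have J00: "0 < J0" using J0e by (cases "J0 = 0") auto
    have W0: "0 < W" using M0 J00 by (simp add: W_def)
    have TW: "real (T i) \<le> W * (1 + real i)" for i
    proof -
      have "2 * (Suc i * J0) + 1 \<le> 3 * (Suc i * J0)" using J00 by simp
      then have "T i \<le> 3 * (Suc i * J0) * M" unfolding T_def by (rule mult_right_mono) simp
      then have "real (T i) \<le> real (3 * (Suc i * J0) * M)" by (simp only: of_nat_le_iff)
      then show ?thesis by (simp add: W_def algebra_simps)
    qed
    have bt: "blanket_time f \<mu> (1 - e) d x \<le> enat (T i)" if "x \<in> {a..b} - B i" for x i
      unfolding blanket_time_def supp space_\<mu>
    proof (rule INF_lower, rule CollectI, rule conjI)
      show "1 \<le> T i" using M0 by (simp add: T_def)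
      show "?good i x" by (rule B(3)[OF that])
    qed
    \<comment> \<open>If \<open>i\<close> is the first index with \<open>x \<notin> B i\<close>, then \<open>x\<close> lies in \<open>B 0, \<dots>, B (i - 1)\<close>,
        and the blanket time is at most \<open>W * (1 + i)\<close>.\<close>
    have pw: "ennreal_of_enat (blanket_time f \<mu> (1 - e) d x)
        \<le> ennreal W * (1 + (\<Sum>i. indicator (B i) x))" if x: "x \<in> space \<mu>" for x
    proof (cases "\<forall>i. x \<in> B i")
      case True
      then have "(\<Sum>i. indicator (B i) x) = (\<Sum>i::nat. 1 :: ennreal)" by simp
      also have "\<dots> = \<top>"
      proof (rule ccontr)
        assume "(\<Sum>i::nat. 1 :: ennreal) \<noteq> \<top>"
        then obtain n where n: "(\<Sum>i::nat. 1 :: ennreal) < of_nat n" using ennreal_Ex_less_of_nat by (auto simp: top.not_eq_extremum)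
        have "(\<Sum>i<n. 1 :: ennreal) \<le> (\<Sum>i::nat. 1)" by (rule sum_le_suminf) auto
        then show False using n by simp
      qed
      finally have top: "(\<Sum>i. indicator (B i) x) = (\<top> :: ennreal)" .
      have "1 + \<top> = (\<top> :: ennreal)" by simp
      moreover have "ennreal W \<noteq> 0" using W0 by (simp only: ennreal_eq_0_iff not_le)
      ultimately have "ennreal W * (1 + \<top>) = \<top>" by (simp only: ennreal_mult_top if_False)
      then show ?thesis unfolding top by (simp only: top_greatest)
    next
      case False
      define i where "i = (LEAST i. x \<notin> B i)"
      have i1: "x \<notin> B i" unfolding i_def by (rule LeastI_ex) (use False in blast)
      have i2: "x \<in> B k" if "k < i" for k using not_less_Least[OF that[unfolded i_def]] by blast
      have "ennreal_of_enat (blanket_time f \<mu> (1 - e) d x) \<le> ennreal_of_enat (enat (T i))"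
        using bt[of x i] x i1 by (subst ennreal_of_enat_le_iff) (simp add: space_\<mu>)
      also have "\<dots> = ennreal (real (T i))" by (simp add: ennreal_of_nat_eq_real_of_nat)
      also have "\<dots> \<le> ennreal (W * (1 + real i))" by (intro ennreal_leI TW)
      also have "\<dots> = ennreal W * (1 + (\<Sum>k<i. indicator (B k) x))"
      proof -
        have "(\<Sum>k<i. indicator (B k) x) = (\<Sum>k<i. 1 :: ennreal)" using i2 by (intro sum.cong) auto
        then have "(\<Sum>k<i. indicator (B k) x) = ennreal (real i)" by (simp add: ennreal_of_nat_eq_real_of_nat)
        moreover have "ennreal (W * (1 + real i)) = ennreal W * (ennreal 1 + ennreal (real i))"
          using W0 by (subst ennreal_plus[symmetric]) (simp_all add: ennreal_mult)
        ultimately show ?thesis by simp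
      qed
      also have "\<dots> \<le> ennreal W * (1 + (\<Sum>k. indicator (B k) x))"
        by (intro mult_left_mono add_left_mono sum_le_suminf) auto
      finally show ?thesis .
    qed
    have "expected_time \<mu> (blanket_time f \<mu> (1 - e) d) \<le> (\<integral>\<^sup>+x. ennreal W * (1 + (\<Sum>i. indicator (B i) x)) \<partial>\<mu>)"
      unfolding expected_time_def by (rule nn_integral_mono[OF pw])
    also have "\<dots> = ennreal W * (1 + (\<Sum>i. emeasure \<mu> (B i)))"
      using B(1) by (simp add: nn_integral_cmult nn_integral_add nn_integral_suminf emeasure_space_1)
    also have "\<dots> \<le> ennreal W * (1 + (\<Sum>i. ennreal ((1 / 2) ^ Suc i)))"
      using B(2) by (intro mult_left_mono add_left_mono suminf_le) (auto simp: emeasure_eq_measure intro!: ennreal_leI)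
    also have "(\<Sum>i. ennreal ((1 / 2) ^ Suc i)) = ennreal 1"
    proof (rule sums_unique[symmetric])
      show "(\<lambda>i. ennreal ((1 / 2) ^ Suc i)) sums ennreal 1"
        using power_half_series by (subst sums_ennreal) (simp_all del: power_Suc)
    qed
    also have "ennreal W * (1 + ennreal 1) = ennreal (2 * W)"
      using W0 by (simp add: ennreal_mult'' mult.commute flip: ennreal_1 ennreal_plus)
    also have "\<dots> \<le> ennreal (C / e ^ 3 * (1 / d * ln (1 / d)))"
    proof (rule ennreal_leI)
      have "2 * W = 6 * (real J0 * real M)" by (simp add: W_def)
      also have "real J0 * real M \<le> ((C4 + 1) * (4 / sqrt e * ln (1 / d)) / e\<^sup>2) * (5 * C1 / (sqrt e * d))"
      proof (rule mult_mono[OF _ M(2)])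
        have "(C4 + 1) * l / e\<^sup>2 \<le> (C4 + 1) * (4 / sqrt e * ln (1 / d)) / e\<^sup>2"
          using l_le2 C4 by (intro divide_right_mono mult_left_mono) auto
        then show "real J0 \<le> (C4 + 1) * (4 / sqrt e * ln (1 / d)) / e\<^sup>2" using J0(2) by linarith
        show "0 \<le> (C4 + 1) * (4 / sqrt e * ln (1 / d)) / e\<^sup>2" using C4 D1 se by simp
      qed simp
      also have "\<dots> = 20 * (C4 + 1) * C1 / ((sqrt e * sqrt e) * e\<^sup>2) * (1 / d * ln (1 / d))"
      proof -
        have "(u * (4 / x * Y) / z) * (5 * v / (x * r)) = 20 * u * v / ((x * x) * z) * (1 / r * Y)"
          for u v x z r Y :: real by (simp add: mult_ac)
        then show ?thesis .
      qed
      also have "(sqrt e * sqrt e) * e\<^sup>2 = e ^ 3"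
        unfolding se(3) by (simp only: power3_eq_cube power2_eq_square mult.assoc)
      finally have "2 * W \<le> 6 * (20 * (C4 + 1) * C1 / e ^ 3 * (1 / d * ln (1 / d)))" by simp
      moreover have "6 * (20 * u * v / z * X) = 120 * u * v / z * X" for u v z X :: real by simp
      ultimately show "2 * W \<le> C / e ^ 3 * (1 / d * ln (1 / d))" unfolding C_def by (simp only:)
    qed
    finally show "expected_time \<mu> (blanket_time f \<mu> (1 - e) d) \<le> ennreal (C / e ^ 3 * (1 / d * ln (1 / d)))" .
  qed
qed

end

section \<open>The expected cover time\<close>

lemma ln_pred_le: assumes "2 \<le> (r::real)" shows "ln r - ln (r - 1) \<le> 2 / r"
proof -
  have "ln r - ln (r - 1) = ln (r / (r - 1))" using assms by (simp add: ln_div)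
  also have "\<dots> \<le> r / (r - 1) - 1" using assms by (intro ln_le_minus_one) simp
  also have "\<dots> \<le> 2 / r" using assms by (simp add: field_simps)
  finally show ?thesis .
qed

context gibbs_coding
begin

text \<open>
  The union of the \<open>q\<close>-cylinders that meet a ball.
\<close>

definition halo :: "nat \<Rightarrow> real \<Rightarrow> real \<Rightarrow> real set" where
  "halo q z r = {x \<in> {a..b}. \<exists>x'\<in>{a..b}. same q x x' \<and> \<bar>x' - z\<bar> < r}"

lemma halo_cylset: "cylset q (halo q z r)"
  unfolding halo_def
proof (rule cylset_Collect, rule cylfunI)
  fix x y assume "x \<in> {a..b}" "y \<in> {a..b}" and xy: "same q x y"
  show "(\<exists>x'\<in>{a..b}. same q x x' \<and> \<bar>x' - z\<bar> < r) = (\<exists>x'\<in>{a..b}. same q y x' \<and> \<bar>x' - z\<bar> < r)"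
    using same_trans[OF xy] same_trans[OF same_sym[OF xy]] by blast
qed

lemma halo_near: assumes "x \<in> halo q z d" "(b - a) / c ^ q \<le> d / 2" shows "\<bar>x - z\<bar> < 3 / 2 * d"
proof -
  obtain x' where x': "x \<in> {a..b}" "x' \<in> {a..b}" "same q x x'" "\<bar>x' - z\<bar> < d" using assms(1) by (auto simp: halo_def)
  have "\<bar>x - x'\<bar> \<le> d / 2" using same_dist[OF x'(1-3)] assms(2) by linarith
  then show ?thesis using x'(4) by linarith
qed

lemma halo_measure: assumes "(b - a) / c ^ q \<le> d / 2" "0 < d" shows "measure \<mu> (halo q z d) \<le> 3 * dens * d"
proof -
  have "halo q z d \<subseteq> {z - 3 / 2 * d .. z + 3 / 2 * d} \<inter> {a..b}"
  proof
    fix x assume x: "x \<in> halo q z d"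
    have "\<bar>x - z\<bar> < 3 / 2 * d" by (rule halo_near[OF x assms(1)])
    then have "z - 3 / 2 * d \<le> x" "x \<le> z + 3 / 2 * d" by linarith+
    then show "x \<in> {z - 3 / 2 * d .. z + 3 / 2 * d} \<inter> {a..b}" using x by (simp add: halo_def)
  qed
  then have "measure \<mu> (halo q z d) \<le> measure \<mu> ({z - 3 / 2 * d .. z + 3 / 2 * d} \<inter> {a..b})"
    by (intro finite_measure_mono borel_sets_\<mu>) auto
  also have "\<dots> \<le> dens * ((z + 3 / 2 * d) - (z - 3 / 2 * d))" using assms(2) by (intro dens_upper) simp
  finally show ?thesis by simp
qed

definition visit_const :: real where "visit_const = (1 + K) * Cg\<^sup>2 * (3 * dens)"

lemma visit_const: "1 \<le> visit_const"
proof -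
  have "1 * 1 * 1 \<le> visit_const" unfolding visit_const_def using K Cg dens by (intro mult_mono) auto
  then show ?thesis by simp
qed

text \<open>
  Independence up to a constant is enough here: only an upper bound for the probability of a
  visit is needed, and \<open>F\<close> may depend on everything before the time \<open>t\<close>.
\<close>

lemma late_hit:
  assumes A: "cylset q A" and F: "cylfun t F" "\<And>x. x \<in> {a..b} \<Longrightarrow> 0 \<le> F x" and N: "t + q \<le> N"
    and m: "measure \<mu> A \<le> 3 * dens * d"
  shows "E N (\<lambda>x. F x * hit A t x) \<le> visit_const * d * E N F"
proof -
  have EF: "0 \<le> E N F" by (rule E_nonneg) (use F(2) in auto)
  have "E N (\<lambda>x. F x * hit A t x) \<le> (1 + K) * (E N F * E N (hit A t))"
    using mixing(1)[OF F, of "indicator A" 0 N] N by (simp add: hit_def[abs_def] \<eta>_0)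
  also have "\<dots> \<le> (1 + K) * (E N F * (Cg\<^sup>2 * (3 * dens * d)))"
  proof (intro mult_left_mono EF)
    have "E N (hit A t) \<le> Cg\<^sup>2 * measure \<mu> A" by (rule E_hit_le[OF A N])
    also have "\<dots> \<le> Cg\<^sup>2 * (3 * dens * d)" using m by (rule mult_left_mono) simp
    finally show "E N (hit A t) \<le> Cg\<^sup>2 * (3 * dens * d)" .
  qed (use K in simp)
  finally show ?thesis by (simp add: visit_const_def mult_ac)
qed

definition unvisited :: "(nat \<Rightarrow> real set) \<Rightarrow> nat \<Rightarrow> nat \<Rightarrow> real \<Rightarrow> nat set" where
  "unvisited A n t x = {i. i < n \<and> (\<forall>s<t. (f ^^ s) x \<notin> A i)}"

lemma unvisited_finite: "finite (unvisited A n t x)" by (simp add: unvisited_def)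

lemma unvisited_step:
  assumes "disjoint_family_on A {..<n}"
  shows "card (unvisited A n t x) \<le> Suc (card (unvisited A n (Suc t) x))"
proof -
  let ?B = "{i. i < n \<and> (f ^^ t) x \<in> A i}"
  have B: "card ?B \<le> Suc 0"
  proof (rule card_le_Suc0_iff_eq[THEN iffD2])
    show "\<forall>i\<in>?B. \<forall>j\<in>?B. i = j" using assms unfolding disjoint_family_on_def by blast
  qed simp
  have "unvisited A n t x \<subseteq> unvisited A n (Suc t) x \<union> ?B" by (auto simp: unvisited_def less_Suc_eq)
  then have "card (unvisited A n t x) \<le> card (unvisited A n (Suc t) x \<union> ?B)"
    by (intro card_mono) (auto simp: unvisited_finite)
  also have "\<dots> \<le> card (unvisited A n (Suc t) x) + card ?B" by (rule card_Un_le)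
  finally show ?thesis using B by simp
qed

lemma unvisited_steps:
  assumes "disjoint_family_on A {..<n}"
  shows "card (unvisited A n t x) \<le> card (unvisited A n (t + k) x) + k"
proof (induction k)
  case (Suc k)
  then show ?case using unvisited_step[OF assms, of "t + k" x] by simp
qed simp

lemma unvisited_antimono: "t \<le> t' \<Longrightarrow> unvisited A n t' x \<subseteq> unvisited A n t x"
  by (auto simp: unvisited_def)

lemma unvisited_cyl:
  assumes "\<And>i. cylset q (A i)"
  shows "cylfun t (unvisited A n (t - q))"
proof (rule cylfunI)
  fix x y assume xy: "x \<in> {a..b}" "y \<in> {a..b}" "same t x y"
  have "((f ^^ s) x \<in> A i) = ((f ^^ s) y \<in> A i)" if "s < t - q" for s i
    using cylfunD[OF cylfun_shift'[of q "\<lambda>x. x \<in> A i" s t] xy] assms[of i] that by (simp add: cylset_def)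
  then show "unvisited A n (t - q) x = unvisited A n (t - q) y" by (auto simp: unvisited_def)
qed

text \<open>
  A visit to a new cell changes the logarithm of the number \<open>R\<close> of unvisited cells by at most
  \<open>2 / R\<close>, and the chance of a new visit is at most of order \<open>R * d\<close>. The cells have depth \<open>q\<close>,
  so that the set of cells unvisited up to time \<open>t - q\<close>, but not the one up to time \<open>t\<close>, is a
  function of the first \<open>t\<close> symbols; the two differ by at most \<open>q \<le> s\<close> cells, which costs a
  factor 2 above the threshold \<open>s\<close>.
\<close>

lemma log_drift:
  assumes A: "\<And>i. cylset q (A i)" "disjoint_family_on A {..<n}" "\<And>i. measure \<mu> (A i) \<le> 3 * dens * d"
    and s: "2 \<le> s" "real q \<le> s" and N: "t + q \<le> N"
  shows "E N (\<lambda>x. ln (max (real (card (unvisited A n t x))) s)) - 4 * visit_const * d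
      \<le> E N (\<lambda>x. ln (max (real (card (unvisited A n (Suc t) x))) s))"
proof -
  let ?R = "\<lambda>t x. real (card (unvisited A n t x))"
  \<comment> \<open>Natural subtraction: for \<open>t < q\<close> no cell counts as visited, and \<open>F i\<close> is constant.\<close>
  define F where "F i x = (if i \<in> unvisited A n (t - q) x then 1 / ?R (t - q) x else 0)" for i x
  have F0: "0 \<le> F i x" for i x by (simp add: F_def)
  have Fcyl: "cylfun t (F i)" for i
    unfolding F_def by (rule cylfun_comp[OF unvisited_cyl[OF A(1)], where G="\<lambda>S. if i \<in> S then 1 / real (card S) else 0"])
  have sumF: "(\<Sum>i<n. F i x) \<le> 1" for x
  proof -
    have "(\<Sum>i<n. F i x) = (\<Sum>i\<in>unvisited A n (t - q) x. 1 / ?R (t - q) x)"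
      unfolding F_def by (rule sum.mono_neutral_cong_right) (auto simp: unvisited_def)
    then show ?thesis by simp
  qed
  have step: "ln (max (?R t x) s) - 4 * (\<Sum>i<n. F i x * hit (A i) t x) \<le> ln (max (?R (Suc t) x) s)" for x
  proof -
    have nn: "0 \<le> (\<Sum>i<n. F i x * hit (A i) t x)" by (intro sum_nonneg mult_nonneg_nonneg F0 hit_nonneg)
    show ?thesis
    proof (cases "s \<le> ?R t x \<and> unvisited A n (Suc t) x \<noteq> unvisited A n t x")
      case False
      then have "ln (max (?R t x) s) \<le> ln (max (?R (Suc t) x) s)" using s by auto
      then show ?thesis using nn by linarith
    next
      case True
      then obtain i where i: "i \<in> unvisited A n t x" "(f ^^ t) x \<in> A i"
        by (auto simp: unvisited_def less_Suc_eq)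
      have iq: "i \<in> unvisited A n (t - q) x" using unvisited_antimono[of "t - q" t A n x] i(1) by auto
      have R1: "?R t x - 1 \<le> ?R (Suc t) x" using unvisited_step[OF A(2), of t x] by linarith
      have "ln (?R t x) - 2 / ?R t x \<le> ln (?R t x - 1)" using ln_pred_le[of "?R t x"] True s by simp
      also have "\<dots> \<le> ln (max (?R (Suc t) x) s)" using R1 True s by (subst ln_le_cancel_iff) auto
      finally have 1: "ln (max (?R t x) s) - 2 / ?R t x \<le> ln (max (?R (Suc t) x) s)" using True by (simp add: max_absorb1)
      have R2: "?R (t - q) x \<le> 2 * ?R t x"
      proof -
        have "card (unvisited A n (t - q) x) \<le> card (unvisited A n t x) + q"
        proof (cases "q \<le> t")
          case True then show ?thesis using unvisited_steps[OF A(2), of "t - q" x q] by simp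
        next
          case False then show ?thesis using unvisited_steps[OF A(2), of 0 x t] by simp
        qed
        then show ?thesis using True s by linarith
      qed
      have pos: "0 < ?R (t - q) x" using iq unvisited_finite[of A n "t - q" x] by (auto simp: card_gt_0_iff)
      have "2 / ?R t x \<le> 4 * (1 / ?R (t - q) x)" using R2 pos True s by (simp add: field_simps)
      also have "1 / ?R (t - q) x = F i x * hit (A i) t x" using iq i by (simp add: F_def hit_def)
      also have "\<dots> \<le> (\<Sum>i<n. F i x * hit (A i) t x)"
        by (rule member_le_sum) (use i F0 hit_nonneg in \<open>auto simp: unvisited_def intro!: mult_nonneg_nonneg\<close>)
      finally show ?thesis using 1 by simp
    qed
  qed
  have "E N (\<lambda>x. \<Sum>i<n. F i x * hit (A i) t x) = (\<Sum>i<n. E N (\<lambda>x. F i x * hit (A i) t x))" by (rule E_sum)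
  also have "\<dots> \<le> (\<Sum>i<n. visit_const * d * E N (F i))"
    by (intro sum_mono late_hit[OF A(1) Fcyl F0 N A(3)])
  also have "\<dots> = visit_const * d * E N (\<lambda>x. \<Sum>i<n. F i x)" by (simp only: E_sum sum_distrib_left)
  also have "\<dots> \<le> visit_const * d * 1"
  proof (rule mult_left_mono)
    show "E N (\<lambda>x. \<Sum>i<n. F i x) \<le> 1" using E_mono[of "\<lambda>x. \<Sum>i<n. F i x" "\<lambda>_. 1" N] sumF by simp
    have "0 \<le> 3 * dens * d" using A(3)[of 0] measure_nonneg order_trans by blast
    then show "0 \<le> visit_const * d" using visit_const dens by (simp add: zero_le_mult_iff)
  qed
  finally have EF: "E N (\<lambda>x. \<Sum>i<n. F i x * hit (A i) t x) \<le> visit_const * d" by simp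
  have "E N (\<lambda>x. ln (max (?R t x) s)) - 4 * E N (\<lambda>x. \<Sum>i<n. F i x * hit (A i) t x)
     = E N (\<lambda>x. ln (max (?R t x) s) - 4 * (\<Sum>i<n. F i x * hit (A i) t x))"
    by (simp only: E_diff E_scale)
  also have "\<dots> \<le> E N (\<lambda>x. ln (max (?R (Suc t) x) s))" using step by (intro E_mono)
  finally show ?thesis using EF by linarith
qed

text \<open>
  The truncated logarithm takes values between half of \<open>ln n\<close> and \<open>ln n\<close>. If its mean is still
  at least three quarters of \<open>ln n\<close>, it exceeds its minimum with probability at least a half.
\<close>

lemma uncovered_probable:
  assumes A: "\<And>i. cylset q (A i)" "disjoint_family_on A {..<n}" "\<And>i. measure \<mu> (A i) \<le> 3 * dens * d"
    and n: "2 \<le> sqrt n" "real q \<le> sqrt n" and T: "16 * visit_const * d * real T \<le> ln (real n)"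
  defines "S \<equiv> {x \<in> {a..b}. unvisited A n T x \<noteq> {}}"
  shows "S \<in> sets \<mu>" "1 \<le> 2 * Cg\<^sup>2 * measure \<mu> S"
proof -
  define N where "N = T + q"
  define s where "s = sqrt n"
  let ?R = "\<lambda>t x. real (card (unvisited A n t x))"
  have s: "2 \<le> s" "real q \<le> s" using n by (simp_all add: s_def)
  have n0: "0 < real n" using n(1) by (cases "n = 0") auto
  have sn: "s \<le> real n"
  proof -
    have "s * 1 \<le> s * s" using s by (intro mult_left_mono) auto
    then show ?thesis by (simp add: s_def)
  qed
  have lns: "ln s = ln (real n) / 2" using n0 by (simp add: s_def ln_sqrt)
  have "0 < ln s" using s by simp
  then have ln0: "0 < ln (real n)" using lns by simp
  have Scyl: "cylset N S"
    unfolding S_def using unvisited_cyl[OF A(1), where n=n and t=N]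
    by (intro cylset_Collect cylfun_comp[where G="\<lambda>U. U \<noteq> {}"]) (simp add: N_def)
  have drift: "ln (real n) - 4 * visit_const * d * real t \<le> E N (\<lambda>x. ln (max (?R t x) s))" if "t \<le> T" for t
    using that
  proof (induction t)
    case 0
    have "?R 0 x = real n" for x by (simp add: unvisited_def)
    then show ?case using sn by (simp add: max_absorb1)
  next
    case (Suc t)
    then show ?case using log_drift[OF A s, of t N] by (simp add: N_def algebra_simps)
  qed
  have "3 / 4 * ln (real n) \<le> ln (real n) - 4 * visit_const * d * real T" using T by linarith
  also have "\<dots> \<le> E N (\<lambda>x. ln (max (?R T x) s))" by (rule drift) simp
  also have "\<dots> \<le> E N (\<lambda>x. ln s + ln s * indicator S x)"
  proof (rule E_mono)
    fix x assume x: "x \<in> {a<..<b}"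
    show "ln (max (?R T x) s) \<le> ln s + ln s * indicator S x"
    proof (cases "unvisited A n T x = {}")
      case True
      then show ?thesis using s by (simp add: max_absorb2 indicator_def)
    next
      case False
      have "card (unvisited A n T x) \<le> card {..<n}" by (intro card_mono) (auto simp: unvisited_def)
      then have "max (?R T x) s \<le> real n" using sn by simp
      then have "ln (max (?R T x) s) \<le> ln (real n)" using s n0 by (subst ln_le_cancel_iff) auto
      also have "\<dots> = ln s + ln s" using lns by simp
      finally show ?thesis using False x by (simp add: S_def)
    qed
  qed
  also have "\<dots> = ln s + ln s * E N (indicator S)" by (simp only: E_plus E_scale E_const)
  finally have "ln s * 1 \<le> 2 * (ln s * E N (indicator S))" using lns by linarith
  then have "ln s * 1 \<le> ln s * (2 * E N (indicator S))" by (simp only: mult.left_commute)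
  then have 1: "1 \<le> 2 * E N (indicator S)" using \<open>0 < ln s\<close> by (simp only: mult_le_cancel_left_pos)
  show "S \<in> sets \<mu>" by (rule cylset_sets[OF Scyl])
  show "1 \<le> 2 * Cg\<^sup>2 * measure \<mu> S" using 1 E_vs_measure(2)[OF Scyl] by linarith
qed

text \<open>
  Cells are cylinder neighbourhoods of balls around points at distance \<open>4 * d\<close>, so that an orbit
  that is \<open>d\<close>-dense meets all of them.
\<close>

lemma cover_expectation:
  "\<exists>C\<ge>1. \<exists>d0>0. \<forall>d. 0 < d \<longrightarrow> d < d0 \<longrightarrow>
     ennreal (1 / C * (1 / d * ln (1 / d))) \<le> expected_time \<mu> (cover_time f {a..b} d)"
proof -
  define C where "C = 128 * visit_const * Cg\<^sup>2"
  have "128 * 1 * 1 \<le> C" unfolding C_def using visit_const Cg by (intro mult_mono) auto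
  then have C: "1 \<le> C" by simp
  define w where "w = b - a"
  have w: "0 < w" using ab by (simp add: w_def)
  define r where "r = \<bar>ln (2 * w)\<bar>"
  define lc where "lc = ln c"
  have lc: "0 < lc" using c_gt_1 by (simp add: lc_def)
  have Cc0: "0 < visit_const" using visit_const by simp
  \<comment> \<open>These conditions say that there are at least \<open>d powr (- 1 / 2)\<close> cells, that the
      cylinder depth is below the threshold \<open>sqrt n\<close> of \<open>uncovered_probable\<close>, and that
      rounding the time down to an integer is harmless.\<close>
  have ev: "\<forall>\<^sub>F d in at_right 0. (1 / d) powr (1 / 2) \<le> w / (4 * d) - 1"
    using w by real_asymp
  moreover have "\<forall>\<^sub>F d in at_right 0. (ln (1 / d) + r) / lc + 1 \<le> (1 / d) powr (1 / 4)"
    using lc by real_asymp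
  moreover have "\<forall>\<^sub>F d::real in at_right 0. 2 \<le> (1 / d) powr (1 / 4)" by real_asymp
  moreover have "\<forall>\<^sub>F d in at_right 0. 1 \<le> ln (1 / d) / (64 * visit_const * d)" using Cc0 by real_asymp
  moreover have "\<forall>\<^sub>F d::real in at_right 0. d < 1" by real_asymp
  ultimately have "\<forall>\<^sub>F d in at_right 0. (1 / d) powr (1 / 2) \<le> w / (4 * d) - 1 \<and>
    (ln (1 / d) + r) / lc + 1 \<le> (1 / d) powr (1 / 4) \<and> 2 \<le> (1 / d) powr (1 / 4) \<and>
    1 \<le> ln (1 / d) / (64 * visit_const * d) \<and> d < 1" by eventually_elim blast
  then obtain d0 where d0: "0 < d0" "\<And>d. 0 < d \<Longrightarrow> d < d0 \<Longrightarrow> (1 / d) powr (1 / 2) \<le> w / (4 * d) - 1 \<and>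
    (ln (1 / d) + r) / lc + 1 \<le> (1 / d) powr (1 / 4) \<and> 2 \<le> (1 / d) powr (1 / 4) \<and>
    1 \<le> ln (1 / d) / (64 * visit_const * d) \<and> d < 1"
    unfolding eventually_at_right_field by blast
  show ?thesis
  proof (rule exI[of _ C], rule conjI[OF C], rule exI[of _ d0], rule conjI[OF d0(1)], intro allI impI)
    fix d assume d: "0 < d" "d < d0"
    note asy = d0(2)[OF d]
    have ld: "0 < ln (1 / d)" using asy d by simp
    define n where "n = nat \<lfloor>w / (4 * d)\<rfloor>"
    have n1: "w / (4 * d) - 1 \<le> real n" "real n \<le> w / (4 * d)"
      using w d unfolding n_def by (auto simp: of_nat_nat)
    have nd: "(1 / d) powr (1 / 2) \<le> real n" using n1 asy by linarith
    have "0 < (1 / d) powr (1 / 2)" using d by simp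
    then have n0: "0 < real n" using nd by linarith
    have sn: "(1 / d) powr (1 / 4) \<le> sqrt (real n)"
    proof -
      have "(1 / d) powr (1 / 4) = ((1 / d) powr (1 / 2)) powr (1 / 2)" by (simp add: powr_powr)
      also have "\<dots> \<le> real n powr (1 / 2)" using nd by (intro powr_mono2) auto
      finally show ?thesis by (simp add: powr_half_sqrt)
    qed
    have lnn: "ln (1 / d) / 2 \<le> ln (real n)"
    proof -
      have "ln ((1 / d) powr (1 / 2)) \<le> ln (real n)" using nd d n0 by (subst ln_le_cancel_iff) auto
      then show ?thesis using d by (simp add: ln_powr)
    qed
    obtain q where q: "(1 / c) ^ q \<le> d / (2 * w)" "real q \<le> \<bar>ln (d / (2 * w))\<bar> / ln (1 / (1 / c)) + 1"
      using power_below[of "1 / c" "d / (2 * w)"] c_gt_1 d w by auto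
    have q1: "(b - a) / c ^ q \<le> d / 2"
    proof -
      have "w * (1 / c) ^ q \<le> w * (d / (2 * w))" using q(1) w by (intro mult_left_mono) auto
      also have "w * (d / (2 * w)) = d / 2" using w by simp
      finally show ?thesis by (simp add: power_divide w_def)
    qed
    have q2: "real q \<le> sqrt (real n)"
    proof -
      have "ln (d / (2 * w)) = - ln (1 / d) - ln (2 * w)" using d w by (simp add: ln_div)
      then have "\<bar>ln (d / (2 * w))\<bar> \<le> ln (1 / d) + r" using ld unfolding r_def by linarith
      then have "\<bar>ln (d / (2 * w))\<bar> / lc \<le> (ln (1 / d) + r) / lc" using lc by (intro divide_right_mono) auto
      then show ?thesis using q(2) asy sn unfolding lc_def by simp
    qed
    have q3: "2 \<le> sqrt (real n)" using asy sn by linarith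
    define z where "z i = a + 4 * d * real i" for i :: nat
    define A where "A i = halo q (z i) d" for i
    have zI: "z i \<in> {a..b}" if "i < n" for i
    proof -
      have "real i \<le> w / (4 * d)" using that n1(2) by linarith
      then have "4 * d * real i \<le> w" using d by (simp add: field_simps)
      then show ?thesis using d by (simp add: z_def w_def)
    qed
    have Acyl: "cylset q (A i)" for i unfolding A_def by (rule halo_cylset)
    have Am: "measure \<mu> (A i) \<le> 3 * dens * d" for i unfolding A_def by (rule halo_measure[OF q1 d(1)])
    have Ad: "disjoint_family_on A {..<n}"
      unfolding disjoint_family_on_def
    proof (intro ballI impI)
      fix i j :: nat assume ij: "i \<noteq> j"
      show "A i \<inter> A j = {}"
      proof (rule ccontr)
        assume "A i \<inter> A j \<noteq> {}"
        then obtain x where "x \<in> A i" "x \<in> A j" by blast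
        then have "\<bar>x - z i\<bar> < 3 / 2 * d" "\<bar>x - z j\<bar> < 3 / 2 * d" using halo_near[OF _ q1] by (auto simp: A_def)
        then have "\<bar>z i - z j\<bar> < 3 * d" by linarith
        moreover have "\<bar>z i - z j\<bar> = 4 * d * \<bar>real i - real j\<bar>" using d by (simp add: z_def abs_mult flip: right_diff_distrib)
        moreover have "1 \<le> \<bar>real i - real j\<bar>" using ij by linarith
        then have "4 * d * 1 \<le> 4 * d * \<bar>real i - real j\<bar>" using d by (intro mult_left_mono) auto
        ultimately show False using d by linarith
      qed
    qed
    define X where "X = ln (real n) / (16 * visit_const * d)"
    define T where "T = nat \<lfloor>X\<rfloor>"
    have "0 \<le> ln (real n)" using lnn ld by linarith
    then have X0: "0 \<le> X" unfolding X_def using Cc0 d by (intro divide_nonneg_nonneg) simp_all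
    have T1: "real T \<le> X" "X - 1 \<le> real T" using X0 unfolding T_def by (auto simp: of_nat_nat)
    have T2: "16 * visit_const * d * real T \<le> ln (real n)" using T1(1) Cc0 d by (simp add: X_def field_simps)
    have T3: "ln (1 / d) / (64 * visit_const * d) \<le> real T"
    proof -
      have "ln (1 / d) / 2 / (16 * visit_const * d) \<le> X" unfolding X_def using lnn Cc0 d by (intro divide_right_mono) auto
      moreover have "ln (1 / d) / 2 / (16 * visit_const * d) = 2 * (ln (1 / d) / (64 * visit_const * d))" by simp
      ultimately show ?thesis using T1(2) asy by linarith
    qed
    define S where "S = {x \<in> {a..b}. unvisited A n T x \<noteq> {}}"
    have S: "S \<in> sets \<mu>" "1 \<le> 2 * Cg\<^sup>2 * measure \<mu> S"
      unfolding S_def using uncovered_probable[OF Acyl Ad Am q3 q2 T2] by blast+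
    have late: "enat T \<le> cover_time f {a..b} d x" if "x \<in> S" for x
      unfolding cover_time_def
    proof (rule INF_greatest)
      fix m assume "m \<in> {m. 1 \<le> m \<and> delta_dense_in d ((\<lambda>i. (f ^^ i) x) ` {..<m}) {a..b}}"
      then have dense: "delta_dense_in d ((\<lambda>i. (f ^^ i) x) ` {..<m}) {a..b}" by simp
      obtain i where i: "i < n" "\<forall>s<T. (f ^^ s) x \<notin> A i" using \<open>x \<in> S\<close> by (auto simp: S_def unvisited_def)
      obtain s where s: "s < m" "(f ^^ s) x \<in> ball (z i) d"
        using dense zI[OF i(1)] unfolding delta_dense_in_def by blast
      have fI: "(f ^^ s) x \<in> {a..b}" using orbit_in \<open>x \<in> S\<close> by (simp add: S_def)
      have "\<bar>(f ^^ s) x - z i\<bar> < d" using s(2) by (simp add: dist_real_def abs_minus_commute)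
      then have "(f ^^ s) x \<in> A i" using fI same_refl unfolding A_def halo_def by blast
      then have "\<not> s < T" using i(2) by blast
      then show "enat T \<le> enat m" using s(1) by simp
    qed
    have "1 / C * (1 / d * ln (1 / d)) = (ln (1 / d) / (64 * visit_const * d)) * (1 / (2 * Cg\<^sup>2))" by (simp add: C_def)
    also have "\<dots> \<le> real T * measure \<mu> S"
    proof (rule mult_mono[OF T3])
      have "0 < Cg\<^sup>2" using Cg by simp
      then show "1 / (2 * Cg\<^sup>2) \<le> measure \<mu> S" using S(2) by (simp add: divide_le_eq mult.commute)
    qed simp_all
    finally have "ennreal (1 / C * (1 / d * ln (1 / d))) \<le> ennreal (real T * measure \<mu> S)" by (rule ennreal_leI)
    also have "\<dots> = (\<integral>\<^sup>+x. ennreal (real T) * indicator S x \<partial>\<mu>)"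
      using S(1) by (simp add: nn_integral_cmult_indicator emeasure_eq_measure ennreal_mult)
    also have "\<dots> \<le> expected_time \<mu> (cover_time f {a..b} d)"
      unfolding expected_time_def
    proof (rule nn_integral_mono)
      fix x
      show "ennreal (real T) * indicator S x \<le> ennreal_of_enat (cover_time f {a..b} d x)"
      proof (cases "x \<in> S")
        case True
        have "ennreal_of_enat (enat T) \<le> ennreal_of_enat (cover_time f {a..b} d x)"
          using late[OF True] by (subst ennreal_of_enat_le_iff)
        then show ?thesis using True by (simp add: ennreal_of_nat_eq_real_of_nat)
      qed simp
    qed
    finally show "ennreal (1 / C * (1 / d * ln (1 / d))) \<le> expected_time \<mu> (cover_time f {a..b} d)" .
  qed
qed

end

section \<open>An absolutely continuous Gibbs measure is comparable with length\<close>

lemma emeasure_lborel_diam: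
  fixes S :: "real set"
  assumes S: "S \<in> sets borel" and l: "0 \<le> l" "\<And>x y. x \<in> S \<Longrightarrow> y \<in> S \<Longrightarrow> \<bar>x - y\<bar> \<le> l"
  shows "emeasure lborel S \<le> ennreal l"
proof (cases "S = {}")
  case False
  then obtain x0 where x0: "x0 \<in> S" by blast
  have "x0 - l \<le> x" if "x \<in> S" for x using l(2)[OF x0 that] by linarith
  then have bd: "bdd_below S" by (rule bdd_belowI)
  have "S \<subseteq> {Inf S .. Inf S + l}"
  proof
    fix x assume x: "x \<in> S"
    have "x - l \<le> y" if "y \<in> S" for y using l(2)[OF x that] by linarith
    then have "x - l \<le> Inf S" by (rule cInf_greatest[OF False])
    then show "x \<in> {Inf S .. Inf S + l}" using cInf_lower[OF x bd] by simp
  qed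
  then have "emeasure lborel S \<le> emeasure lborel {Inf S .. Inf S + l}" by (intro emeasure_mono) auto
  then show ?thesis using l by simp
qed simp

text \<open>
  Bounded distortion is stated with difference quotients, the form in which it enters estimates
  of lengths, and in product form so that no quotient can degenerate.
\<close>

locale acip_coding = gibbs_measure +
  fixes dist_const :: real
  assumes cell_interval: "\<And>n x. x \<in> {a..b} \<Longrightarrow> is_interval (cell n x)"
    and cell_continuous: "\<And>n x. x \<in> {a..b} \<Longrightarrow> continuous_on (cell n x) (f ^^ n)"
    and dist_const: "1 \<le> dist_const"
    and distortion: "\<And>n x u v u' v'. x \<in> {a..b} \<Longrightarrow> u \<in> cell n x \<Longrightarrow> v \<in> cell n x \<Longrightarrow>
        u' \<in> cell n x \<Longrightarrow> v' \<in> cell n x \<Longrightarrow>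
        \<bar>(f ^^ n) u - (f ^^ n) v\<bar> * \<bar>u' - v'\<bar> \<le> dist_const * \<bar>(f ^^ n) u' - (f ^^ n) v'\<bar> * \<bar>u - v\<bar>"
    and acip: "absolutely_continuous (restrict_space lborel {a..b}) \<mu>"
begin

definition lam :: "real measure" where "lam = restrict_space lborel {a..b}"

lemma space_lam: "space lam = {a..b}" by (simp add: lam_def space_restrict_space)

lemma sets_lam: "sets lam = sets \<mu>"
  unfolding lam_def sets_\<mu> by (intro sets_restrict_space_cong) simp

lemma lam_eq: "S \<subseteq> {a..b} \<Longrightarrow> emeasure lam S = emeasure lborel S"
  unfolding lam_def by (intro emeasure_restrict_space) auto

lemma lam_measure: "S \<subseteq> {a..b} \<Longrightarrow> measure lam S = measure lborel S"
  by (simp add: measure_def lam_eq)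

lemma finite_lam: "finite_measure lam"
  by (rule finite_measureI) (simp add: space_lam lam_eq ab less_imp_le)

sublocale lam: finite_measure lam by (rule finite_lam)

lemma sets_sub: "S \<in> sets \<mu> \<Longrightarrow> S \<subseteq> {a..b}"
  using sets.sets_into_space[of S \<mu>] space_\<mu> by simp

lemma lam_diam:
  assumes C: "C \<in> sets \<mu>" and l: "0 \<le> l" "\<And>x y. x \<in> C \<Longrightarrow> y \<in> C \<Longrightarrow> \<bar>x - y\<bar> \<le> l"
  shows "measure lam C \<le> l"
proof -
  have "C \<in> sets borel" using C unfolding sets_\<mu> by (auto simp: sets_restrict_space_iff)
  then have "emeasure lam C \<le> ennreal l"
    unfolding lam_eq[OF sets_sub[OF C]] using l by (rule emeasure_lborel_diam)
  then show ?thesis using l(1) by (simp add: lam.emeasure_eq_measure)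
qed

lemma lam_segment:
  assumes "C \<in> sets \<mu>" "closed_segment u v \<subseteq> C" shows "\<bar>u - v\<bar> \<le> measure lam C"
proof -
  have sub: "closed_segment u v \<subseteq> {a..b}" using assms sets_sub by blast
  have "measure lam (closed_segment u v) = \<bar>u - v\<bar>"
    by (subst lam_measure[OF sub]) (simp add: closed_segment_eq_real_ivl)
  moreover have "measure lam (closed_segment u v) \<le> measure lam C"
    by (rule lam.finite_measure_mono[OF assms(2)]) (simp add: sets_lam assms)
  ultimately show ?thesis by simp
qed

lemma cell_sub: "cell n x \<subseteq> {a..b}" by (auto simp: cell_def)

lemma cell_same: "u \<in> cell n x \<Longrightarrow> v \<in> cell n x \<Longrightarrow> same n u v"
  using same_trans same_sym unfolding cell_def by blast

lemma cell_segment: assumes "x \<in> {a..b}" "u \<in> cell n x" "v \<in> cell n x" shows "closed_segment u v \<subseteq> cell n x"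
  using cell_interval[OF assms(1)] assms(2,3) closed_segment_subset is_interval_convex by blast

lemma cell_inj: "inj_on (f ^^ n) (cell n x)"
proof (rule inj_onI)
  fix u v assume uv: "u \<in> cell n x" "v \<in> cell n x" "(f ^^ n) u = (f ^^ n) v"
  have "u \<in> {a..b}" "v \<in> {a..b}" using uv cell_sub by blast+
  then have "c ^ n * \<bar>u - v\<bar> \<le> 0" using same_contract[OF _ _ cell_same[OF uv(1,2)]] uv(3) by simp
  moreover have "0 < c ^ n" using c_gt_1 by simp
  ultimately show "u = v" by (simp add: mult_le_0_iff)
qed

lemma cell_between:
  assumes x: "x \<in> {a..b}" and u: "u \<in> cell n x" "v \<in> cell n x" and w: "w \<in> closed_segment u v"
  shows "(f ^^ n) w \<in> closed_segment ((f ^^ n) u) ((f ^^ n) v)"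
proof -
  have *: "(f ^^ n) w \<in> closed_segment ((f ^^ n) u) ((f ^^ n) v)"
    if u: "u \<in> cell n x" "v \<in> cell n x" and w: "u < w" "w < v" for u v
  proof -
    have sub: "{u..v} \<subseteq> cell n x" using cell_segment[OF x u] w by (simp add: closed_segment_eq_real_ivl)
    show ?thesis
      using continuous_inj_imp_mono[OF w continuous_on_subset[OF cell_continuous[OF x] sub] inj_on_subset[OF cell_inj sub]]
      by (auto simp: closed_segment_eq_real_ivl)
  qed
  consider "w = u" | "w = v" | "u < w" "w < v" | "v < w" "w < u"
    using w by (force simp: closed_segment_eq_real_ivl split: if_splits)
  then show ?thesis
  proof cases
    case 4 then show ?thesis using *[OF u(2,1)] by (simp add: closed_segment_commute)
  qed (use * u in auto)
qed

definition pullback :: "nat \<Rightarrow> real set \<Rightarrow> real set" where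
  "pullback n B = {x \<in> {a..b}. (f ^^ n) x \<in> B}"

lemma pullback_sets: "B \<in> sets \<mu> \<Longrightarrow> pullback n B \<in> sets \<mu>"
  using measurable_sets[OF fn_meas, of B n] by (simp add: pullback_def space_\<mu> vimage_def Int_def conj_commute)

lemma pullback_measure: "B \<in> sets \<mu> \<Longrightarrow> measure \<mu> (pullback n B) = measure \<mu> B"
  unfolding pullback_def by (rule measure_shift)

lemma Icc_sets: assumes "a \<le> s" "t \<le> b" shows "{s..t} \<in> sets \<mu>"
proof -
  have "{s..t} \<subseteq> {a..b}" using assms by auto
  moreover have "{s..t} \<inter> {a..b} \<in> sets \<mu>" by (rule borel_sets_\<mu>) simp
  ultimately show ?thesis by (simp only: Int_absorb2)
qed

lemma cell_lower:
  assumes x: "x \<in> {a..b}" and st: "a < s" "s < t" "t < b"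
  shows "measure lam (cell n x) * (t - s) \<le> dist_const * (b - a) * measure lam (cell n x \<inter> pullback n {s..t})"
proof -
  obtain u where u: "u \<in> pre n s" "same n x u" using ex1_pre_same[OF x, of s n] st by auto
  obtain v where v: "v \<in> pre n t" "same n x v" using ex1_pre_same[OF x, of t n] st by auto
  have uc: "u \<in> cell n x" "v \<in> cell n x" and fu: "(f ^^ n) u = s" "(f ^^ n) v = t"
    using u v by (auto simp: cell_def pre_def)
  have sub: "closed_segment u v \<subseteq> cell n x \<inter> pullback n {s..t}"
  proof
    fix w assume w: "w \<in> closed_segment u v"
    have wc: "w \<in> cell n x" using cell_segment[OF x uc] w by blast
    have "(f ^^ n) w \<in> closed_segment s t" using cell_between[OF x uc w] fu by simp
    then have "(f ^^ n) w \<in> {s..t}" using st by (simp add: closed_segment_eq_real_ivl)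
    then show "w \<in> cell n x \<inter> pullback n {s..t}" using wc cell_sub[of n x] unfolding pullback_def by blast
  qed
  have set: "cell n x \<inter> pullback n {s..t} \<in> sets \<mu>"
    using st by (intro sets.Int cell_sets pullback_sets Icc_sets) auto
  have uv: "\<bar>u - v\<bar> \<le> measure lam (cell n x \<inter> pullback n {s..t})" by (rule lam_segment[OF set sub])
  have "measure lam (cell n x) \<le> dist_const * (b - a) * \<bar>u - v\<bar> / (t - s)"
  proof (rule lam_diam[OF cell_sets])
    show "0 \<le> dist_const * (b - a) * \<bar>u - v\<bar> / (t - s)" using dist_const ab st by simp
    fix x' y' assume xy: "x' \<in> cell n x" "y' \<in> cell n x"
    have "\<bar>s - t\<bar> * \<bar>x' - y'\<bar> \<le> dist_const * \<bar>(f ^^ n) x' - (f ^^ n) y'\<bar> * \<bar>u - v\<bar>"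
      using distortion[OF x uc xy] fu by simp
    also have "\<dots> \<le> dist_const * (b - a) * \<bar>u - v\<bar>"
    proof (intro mult_right_mono mult_left_mono)
      have "x' \<in> {a..b}" "y' \<in> {a..b}" using xy cell_sub[of n x] by blast+
      then show "\<bar>(f ^^ n) x' - (f ^^ n) y'\<bar> \<le> b - a"
        using orbit_in[of x' n] orbit_in[of y' n] by auto
    qed (use dist_const in simp_all)
    finally show "\<bar>x' - y'\<bar> \<le> dist_const * (b - a) * \<bar>u - v\<bar> / (t - s)" using st by (simp add: field_simps)
  qed
  then have "measure lam (cell n x) * (t - s) \<le> dist_const * (b - a) * \<bar>u - v\<bar>" using st by (simp add: field_simps)
  also have "\<dots> \<le> dist_const * (b - a) * measure lam (cell n x \<inter> pullback n {s..t})"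
    using uv dist_const ab by (intro mult_left_mono) auto
  finally show ?thesis .
qed

lemma cell_upper:
  assumes x: "x \<in> {a..b}" and B: "B \<in> sets \<mu>" and l: "0 \<le> l" "\<And>u v. u \<in> B \<Longrightarrow> v \<in> B \<Longrightarrow> \<bar>u - v\<bar> \<le> l"
  shows "measure lam (cell n x \<inter> pullback n B) * (b - a) \<le> 2 * dist_const * l * measure lam (cell n x)"
proof -
  \<comment> \<open>The endpoints need not be values of \<open>f^n\<close> on the cylinder; those of an interior
      interval of half the length are.\<close>
  let ?s = "a + (b - a) / 4" and ?t = "a + 3 * (b - a) / 4"
  have st: "a < ?s" "?s < ?t" "?t < b" using ab by (simp_all add: field_simps)
  obtain u where u: "u \<in> pre n ?s" "same n x u" using ex1_pre_same[OF x, of ?s n] st by auto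
  obtain v where v: "v \<in> pre n ?t" "same n x v" using ex1_pre_same[OF x, of ?t n] st by auto
  have uc: "u \<in> cell n x" "v \<in> cell n x" and fu: "(f ^^ n) u = ?s" "(f ^^ n) v = ?t"
    using u v by (auto simp: cell_def pre_def)
  have uv: "\<bar>u - v\<bar> \<le> measure lam (cell n x)" by (rule lam_segment[OF cell_sets cell_segment[OF x uc]])
  have "measure lam (cell n x \<inter> pullback n B) \<le> 2 * dist_const * l * \<bar>u - v\<bar> / (b - a)"
  proof (rule lam_diam)
    show "cell n x \<inter> pullback n B \<in> sets \<mu>" using cell_sets pullback_sets[OF B] by (rule sets.Int)
    show "0 \<le> 2 * dist_const * l * \<bar>u - v\<bar> / (b - a)" using dist_const ab l by simp
    fix x' y' assume xy: "x' \<in> cell n x \<inter> pullback n B" "y' \<in> cell n x \<inter> pullback n B"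
    have d: "\<bar>(f ^^ n) u - (f ^^ n) v\<bar> = (b - a) / 2" using fu ab by (simp add: abs_if field_simps)
    have "\<bar>(f ^^ n) u - (f ^^ n) v\<bar> * \<bar>x' - y'\<bar> \<le> dist_const * \<bar>(f ^^ n) x' - (f ^^ n) y'\<bar> * \<bar>u - v\<bar>"
      using distortion[OF x uc] xy by blast
    also have "\<dots> \<le> dist_const * l * \<bar>u - v\<bar>"
      using l(2) xy dist_const by (intro mult_right_mono mult_left_mono) (auto simp: pullback_def)
    finally have "(b - a) / 2 * \<bar>x' - y'\<bar> \<le> dist_const * l * \<bar>u - v\<bar>" unfolding d .
    then have "\<bar>x' - y'\<bar> * (b - a) \<le> 2 * dist_const * l * \<bar>u - v\<bar>" by (simp add: algebra_simps)
    then show "\<bar>x' - y'\<bar> \<le> 2 * dist_const * l * \<bar>u - v\<bar> / (b - a)" using ab by (simp add: le_divide_eq)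
  qed
  then have "measure lam (cell n x \<inter> pullback n B) * (b - a) \<le> 2 * dist_const * l * \<bar>u - v\<bar>" using ab by (simp add: le_divide_eq)
  also have "\<dots> \<le> 2 * dist_const * l * measure lam (cell n x)" using uv dist_const l by (intro mult_left_mono) auto
  finally show ?thesis .
qed

lemma cells_disjoint: "disjoint_family_on (cell n) (pre n y0)"
  unfolding disjoint_family_on_def
proof (intro ballI impI, rule ccontr)
  fix x x' assume x: "x \<in> pre n y0" "x' \<in> pre n y0" "x \<noteq> x'" "cell n x \<inter> cell n x' \<noteq> {}"
  then obtain z where z: "z \<in> {a..b}" "same n x z" "same n x' z" by (auto simp: cell_def)
  then show False using ex1_pre_same[OF z(1) y0, of n] x same_sym by blast
qed

lemma measure_cells:
  assumes \<nu>: "finite_measure \<nu>" "sets \<nu> = sets \<mu>" and T: "cylset n T" and Y: "Y \<in> sets \<mu>"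
  shows "measure \<nu> (T \<inter> Y) = (\<Sum>x\<in>pre n y0 \<inter> T. measure \<nu> (cell n x \<inter> Y))"
proof -
  interpret \<nu>: finite_measure \<nu> by (rule \<nu>(1))
  have "T \<inter> Y = (\<Union>x\<in>pre n y0 \<inter> T. cell n x \<inter> Y)" using cylset_UN[OF T] by blast
  moreover have "disjoint_family_on (\<lambda>x. cell n x \<inter> Y) (pre n y0 \<inter> T)"
    using cells_disjoint[of n] unfolding disjoint_family_on_def by blast
  ultimately show ?thesis
    using finite_pre[OF y0, of n] cell_sets Y \<nu>(2)
    by (simp only:, intro \<nu>.finite_measure_finite_Union) auto
qed

lemma lam_mix_lower:
  assumes T: "cylset n T" and st: "a < s" "s < t" "t < b"
  shows "measure lam T * (t - s) \<le> dist_const * (b - a) * measure lam (T \<inter> pullback n {s..t})"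
proof -
  have B: "{s..t} \<in> sets \<mu>" using st by (intro Icc_sets) auto
  have TI: "T \<inter> {a..b} = T" using T by (auto simp: cylset_def)
  have "measure lam T = (\<Sum>x\<in>pre n y0 \<inter> T. measure lam (cell n x))"
    using measure_cells[OF finite_lam sets_lam T, of "{a..b}"] sets.top[of \<mu>] by (simp add: TI space_\<mu> cell_Int)
  then have "measure lam T * (t - s) = (\<Sum>x\<in>pre n y0 \<inter> T. measure lam (cell n x) * (t - s))"
    by (simp only: sum_distrib_right)
  also have "\<dots> \<le> (\<Sum>x\<in>pre n y0 \<inter> T. dist_const * (b - a) * measure lam (cell n x \<inter> pullback n {s..t}))"
    by (intro sum_mono cell_lower st) (simp add: pre_def)
  also have "\<dots> = dist_const * (b - a) * measure lam (T \<inter> pullback n {s..t})"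
    by (simp only: measure_cells[OF finite_lam sets_lam T pullback_sets[OF B]] sum_distrib_left)
  finally show ?thesis .
qed

lemma cylset_all: "cylset n {a..b}"
  unfolding cylset_def by (auto intro!: cylfunI)

lemma lam_pull_upper:
  assumes B: "B \<in> sets \<mu>" and l: "0 \<le> l" "\<And>u v. u \<in> B \<Longrightarrow> v \<in> B \<Longrightarrow> \<bar>u - v\<bar> \<le> l"
  shows "measure lam (pullback n B) \<le> 2 * dist_const * l"
proof -
  have I: "{a..b} \<in> sets \<mu>" using sets.top[of \<mu>] by (simp add: space_\<mu>)
  have vI: "{a..b} \<inter> pullback n B = pullback n B" by (auto simp: pullback_def)
  have "measure lam (pullback n B) * (b - a) = (\<Sum>x\<in>pre n y0 \<inter> {a..b}. measure lam (cell n x \<inter> pullback n B) * (b - a))"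
    using measure_cells[OF finite_lam sets_lam cylset_all[of n] pullback_sets[OF B, of n]]
    by (simp only: vI sum_distrib_right)
  also have "\<dots> \<le> (\<Sum>x\<in>pre n y0 \<inter> {a..b}. 2 * dist_const * l * measure lam (cell n x))"
    by (intro sum_mono cell_upper[OF _ B l]) auto
  also have "\<dots> = 2 * dist_const * l * measure lam {a..b}"
    using measure_cells[OF finite_lam sets_lam cylset_all[of n] I] by (simp add: sum_distrib_left cell_Int)
  also have "measure lam {a..b} = b - a" using ab by (simp add: lam_measure)
  finally show ?thesis using ab by simp
qed

lemma mu_mix_lower:
  assumes T: "cylset n T" and B: "cylset m B"
  shows "measure \<mu> T * measure \<mu> B \<le> Cg ^ 6 * (1 + K) * measure \<mu> (T \<inter> pullback n B)"
proof -
  let ?N = "n + m"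
  have cyl: "cylset ?N (T \<inter> pullback n B)"
  proof -
    have "cylfun ?N (\<lambda>x. x \<in> T \<and> (f ^^ n) x \<in> B)"
      using cylfun_comp2[where G="(\<and>)", OF cylfun_mono[of n "\<lambda>x. x \<in> T" ?N] cylfun_shift[of m "\<lambda>x. x \<in> B" n]] T B
      by (simp add: cylset_def)
    moreover have "T \<inter> pullback n B = {x \<in> {a..b}. x \<in> T \<and> (f ^^ n) x \<in> B}" by (auto simp: pullback_def)
    ultimately show ?thesis using cylset_Collect by simp
  qed
  have eq: "E ?N (indicator (T \<inter> pullback n B)) = E ?N (\<lambda>x. indicator T x * hit B n x)"
    by (rule E_cong) (auto simp: indicator_def hit_def pullback_def)
  have hB: "measure \<mu> B \<le> Cg\<^sup>2 * E ?N (hit B n)"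
    using E_vs_integral(1)[OF hit_cyl[OF B order_refl] hit_nonneg, of n] hit_integral[OF B, of n] by simp
  have "measure \<mu> T * measure \<mu> B \<le> (Cg\<^sup>2 * E ?N (indicator T)) * (Cg\<^sup>2 * E ?N (hit B n))"
    using E_vs_measure(1)[OF cylset_mono[OF T, of ?N]] hB
    by (intro mult_mono) (auto intro!: mult_nonneg_nonneg E_nonneg)
  also have "\<dots> = Cg ^ 4 * (E ?N (indicator T) * E ?N (hit B n))" by (simp add: power_numeral_reduce mult_ac)
  also have "\<dots> \<le> Cg ^ 4 * ((1 + K) * E ?N (\<lambda>x. indicator T x * hit B n x))"
    using mixing(2)[OF cylset_indicator[OF T], of "indicator B" 0 ?N] Cg
    by (intro mult_left_mono) (auto simp: hit_def[abs_def] \<eta>_0)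
  also have "\<dots> \<le> Cg ^ 4 * ((1 + K) * (Cg\<^sup>2 * measure \<mu> (T \<inter> pullback n B)))"
    using E_vs_measure(2)[OF cyl] K Cg unfolding eq by (intro mult_left_mono) auto
  finally show ?thesis by (simp add: power_numeral_reduce mult_ac)
qed

definition nbhd :: "nat \<Rightarrow> real set \<Rightarrow> real set" where
  "nbhd n Q = {x \<in> {a..b}. \<exists>z\<in>Q. same n x z}"

lemma nbhd_cylset: "cylset n (nbhd n Q)"
  unfolding nbhd_def
proof (rule cylset_Collect, rule cylfunI)
  fix x y assume "x \<in> {a..b}" "y \<in> {a..b}" and xy: "same n x y"
  show "(\<exists>z\<in>Q. same n x z) = (\<exists>z\<in>Q. same n y z)"
    using same_trans[OF xy] same_trans[OF same_sym[OF xy]] by blast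
qed

lemma nbhd_super: "Q \<subseteq> {a..b} \<Longrightarrow> Q \<subseteq> nbhd n Q"
  unfolding nbhd_def using same_refl by blast

lemma width_tendsto: "(\<lambda>n. (b - a) / c ^ n) \<longlonglongrightarrow> 0"
proof -
  have "(\<lambda>n. (b - a) * (1 / c) ^ n) \<longlonglongrightarrow> (b - a) * 0"
    using c_gt_1 by (intro tendsto_mult tendsto_const LIMSEQ_power_zero) auto
  then show ?thesis by (simp add: power_divide)
qed

lemma nbhd_measure:
  assumes \<nu>: "finite_measure \<nu>" "sets \<nu> = sets \<mu>" and Q: "compact Q" "Q \<subseteq> {a..b}"
  shows "(\<lambda>n. measure \<nu> (nbhd n Q)) \<longlonglongrightarrow> measure \<nu> Q"
proof -
  interpret \<nu>: finite_measure \<nu> by (rule \<nu>(1))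
  have "(\<Inter>n. nbhd n Q) = Q"
  proof (intro antisym subsetI)
    fix x assume x: "x \<in> (\<Inter>n. nbhd n Q)"
    have "\<exists>z\<in>Q. \<bar>x - z\<bar> \<le> (b - a) / c ^ n" for n
      using x same_dist[of x _ n] Q(2) unfolding nbhd_def by blast
    then obtain z where z: "\<And>n. z n \<in> Q" "\<And>n. \<bar>x - z n\<bar> \<le> (b - a) / c ^ n" by metis
    have "(\<lambda>n. x - z n) \<longlonglongrightarrow> 0"
      by (rule Lim_null_comparison[OF _ width_tendsto]) (simp add: z)
    then have "(\<lambda>n. x - (x - z n)) \<longlonglongrightarrow> x - 0" by (intro tendsto_diff tendsto_const)
    then have "z \<longlonglongrightarrow> x" by simp
    then show "x \<in> Q" using z(1) closed_sequentially[OF compact_imp_closed[OF Q(1)]] by blast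
  qed (use nbhd_super[OF Q(2)] in blast)
  moreover have "(\<lambda>n. measure \<nu> (nbhd n Q)) \<longlonglongrightarrow> measure \<nu> (\<Inter>n. nbhd n Q)"
  proof (rule \<nu>.finite_Lim_measure_decseq)
    show "range (\<lambda>n. nbhd n Q) \<subseteq> sets \<nu>" using cylset_sets[OF nbhd_cylset] \<nu>(2) by auto
    show "decseq (\<lambda>n. nbhd n Q)" unfolding decseq_def nbhd_def using same_mono by blast
  qed
  ultimately show ?thesis by simp
qed

text \<open>
  The density of \<open>\<mu>\<close> is finite and positive almost everywhere for \<open>\<mu>\<close>, hence bounded above and
  below on a set of positive measure; inner regularity makes this set compact.
\<close>

lemma comparable_compact:
  "\<exists>t Q. (1::real) \<le> t \<and> compact Q \<and> Q \<in> sets \<mu> \<and> 0 < measure \<mu> Q \<and>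
    (\<forall>A\<in>sets \<mu>. A \<subseteq> Q \<longrightarrow> measure \<mu> A \<le> t * measure lam A \<and> measure lam A \<le> t * measure \<mu> A)"
proof -
  define h where "h = RN_deriv lam \<mu>"
  have hm [measurable]: "h \<in> borel_measurable lam" by (simp add: h_def)
  have dens: "density lam h = \<mu>"
    unfolding h_def by (rule lam.density_RN_deriv) (use acip sets_lam lam_def in auto)
  have em: "emeasure \<mu> A = (\<integral>\<^sup>+x. h x * indicator A x \<partial>lam)" if "A \<in> sets \<mu>" for A
    using emeasure_density[OF hm, of A] that unfolding dens sets_lam by blast
  have "(\<integral>\<^sup>+x. h x \<partial>lam) = emeasure \<mu> (space \<mu>)"
    using em[OF sets.top] by (simp add: space_\<mu> space_lam[symmetric] nn_integral_indicator_singleton cong: nn_integral_cong_simp)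
  then have "AE x in lam. h x \<noteq> \<infinity>" by (intro nn_integral_PInf_AE[OF hm]) (simp add: emeasure_space_1)
  then have "AE x in density lam h. 0 < h x \<and> h x \<noteq> \<infinity>"
    by (subst AE_density[OF hm]) auto
  then have AEh: "AE x in \<mu>. 0 < h x \<and> h x \<noteq> \<infinity>" unfolding dens .
  define D where "D k = {x \<in> space lam. h x \<le> ennreal (real (Suc k)) \<and> 1 \<le> h x * ennreal (real (Suc k))}" for k
  have Ds: "D k \<in> sets \<mu>" for k unfolding D_def sets_lam[symmetric] by measurable
  have key: "\<exists>k. x \<in> D k" if x: "x \<in> {a..b}" "0 < h x" "h x \<noteq> \<infinity>" for x
  proof -
    obtain r where r: "h x = ennreal r" "0 < r" using x(2,3) by (cases "h x") auto
    obtain k1 k2 :: nat where k: "r < real k1" "1 / r < real k2" using reals_Archimedean2 by meson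
    define k where "k = max k1 k2"
    have "r \<le> real (Suc k)" "1 / r \<le> real (Suc k)" using k by (auto simp: k_def)
    then have "r \<le> real (Suc k)" "1 \<le> r * real (Suc k)" using r(2) by (auto simp: field_simps)
    from ennreal_leI[OF this(1)] ennreal_leI[OF this(2)]
    have "ennreal r \<le> ennreal (real (Suc k))" "ennreal 1 \<le> ennreal (r * real (Suc k))" .
    then have "x \<in> D k" using x(1) r by (simp add: D_def space_lam ennreal_mult)
    then show ?thesis by blast
  qed
  have "\<exists>k. measure \<mu> (D k) \<noteq> 0"
  proof (rule ccontr)
    assume "\<not> ?thesis"
    then have "\<And>k. D k \<in> null_sets \<mu>" using Ds by (simp add: emeasure_eq_measure null_sets_def)
    then have "AE x in \<mu>. \<forall>k. x \<notin> D k" by (simp add: AE_all_countable AE_not_in)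
    moreover have "AE x in \<mu>. x \<in> {a..b}" using AE_space[of \<mu>] by (simp add: space_\<mu>)
    ultimately have "AE x in \<mu>. False" using AEh
      by eventually_elim (use key in blast)
    then show False by simp
  qed
  then obtain k where k: "measure \<mu> (D k) \<noteq> 0" by blast
  define t where "t = real (Suc k)"
  have t: "1 \<le> t" by (simp add: t_def)
  have comp: "measure \<mu> A \<le> t * measure lam A \<and> measure lam A \<le> t * measure \<mu> A"
    if A: "A \<in> sets \<mu>" "A \<subseteq> D k" for A
  proof
    have Al: "A \<in> sets lam" using A sets_lam by simp
    have "emeasure \<mu> A \<le> (\<integral>\<^sup>+x. ennreal t * indicator A x \<partial>lam)"
      unfolding em[OF A(1)] using A(2) by (intro nn_integral_mono) (auto simp: D_def t_def indicator_def)
    also have "\<dots> = ennreal t * emeasure lam A" using Al by (rule nn_integral_cmult_indicator)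
    finally show "measure \<mu> A \<le> t * measure lam A"
      using t by (simp add: emeasure_eq_measure lam.emeasure_eq_measure ennreal_mult[symmetric])
    have "emeasure lam A = (\<integral>\<^sup>+x. indicator A x \<partial>lam)" using Al by simp
    also have "\<dots> \<le> (\<integral>\<^sup>+x. ennreal t * (h x * indicator A x) \<partial>lam)"
      using A(2) by (intro nn_integral_mono) (auto simp: D_def t_def indicator_def mult.commute)
    also have "\<dots> = ennreal t * emeasure \<mu> A" unfolding em[OF A(1)] using Al
      by (intro nn_integral_cmult borel_measurable_times_ennreal hm borel_measurable_indicator)
    finally show "measure lam A \<le> t * measure \<mu> A"
      using t by (simp add: emeasure_eq_measure lam.emeasure_eq_measure ennreal_mult[symmetric])
  qed
  define M where "M = distr \<mu> borel (\<lambda>x. x)"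
  have id: "(\<lambda>x. x) \<in> measurable \<mu> borel"
    unfolding measurable_cong_sets[OF sets_\<mu> refl] by (rule measurable_restrict_space1) simp
  have Db: "D k \<in> sets borel"
    using Ds[of k] unfolding sets_\<mu> by (auto simp: sets_restrict_space_iff)
  have ME: "emeasure M B = emeasure \<mu> (B \<inter> {a..b})" if "B \<in> sets borel" for B
    unfolding M_def using that by (subst emeasure_distr[OF id]) (auto simp: space_\<mu> vimage_def Int_def)
  have DI: "D k \<inter> {a..b} = D k" by (auto simp: D_def space_lam)
  have "0 < emeasure M (D k)" using k by (simp add: ME[OF Db] DI emeasure_eq_measure less_le)
  also have "emeasure M (D k) = (SUP K\<in>{K. K \<subseteq> D k \<and> compact K}. emeasure M K)"
  proof (rule inner_regular)
    show "sets M = sets borel" by (simp add: M_def)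
    show "emeasure M (space M) \<noteq> \<infinity>" using ME[of UNIV] by (simp add: M_def emeasure_eq_measure)
  qed (rule Db)
  finally obtain Q where Q: "Q \<subseteq> D k" "compact Q" "0 < emeasure M Q" by (auto simp: less_SUP_iff)
  have QI: "Q \<inter> {a..b} = Q" using Q(1) DI by blast
  have Qb: "Q \<in> sets borel" by (rule borel_closed[OF compact_imp_closed[OF Q(2)]])
  have Qs: "Q \<in> sets \<mu>" using borel_sets_\<mu>[OF Qb] QI by simp
  have "0 < measure \<mu> Q" using Q(3) ME[OF Qb] QI by (simp add: emeasure_eq_measure)
  then show ?thesis using t Q comp Qs by (intro exI[of _ t] exI[of _ Q]) blast
qed

text \<open>
  By invariance the measure of an interval is that of its \<open>n\<close>-th preimage, which is at least
  that of the part inside \<open>Q\<close>, where \<open>\<mu>\<close> and length are comparable. Since the \<open>n\<close>-cylinders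
  meeting \<open>Q\<close> shrink to \<open>Q\<close> and, by distortion, the preimage takes up its share of each
  cylinder, that part has length at least a fixed multiple of the length of the interval, up to
  an error tending to 0.
\<close>

lemma density_lower: "\<exists>k>0. \<forall>s t. a < s \<longrightarrow> s < t \<longrightarrow> t < b \<longrightarrow> k * (t - s) \<le> measure \<mu> {s..t}"
proof -
  obtain T Q where Q: "1 \<le> T" "compact Q" "Q \<in> sets \<mu>" "0 < measure \<mu> Q"
    and comp: "\<And>A. A \<in> sets \<mu> \<Longrightarrow> A \<subseteq> Q \<Longrightarrow> measure \<mu> A \<le> T * measure lam A \<and> measure lam A \<le> T * measure \<mu> A"
    using comparable_compact by blast
  have lQ: "0 < measure lam Q"
  proof -
    have "0 < T * measure lam Q" using comp[OF Q(3) order_refl] Q(4) by linarith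
    then show ?thesis using Q(1) by (simp add: zero_less_mult_iff)
  qed
  define k where "k = measure lam Q / (dist_const * (b - a) * T)"
  have Kb: "0 < dist_const * (b - a)" using dist_const ab by simp
  have k0: "0 < k" using lQ Kb Q(1) by (simp add: k_def)
  have "k * (t - s) \<le> measure \<mu> {s..t}" if st: "a < s" "s < t" "t < b" for s t
  proof -
    have B: "{s..t} \<in> sets \<mu>" using st by (intro Icc_sets) auto
    have n: "measure lam Q * (t - s) / (dist_const * (b - a)) \<le> T * measure \<mu> {s..t} + (measure lam (nbhd n Q) - measure lam Q)" for n
    proof -
      let ?T = "nbhd n Q"
      have Ts: "?T \<in> sets \<mu>" by (rule cylset_sets[OF nbhd_cylset])
      have QT: "Q \<subseteq> ?T" by (rule nbhd_super[OF sets_sub[OF Q(3)]])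
      have vs: "pullback n {s..t} \<in> sets \<mu>" by (rule pullback_sets[OF B])
      have "measure lam Q * (t - s) \<le> measure lam ?T * (t - s)"
        using st QT Ts sets_lam by (intro mult_right_mono lam.finite_measure_mono) auto
      also have "\<dots> \<le> dist_const * (b - a) * measure lam (?T \<inter> pullback n {s..t})" by (rule lam_mix_lower[OF nbhd_cylset st])
      finally have "measure lam Q * (t - s) / (dist_const * (b - a)) \<le> measure lam (?T \<inter> pullback n {s..t})"
        using Kb by (simp add: divide_le_eq mult.commute)
      also have "\<dots> \<le> measure lam ((Q \<inter> pullback n {s..t}) \<union> (?T - Q))"
        using Ts Q(3) vs sets_lam by (intro lam.finite_measure_mono) auto
      also have "\<dots> \<le> measure lam (Q \<inter> pullback n {s..t}) + measure lam (?T - Q)"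
        using Ts Q(3) vs sets_lam by (intro measure_Un_le) auto
      also have "measure lam (?T - Q) = measure lam ?T - measure lam Q"
        using Ts Q(3) QT sets_lam by (intro lam.finite_measure_Diff) auto
      also have "measure lam (Q \<inter> pullback n {s..t}) \<le> T * measure \<mu> (Q \<inter> pullback n {s..t})"
        using comp[of "Q \<inter> pullback n {s..t}"] Q(3) vs by auto
      also have "\<dots> \<le> T * measure \<mu> (pullback n {s..t})"
        using Q(1) vs by (intro mult_left_mono finite_measure_mono) auto
      also have "measure \<mu> (pullback n {s..t}) = measure \<mu> {s..t}" by (rule pullback_measure[OF B])
      finally show ?thesis by simp
    qed
    have "(\<lambda>n. T * measure \<mu> {s..t} + (measure lam (nbhd n Q) - measure lam Q)) \<longlonglongrightarrow> T * measure \<mu> {s..t} + (measure lam Q - measure lam Q)"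
      by (intro tendsto_intros nbhd_measure[OF finite_lam sets_lam Q(2) sets_sub[OF Q(3)]])
    then have "measure lam Q * (t - s) / (dist_const * (b - a)) \<le> T * measure \<mu> {s..t} + (measure lam Q - measure lam Q)"
      by (rule LIMSEQ_le_const) (use n in blast)
    then have "measure lam Q * (t - s) / (dist_const * (b - a)) / T \<le> T * measure \<mu> {s..t} / T"
      using Q(1) by (intro divide_right_mono) auto
    then show ?thesis using Q(1) by (simp add: k_def)
  qed
  then show ?thesis using k0 by blast
qed

text \<open>
  The argument of \<open>density_lower\<close> with the roles of \<open>\<mu>\<close> and length exchanged. Length is not
  invariant, but pulling back changes it by a bounded factor; and independence of past and
  future up to a constant holds for \<open>\<mu>\<close> on cylinders, whence the restriction to cylinders.
\<close>

lemma cell_density_upper: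
  "\<exists>k>0. \<forall>m x l. x \<in> {a..b} \<longrightarrow> (\<forall>u\<in>cell m x. \<forall>v\<in>cell m x. \<bar>u - v\<bar> \<le> l) \<longrightarrow> measure \<mu> (cell m x) \<le> k * l"
proof -
  obtain T Q where Q: "1 \<le> T" "compact Q" "Q \<in> sets \<mu>" "0 < measure \<mu> Q"
    and comp: "\<And>A. A \<in> sets \<mu> \<Longrightarrow> A \<subseteq> Q \<Longrightarrow> measure \<mu> A \<le> T * measure lam A \<and> measure lam A \<le> T * measure \<mu> A"
    using comparable_compact by blast
  define G where "G = Cg ^ 6 * (1 + K)"
  have G: "0 < G" using Cg K by (simp add: G_def)
  define k where "k = 2 * dist_const * T * G / measure \<mu> Q"
  have k0: "0 < k" using dist_const Q G by (simp add: k_def)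
  have "measure \<mu> (cell m x) \<le> k * l"
    if x: "x \<in> {a..b}" and l: "\<And>u v. u \<in> cell m x \<Longrightarrow> v \<in> cell m x \<Longrightarrow> \<bar>u - v\<bar> \<le> l" for m x l
  proof -
    let ?B = "cell m x"
    have l0: "0 \<le> l" using l[of x x] x by (simp add: cell_def)
    have Bc: "cylset m ?B"
      unfolding cell_def
    proof (rule cylset_Collect, rule cylfunI)
      fix y z assume "y \<in> {a..b}" "z \<in> {a..b}" and yz: "same m y z"
      show "same m x y = same m x z" using same_trans[OF _ yz] same_trans[OF _ same_sym[OF yz]] by blast
    qed
    have Bs: "?B \<in> sets \<mu>" by (rule cell_sets)
    have n: "measure \<mu> Q * measure \<mu> ?B / G \<le> T * (2 * dist_const * l) + (measure \<mu> (nbhd n Q) - measure \<mu> Q)" for n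
    proof -
      let ?T = "nbhd n Q"
      have Ts: "?T \<in> sets \<mu>" by (rule cylset_sets[OF nbhd_cylset])
      have QT: "Q \<subseteq> ?T" by (rule nbhd_super[OF sets_sub[OF Q(3)]])
      have vs: "pullback n ?B \<in> sets \<mu>" by (rule pullback_sets[OF Bs])
      have "measure \<mu> Q * measure \<mu> ?B \<le> measure \<mu> ?T * measure \<mu> ?B"
        using QT Ts by (intro mult_right_mono finite_measure_mono) auto
      also have "\<dots> \<le> G * measure \<mu> (?T \<inter> pullback n ?B)" unfolding G_def by (rule mu_mix_lower[OF nbhd_cylset Bc])
      finally have "measure \<mu> Q * measure \<mu> ?B / G \<le> measure \<mu> (?T \<inter> pullback n ?B)"
        using G by (simp add: divide_le_eq mult.commute)
      also have "\<dots> \<le> measure \<mu> ((Q \<inter> pullback n ?B) \<union> (?T - Q))"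
        using Ts Q(3) vs by (intro finite_measure_mono) auto
      also have "\<dots> \<le> measure \<mu> (Q \<inter> pullback n ?B) + measure \<mu> (?T - Q)"
        using Ts Q(3) vs by (intro measure_Un_le) auto
      also have "measure \<mu> (?T - Q) = measure \<mu> ?T - measure \<mu> Q"
        using Ts Q(3) QT by (intro finite_measure_Diff) auto
      also have "measure \<mu> (Q \<inter> pullback n ?B) \<le> T * measure lam (Q \<inter> pullback n ?B)"
        using comp[of "Q \<inter> pullback n ?B"] Q(3) vs by auto
      also have "\<dots> \<le> T * measure lam (pullback n ?B)"
        using Q(1) vs sets_lam by (intro mult_left_mono lam.finite_measure_mono) auto
      also have "\<dots> \<le> T * (2 * dist_const * l)"
        using Q(1) by (intro mult_left_mono lam_pull_upper[OF Bs l0 l]) auto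
      finally show ?thesis by simp
    qed
    have "(\<lambda>n. T * (2 * dist_const * l) + (measure \<mu> (nbhd n Q) - measure \<mu> Q)) \<longlonglongrightarrow> T * (2 * dist_const * l) + (measure \<mu> Q - measure \<mu> Q)"
      by (intro tendsto_intros nbhd_measure[OF _ refl Q(2) sets_sub[OF Q(3)]]) unfold_locales
    then have "measure \<mu> Q * measure \<mu> ?B / G \<le> T * (2 * dist_const * l) + (measure \<mu> Q - measure \<mu> Q)"
      by (rule LIMSEQ_le_const) (use n in blast)
    then show ?thesis using Q G by (simp add: k_def field_simps)
  qed
  then show ?thesis using k0 by blast
qed

text \<open>
  An interval is covered by the \<open>n\<close>-cylinders that meet it, whose total length tends to that of
  the interval.
\<close>

lemma density_upper: "\<exists>k>0. \<forall>s t. s \<le> t \<longrightarrow> measure \<mu> ({s..t} \<inter> {a..b}) \<le> k * (t - s)"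
proof -
  obtain k where k: "0 < k" "\<And>m x l. x \<in> {a..b} \<Longrightarrow>
     (\<And>u v. u \<in> cell m x \<Longrightarrow> v \<in> cell m x \<Longrightarrow> \<bar>u - v\<bar> \<le> l) \<Longrightarrow> measure \<mu> (cell m x) \<le> k * l"
    using cell_density_upper by blast
  have "measure \<mu> ({s..t} \<inter> {a..b}) \<le> k * (t - s)" if st: "s \<le> t" for s t
  proof -
    define V where "V = {s..t} \<inter> {a..b}"
    have n: "measure \<mu> V \<le> k * (t - s + 2 * ((b - a) / c ^ n))" for n
    proof -
      let ?r = "(b - a) / c ^ n" and ?T = "nbhd n V"
      have r0: "0 \<le> ?r" using ab c_gt_1 by simp
      have Ts: "?T \<in> sets \<mu>" by (rule cylset_sets[OF nbhd_cylset])
      have T: "?T \<inter> {a..b} = ?T" by (auto simp: nbhd_def)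
      have I: "{a..b} \<in> sets \<mu>" using ab by (intro Icc_sets) auto
      have "measure \<mu> V \<le> measure \<mu> ?T"
        by (intro finite_measure_mono Ts nbhd_super) (simp add: V_def)
      also have "\<dots> = (\<Sum>x\<in>pre n y0 \<inter> ?T. measure \<mu> (cell n x))"
        using measure_cells[OF finite_measure_axioms refl nbhd_cylset[of n V] I] by (simp add: T cell_Int)
      also have "\<dots> \<le> (\<Sum>x\<in>pre n y0 \<inter> ?T. k * measure lam (cell n x))"
      proof (rule sum_mono)
        fix x assume "x \<in> pre n y0 \<inter> ?T"
        then have x: "x \<in> {a..b}" by (simp add: pre_def)
        show "measure \<mu> (cell n x) \<le> k * measure lam (cell n x)"
          by (rule k(2)[OF x]) (rule lam_segment[OF cell_sets cell_segment[OF x]])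
      qed
      also have "\<dots> = k * measure lam ?T"
        using measure_cells[OF finite_lam sets_lam nbhd_cylset[of n V] I]
        by (simp add: T cell_Int sum_distrib_left)
      also have "\<dots> \<le> k * (t - s + 2 * ?r)"
      proof (intro mult_left_mono lam_diam[OF Ts])
        fix x y assume "x \<in> ?T" "y \<in> ?T"
        then obtain x' y' where x': "x' \<in> {s..t}" "\<bar>x - x'\<bar> \<le> ?r" and y': "y' \<in> {s..t}" "\<bar>y - y'\<bar> \<le> ?r"
          using same_dist[of x _ n] same_dist[of y _ n] unfolding nbhd_def V_def by blast
        have "\<bar>x' - y'\<bar> \<le> t - s" using x'(1) y'(1) by auto
        then show "\<bar>x - y\<bar> \<le> t - s + 2 * ?r" using x'(2) y'(2) by linarith
      qed (use k(1) r0 st in linarith)+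
      finally show ?thesis .
    qed
    have "(\<lambda>n. k * (t - s + 2 * ((b - a) / c ^ n))) \<longlonglongrightarrow> k * (t - s + 2 * 0)"
      by (intro tendsto_intros width_tendsto)
    then have "measure \<mu> V \<le> k * (t - s + 2 * 0)"
      by (rule LIMSEQ_le_const) (use n in blast)
    then show ?thesis by (simp add: V_def)
  qed
  then show ?thesis using k(1) by blast
qed

lemma gibbs_coding_exists: "\<exists>dens. gibbs_coding a b \<P> f \<phi> c \<alpha> H \<mu> Cg dens"
proof -
  obtain k1 where k1: "0 < k1" "\<And>s t. a < s \<Longrightarrow> s < t \<Longrightarrow> t < b \<Longrightarrow> k1 * (t - s) \<le> measure \<mu> {s..t}"
    using density_lower by blast
  obtain k2 where k2: "0 < k2" "\<And>s t. s \<le> t \<Longrightarrow> measure \<mu> ({s..t} \<inter> {a..b}) \<le> k2 * (t - s)"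
    using density_upper by blast
  define D where "D = 1 + k2 + 4 / k1"
  have D: "1 \<le> D" "k2 \<le> D" "4 / k1 \<le> D" using k1 k2 by (simp_all add: D_def)
  have "gibbs_coding a b \<P> f \<phi> c \<alpha> H \<mu> Cg D"
  proof unfold_locales
    show "1 \<le> D" by (rule D)
    show "measure \<mu> ({s..t} \<inter> {a..b}) \<le> D * (t - s)" if "s \<le> t" for s t
      using k2(2)[OF that] mult_right_mono[OF D(2), of "t - s"] that by linarith
    show "d \<le> D * measure \<mu> (ball y d \<inter> {a..b})" if y: "y \<in> {a..b}" and d: "0 < d" "d \<le> b - a" for y d
    proof -
      have "\<exists>s t. a < s \<and> t < b \<and> t - s = d / 4 \<and> {s..t} \<subseteq> ball y d"
      proof (cases "y \<le> (a + b) / 2")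
        case True
        show ?thesis
          by (intro exI[of _ "y + d / 8"] exI[of _ "y + 3 * d / 8"] conjI) (use True y d in \<open>auto simp: dist_real_def field_simps\<close>)
      next
        case False
        show ?thesis
          by (intro exI[of _ "y - 3 * d / 8"] exI[of _ "y - d / 8"] conjI) (use False y d in \<open>auto simp: dist_real_def field_simps\<close>)
      qed
      then obtain s t where st: "a < s" "t < b" "t - s = d / 4" "{s..t} \<subseteq> ball y d" by blast
      have "k1 * (d / 4) \<le> measure \<mu> {s..t}" using k1(2)[of s t] st d by simp
      also have "\<dots> \<le> measure \<mu> (ball y d \<inter> {a..b})"
        using st by (intro finite_measure_mono borel_sets_\<mu>) auto
      finally have "(4 / k1) * (k1 * (d / 4)) \<le> (4 / k1) * measure \<mu> (ball y d \<inter> {a..b})"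
        using k1(1) by (intro mult_left_mono) auto
      then have "d \<le> (4 / k1) * measure \<mu> (ball y d \<inter> {a..b})" using k1(1) by simp
      also have "\<dots> \<le> D * measure \<mu> (ball y d \<inter> {a..b})" using D(3) by (intro mult_right_mono) auto
      finally show ?thesis .
    qed
  qed
  then show ?thesis by blast
qed

end

section \<open>The interval, its branches and its cylinders\<close>

lemma mvt_within:
  fixes g :: "real \<Rightarrow> real"
  assumes S: "is_interval S" "g differentiable_on S" and xy: "x \<in> S" "y \<in> S" "x < y"
  shows "\<exists>z\<in>S. g y - g x = (y - x) * deriv_on S g z"
proof -
  have sub: "{x..y} \<subseteq> S"
    using mem_is_interval_1_I[OF S(1) xy(1,2)] by (intro subsetI) (simp only: atLeastAtMost_iff)
  have cont: "continuous_on {x..y} g"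
    using differentiable_imp_continuous_on[OF S(2)] sub continuous_on_subset by blast
  have at: "at z within S = at z" if "x < z" "z < y" for z
  proof (rule at_within_interior)
    have "{x<..<y} \<subseteq> interior S" using sub by (intro interior_maximal) auto
    then show "z \<in> interior S" using that by auto
  qed
  have d: "g differentiable (at z)" if "x < z" "z < y" for z
  proof -
    have "z \<in> S" using sub that by auto
    then have "g differentiable (at z within S)" using S(2) unfolding differentiable_on_def by blast
    then show ?thesis unfolding at[OF that] .
  qed
  obtain l z where lz: "x < z" "z < y" "DERIV g z :> l" "g y - g x = (y - x) * l"
    using MVT[OF xy(3) cont d] by blast
  have "deriv_on S g z = l"
    unfolding at[OF lz(1,2)] by (rule vector_derivative_at) (use lz(3) has_real_derivative_iff_has_vector_derivative in blast)
  then show ?thesis using lz sub by (intro bexI[of _ z]) auto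
qed

text \<open>
  Removing an endpoint from an interval leaves an interval, whereas removing an interior value
  from the image of the interval would disconnect it.
\<close>

lemma endpoint_extremal:
  fixes g :: "real \<Rightarrow> real"
  assumes "is_interval (S - {e})" "continuous_on S g" "inj_on g S" "e \<in> S" "u \<in> S" "v \<in> S" "g u < g e" "g e < g v"
  shows False
proof -
  have "connected (g ` (S - {e}))"
    using assms by (intro connected_continuous_image is_interval_connected) (auto intro: continuous_on_subset)
  moreover have "g u \<in> g ` (S - {e})" "g v \<in> g ` (S - {e})" using assms by auto
  ultimately have "{g u..g v} \<subseteq> g ` (S - {e})" by (rule connected_contains_Icc)
  then have "g e \<in> g ` (S - {e})" using assms by auto
  then show False using assms(3,4) by (auto simp: inj_on_def)
qed

lemma powr_le_smaller_exponent:
  fixes t D :: real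
  assumes "0 \<le> t" "t \<le> D" "0 < \<alpha>" "\<alpha> \<le> \<beta>" "\<beta> \<le> 1"
  shows "t powr \<beta> \<le> (1 + D) * t powr \<alpha>"
proof (cases "t = 0")
  case False
  have "t powr \<beta> = t powr \<alpha> * t powr (\<beta> - \<alpha>)" using False assms by (simp flip: powr_add)
  also have "\<dots> \<le> t powr \<alpha> * (1 + D)"
  proof (rule mult_left_mono)
    have "t powr (\<beta> - \<alpha>) \<le> (1 + D) powr (\<beta> - \<alpha>)" using assms by (intro powr_mono2) auto
    also have "\<dots> \<le> (1 + D) powr 1" using assms by (intro powr_mono) auto
    finally show "t powr (\<beta> - \<alpha>) \<le> 1 + D" using assms by simp
  qed simp
  finally show ?thesis by (simp add: mult.commute)
qed (use assms in simp)

lemma uniform_holder: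
  assumes "finite \<Q>" and sub: "\<And>P. P \<in> \<Q> \<Longrightarrow> P \<subseteq> {a..b}" and h: "\<And>P. P \<in> \<Q> \<Longrightarrow> holder_on P \<phi>" and ab: "a < b"
  shows "\<exists>\<alpha> K. 0 < \<alpha> \<and> \<alpha> \<le> 1 \<and> 0 \<le> K \<and> (\<forall>P\<in>\<Q>. \<forall>x\<in>P. \<forall>y\<in>P. \<bar>\<phi> x - \<phi> y\<bar> \<le> K * \<bar>x - y\<bar> powr \<alpha>)"
  using assms(1,2,3)
proof (induction \<Q> rule: finite_induct)
  case empty
  show ?case by (intro exI[of _ 1] exI[of _ 0]) auto
next
  case (insert P \<Q>)
  obtain \<alpha>1 K1 where 1: "0 < \<alpha>1" "\<alpha>1 \<le> 1" "0 \<le> K1" "\<forall>P\<in>\<Q>. \<forall>x\<in>P. \<forall>y\<in>P. \<bar>\<phi> x - \<phi> y\<bar> \<le> K1 * \<bar>x - y\<bar> powr \<alpha>1"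
    using insert.IH insert.prems by auto
  obtain \<alpha>2 K2 where 2: "0 < \<alpha>2" "\<alpha>2 \<le> 1" "\<forall>x\<in>P. \<forall>y\<in>P. \<bar>\<phi> x - \<phi> y\<bar> \<le> K2 * \<bar>x - y\<bar> powr \<alpha>2"
    using insert.prems(2)[of P] unfolding holder_on_def by auto
  define \<alpha> where "\<alpha> = min \<alpha>1 \<alpha>2"
  define D where "D = b - a"
  define K where "K = (K1 + \<bar>K2\<bar>) * (1 + D)"
  have D: "0 \<le> D" using ab by (simp add: D_def)
  have K: "0 \<le> K" using 1 D by (simp add: K_def)
  have \<alpha>: "0 < \<alpha>" "\<alpha> \<le> 1" "\<alpha> \<le> \<alpha>1" "\<alpha> \<le> \<alpha>2" using 1 2 by (auto simp: \<alpha>_def)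
  have gen: "\<bar>\<phi> x - \<phi> y\<bar> \<le> K * \<bar>x - y\<bar> powr \<alpha>"
    if xy: "x \<in> {a..b}" "y \<in> {a..b}" and le: "\<bar>\<phi> x - \<phi> y\<bar> \<le> k * \<bar>x - y\<bar> powr \<beta>"
      and k: "k \<le> K1 + \<bar>K2\<bar>" and \<beta>: "\<alpha> \<le> \<beta>" "\<beta> \<le> 1" for x y k \<beta>
  proof -
    have "k * \<bar>x - y\<bar> powr \<beta> \<le> (K1 + \<bar>K2\<bar>) * \<bar>x - y\<bar> powr \<beta>" using k by (intro mult_right_mono) auto
    also have "\<dots> \<le> (K1 + \<bar>K2\<bar>) * ((1 + D) * \<bar>x - y\<bar> powr \<alpha>)"
      using xy 1 \<alpha> \<beta> by (intro mult_left_mono powr_le_smaller_exponent) (auto simp: D_def)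
    finally show ?thesis using le by (simp add: K_def mult.assoc)
  qed
  have "\<bar>\<phi> x - \<phi> y\<bar> \<le> K * \<bar>x - y\<bar> powr \<alpha>" if Q: "Q \<in> insert P \<Q>" and xy: "x \<in> Q" "y \<in> Q" for Q x y
  proof -
    have I: "x \<in> {a..b}" "y \<in> {a..b}" using insert.prems(1)[OF Q] xy by blast+
    show ?thesis
    proof (cases "Q = P")
      case True
      then show ?thesis using gen[OF I, of K2 \<alpha>2] 2 xy 1(3) \<alpha> by auto
    next
      case False
      then show ?thesis using gen[OF I, of K1 \<alpha>1] 1 Q xy \<alpha> by auto
    qed
  qed
  then show ?case using \<alpha> K by (intro exI[of _ \<alpha>] exI[of _ K]) auto
qed

context branch_coding
begin

lemma cell_cylinder:
  assumes x: "x \<in> {a..b}"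
  shows "{z \<in> {a..b}. same n x z} \<in> cylinders {a..b} \<P> f n"
proof -
  define w where "w i = (SOME P. P \<in> \<P> \<and> (f ^^ i) x \<in> P)" for i
  have w: "w i \<in> \<P>" "(f ^^ i) x \<in> w i" for i
    using someI_ex[of "\<lambda>P. P \<in> \<P> \<and> (f ^^ i) x \<in> P"] in_some_P[OF orbit_in[OF x, of i]] unfolding w_def by blast+
  have iff: "(\<forall>P\<in>\<P>. (f ^^ i) x \<in> P \<longleftrightarrow> (f ^^ i) z \<in> P) \<longleftrightarrow> (f ^^ i) z \<in> w i" for i z
    using w[of i] P_eq by blast
  have eq: "{z \<in> {a..b}. same n x z} = {z \<in> {a..b}. \<forall>i<n. (f ^^ i) z \<in> w i}"
    unfolding same_def iff ..
  have "x \<in> {z \<in> {a..b}. same n x z}" using x same_refl by blast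
  then show ?thesis unfolding cylinders_def eq using w(1) by blast
qed

text \<open>
  A cylinder of order \<open>n + 1\<close> is the part of a cylinder of order \<open>n\<close> that \<open>f^n\<close> maps into an
  interval, and \<open>f^n\<close> is injective and continuous, hence monotone, on the larger cylinder.
\<close>

lemma cell_structure:
  assumes P: "\<And>P. P \<in> \<P> \<Longrightarrow> is_interval P" "\<And>P. P \<in> \<P> \<Longrightarrow> f differentiable_on P" and x: "x \<in> {a..b}"
  shows "is_interval {z \<in> {a..b}. same n x z} \<and> (f ^^ n) differentiable_on {z \<in> {a..b}. same n x z}"
proof (induction n)
  case 0
  have "{z \<in> {a..b}. same 0 x z} = {a..b}" by (auto simp: same_def)
  then show ?case by (simp add: is_interval_cc id_def)
next
  case (Suc n)
  let ?C = "{z \<in> {a..b}. same n x z}" and ?D = "{z \<in> {a..b}. same (Suc n) x z}"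
  obtain Q where Q: "Q \<in> \<P>" "(f ^^ n) x \<in> Q" using in_some_P[OF orbit_in[OF x]] by blast
  have D: "?D = {z \<in> ?C. (f ^^ n) z \<in> Q}"
  proof -
    have "(\<forall>P\<in>\<P>. (f ^^ n) x \<in> P \<longleftrightarrow> (f ^^ n) z \<in> P) \<longleftrightarrow> (f ^^ n) z \<in> Q" for z
      using Q P_eq by blast
    then show ?thesis unfolding same_def by (auto simp: less_Suc_eq)
  qed
  have cont: "continuous_on ?C (f ^^ n)" using Suc differentiable_imp_continuous_on by blast
  have inj: "inj_on (f ^^ n) ?C"
  proof (rule inj_onI)
    fix u v assume uv: "u \<in> ?C" "v \<in> ?C" "(f ^^ n) u = (f ^^ n) v"
    have "same n u v" using uv same_trans[OF same_sym] by blast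
    then have "c ^ n * \<bar>u - v\<bar> \<le> 0" using same_contract[of u v n] uv by simp
    moreover have "0 < c ^ n" using c_gt_1 by simp
    ultimately show "u = v" by (simp add: mult_le_0_iff)
  qed
  have int: "is_interval ?D"
    unfolding is_interval_1
  proof (intro ballI allI impI)
    fix u v z assume u: "u \<in> ?D" and v: "v \<in> ?D" and z: "u \<le> z \<and> z \<le> v"
    have uC: "u \<in> ?C" "v \<in> ?C" using u v unfolding D by blast+
    have sub: "{u..v} \<subseteq> ?C"
      using mem_is_interval_1_I[OF conjunct1[OF Suc] uC] by (intro subsetI) (simp only: atLeastAtMost_iff)
    have zC: "z \<in> ?C" using sub z by auto
    show "z \<in> ?D"
    proof (cases "z = u \<or> z = v")
      case False
      then have uz: "u < z" "z < v" using z by auto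
      have "((f ^^ n) u < (f ^^ n) z \<and> (f ^^ n) z < (f ^^ n) v) \<or> ((f ^^ n) v < (f ^^ n) z \<and> (f ^^ n) z < (f ^^ n) u)"
        by (rule continuous_inj_imp_mono[OF uz continuous_on_subset[OF cont sub] inj_on_subset[OF inj sub]])
      moreover have "(f ^^ n) u \<in> Q" "(f ^^ n) v \<in> Q" using u v unfolding D by auto
      ultimately have "(f ^^ n) z \<in> Q"
        using mem_is_interval_1_I[OF P(1)[OF Q(1)]] less_imp_le by metis
      then show ?thesis using zC unfolding D by blast
    qed (use u v in auto)
  qed
  have "(f ^^ Suc n) differentiable_on ?D"
    unfolding differentiable_on_def funpow.simps
  proof (intro ballI differentiable_chain_within)
    fix z assume z: "z \<in> ?D"
    have "?D \<subseteq> ?C" unfolding D by blast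
    then show "(f ^^ n) differentiable (at z within ?D)"
      using Suc z unfolding differentiable_on_def by (meson differentiable_within_subset subsetD)
    have "(f ^^ n) ` ?D \<subseteq> Q" "(f ^^ n) z \<in> Q" using z unfolding D by auto
    then show "f differentiable (at ((f ^^ n) z) within (f ^^ n) ` ?D)"
      using P(2)[OF Q(1)] unfolding differentiable_on_def by (meson differentiable_within_subset)
  qed
  then show ?case using int by blast
qed

end

locale acip_gibbs_system = gibbs_system +
  assumes ac: "absolutely_continuous (restrict_space lborel I) \<mu>"
begin

lemma space_I: "space \<mu> = I"
  using sets_eq_imp_space_eq[OF sets_borel] by (simp add: space_restrict_space)

lemma I_borel: "I \<in> sets borel" by (rule real_interval_borel_measurable[OF interval])

lemma borel_null: assumes "N \<in> sets borel" "N \<subseteq> I" "emeasure lborel N = 0" shows "emeasure \<mu> N = 0"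
proof -
  have "N \<in> null_sets (restrict_space lborel I)"
    using assms I_borel by (subst null_sets_restrict_space) (simp_all add: null_sets_def)
  then have "N \<in> null_sets \<mu>" using ac unfolding absolutely_continuous_def by blast
  then show ?thesis by auto
qed

lemma I_two_points: "\<exists>u\<in>I. \<exists>v\<in>I. u < v"
proof (rule ccontr)
  assume n: "\<not> ?thesis"
  obtain x where x: "x \<in> I" using not_empty space_I by auto
  then have "I = {x}" using n by (metis antisym_conv3 singleton_iff subsetI subset_antisym empty_subsetI insert_subset)
  then have "emeasure \<mu> I = 0" using I_borel by (intro borel_null) auto
  then show False using emeasure_space_1 space_I by simp
qed

lemma P_sub: "P \<in> \<P> \<Longrightarrow> P \<subseteq> I" and P_nonempty: "P \<in> \<P> \<Longrightarrow> P \<noteq> {}"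
  and P_disjoint: "P \<in> \<P> \<Longrightarrow> Q \<in> \<P> \<Longrightarrow> P \<noteq> Q \<Longrightarrow> P \<inter> Q = {}" and P_cover: "x \<in> I \<Longrightarrow> \<exists>P\<in>\<P>. x \<in> P"
  using finite_partition(2) by (auto simp: partition_on_def disjoint_def)

lemma f_I: "x \<in> I \<Longrightarrow> f x \<in> I" using P_cover branch_into by blast

lemma fn_I: "x \<in> I \<Longrightarrow> (f ^^ n) x \<in> I" by (induction n) (auto intro: f_I)

lemma f_diff: "P \<in> \<P> \<Longrightarrow> f differentiable_on P"
  using branch_C2 by (auto simp: C2_on_def)

lemma expansion: "\<exists>c>1. \<forall>P\<in>\<P>. \<forall>x\<in>P. \<forall>y\<in>P. c * \<bar>x - y\<bar> \<le> \<bar>f x - f y\<bar>"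
proof -
  obtain c where c: "1 < c" "\<And>P x. P \<in> \<P> \<Longrightarrow> x \<in> P \<Longrightarrow> c \<le> \<bar>deriv_on P f x\<bar>" using expanding by blast
  have *: "c * (y - x) \<le> \<bar>f y - f x\<bar>" if P: "P \<in> \<P>" and xy: "x \<in> P" "y \<in> P" "x < y" for P x y
  proof -
    obtain z where z: "z \<in> P" "f y - f x = (y - x) * deriv_on P f z"
      using mvt_within[OF partition_intervals[OF P] f_diff[OF P] xy] by blast
    have "c * (y - x) \<le> \<bar>deriv_on P f z\<bar> * (y - x)" using c(2)[OF P z(1)] xy by (intro mult_right_mono) auto
    then show ?thesis using z(2) xy by (simp add: abs_mult mult.commute)
  qed
  have "c * \<bar>x - y\<bar> \<le> \<bar>f x - f y\<bar>" if P: "P \<in> \<P>" and xy: "x \<in> P" "y \<in> P" for P x y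
  proof -
    consider "x = y" | "x < y" | "y < x" by linarith
    then show ?thesis
    proof cases
      case 2 then show ?thesis using *[OF P xy] by (simp add: abs_minus_commute)
    next
      case 3 then show ?thesis using *[OF P xy(2,1)] by simp
    qed simp
  qed
  then show ?thesis using c(1) by blast
qed

text \<open>
  With a single branch, the points that are in a bounded window after \<open>n\<close> steps form a set of
  diameter at most a multiple of \<open>c ^ - n\<close>, but of measure independent of \<open>n\<close>. By
  Borel-Cantelli, the points for which this happens infinitely often form a set of length 0, but
  of positive measure.
\<close>

lemma two_branches: "\<exists>P\<in>\<P>. \<exists>Q\<in>\<P>. P \<noteq> Q"
proof (rule ccontr)
  assume n: "\<not> ?thesis"
  obtain c where c: "1 < c" "\<And>P x y. P \<in> \<P> \<Longrightarrow> x \<in> P \<Longrightarrow> y \<in> P \<Longrightarrow> c * \<bar>x - y\<bar> \<le> \<bar>f x - f y\<bar>"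
    using expansion by blast
  have exp1: "c * \<bar>x - y\<bar> \<le> \<bar>f x - f y\<bar>" if "x \<in> I" "y \<in> I" for x y
    using that n P_cover c(2) by metis
  have expn: "c ^ n * \<bar>x - y\<bar> \<le> \<bar>(f ^^ n) x - (f ^^ n) y\<bar>" if "x \<in> I" "y \<in> I" for x y n
  proof (induction n)
    case (Suc n)
    have "c * (c ^ n * \<bar>x - y\<bar>) \<le> c * \<bar>(f ^^ n) x - (f ^^ n) y\<bar>" using Suc c(1) by (intro mult_left_mono) auto
    also have "\<dots> \<le> \<bar>f ((f ^^ n) x) - f ((f ^^ n) y)\<bar>" by (intro exp1 fn_I that)
    finally show ?case by (simp add: mult.assoc)
  qed simp
  have sets_I: "B \<inter> I \<in> sets \<mu>" if "B \<in> sets borel" for B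
    unfolding sets_borel sets_restrict_space using that by blast
  have "\<exists>R::nat. measure \<mu> ({- real R .. real R} \<inter> I) \<noteq> 0"
  proof (rule ccontr)
    assume z: "\<not> ?thesis"
    have "emeasure \<mu> (\<Union>R::nat. {- real R .. real R} \<inter> I) = 0"
      using z sets_I by (intro emeasure_UN_eq_0) (auto simp: emeasure_eq_measure)
    moreover have "(\<Union>R::nat. {- real R .. real R} \<inter> I) = I"
    proof (intro antisym subsetI)
      fix x assume x: "x \<in> I"
      obtain R :: nat where "\<bar>x\<bar> \<le> real R" using real_arch_simple by blast
      then show "x \<in> (\<Union>R::nat. {- real R .. real R} \<inter> I)" using x by (intro UN_I[of R]) auto
    qed blast
    ultimately show False using emeasure_space_1 space_I by simp
  qed
  then obtain R :: nat where R: "measure \<mu> ({- real R .. real R} \<inter> I) \<noteq> 0" by blast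
  define m where "m = measure \<mu> ({- real R .. real R} \<inter> I)"
  have m: "0 < m" unfolding m_def zero_less_measure_iff by (rule R)
  define S where "S n = {x \<in> I. (f ^^ n) x \<in> {- real R .. real R} \<inter> I}" for n
  have S_pre: "S n = (f ^^ n) -` ({- real R .. real R} \<inter> I) \<inter> space \<mu>" for n
    unfolding S_def space_I by blast
  have B: "{- real R .. real R} \<inter> I \<in> sets \<mu>" by (rule sets_I) simp
  note pres = funpow_measure_preserving[OF invariant]
  have Ss: "S n \<in> sets \<mu>" for n unfolding S_pre by (rule measurable_sets[OF pres(1) B])
  have Sm: "measure \<mu> (S n) = m" for n
    unfolding m_def S_pre measure_distr[OF pres(1) B, symmetric] pres(2) ..
  have Sb: "S n \<in> sets borel" for n
    using Ss[of n] I_borel unfolding sets_borel by (simp add: sets_restrict_space_iff)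
  have Sl: "emeasure lborel (S n) \<le> ennreal (2 * real R * (1 / c) ^ n)" for n
  proof (rule emeasure_lborel_diam[OF Sb])
    show "0 \<le> 2 * real R * (1 / c) ^ n" using c(1) by simp
    fix x y assume xy: "x \<in> S n" "y \<in> S n"
    have "c ^ n * \<bar>x - y\<bar> \<le> 2 * real R" using expn[of x y n] xy by (auto simp: S_def)
    then show "\<bar>x - y\<bar> \<le> 2 * real R * (1 / c) ^ n" using c(1) by (simp add: field_simps)
  qed
  have "limsup S \<in> null_sets lborel"
  proof (rule borel_cantelli_limsup1)
    show "S n \<in> sets lborel" for n using Sb by simp
    show "emeasure lborel (S n) < \<infinity>" for n using Sl[of n] by (simp add: le_less_trans)
    show "summable (\<lambda>n. measure lborel (S n))"
    proof (rule summable_comparison_test')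
      show "summable (\<lambda>n. 2 * real R * (1 / c) ^ n)" using c(1) by (intro summable_mult summable_geometric) auto
      fix n show "norm (measure lborel (S n)) \<le> 2 * real R * (1 / c) ^ n"
        using Sl[of n] c(1) by (simp add: measure_def enn2real_leI)
    qed
  qed
  then have null: "emeasure lborel (limsup S) = 0" "limsup S \<in> sets borel" by auto
  have lim_eq: "limsup S = (\<Inter>n. \<Union>k\<in>{n..}. S k)" by (rule limsup_INF_SUP)
  have "limsup S \<subseteq> I" unfolding lim_eq by (auto simp: S_def)
  then have "emeasure \<mu> (limsup S) = 0" using null by (intro borel_null)
  then have l0: "measure \<mu> (\<Inter>n. \<Union>k\<in>{n..}. S k) = 0" by (simp add: measure_def lim_eq)
  have "(\<lambda>n. measure \<mu> (\<Union>k\<in>{n..}. S k)) \<longlonglongrightarrow> measure \<mu> (\<Inter>n. \<Union>k\<in>{n..}. S k)"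
  proof (rule finite_Lim_measure_decseq)
    show "range (\<lambda>n. \<Union>k\<in>{n..}. S k) \<subseteq> sets \<mu>" using Ss by auto
    show "decseq (\<lambda>n. \<Union>k\<in>{n..}. S k)" unfolding decseq_def by fastforce
  qed
  moreover have "m \<le> measure \<mu> (\<Union>k\<in>{n..}. S k)" for n
    unfolding Sm[of n, symmetric] using Ss by (intro finite_measure_mono) auto
  ultimately have "m \<le> measure \<mu> (\<Inter>n. \<Union>k\<in>{n..}. S k)" by (intro LIMSEQ_le_const) auto
  then show False using m l0 by simp
qed

lemma branch_extension:
  assumes "P \<in> \<P>"
  obtains g where "\<And>x. x \<in> P \<Longrightarrow> g x = f x" "continuous_on (closure P) g" "inj_on g (closure P)" "g ` closure P = I"
  using full_branch[OF assms] unfolding diffeomorphism_on_def bij_betw_def by blast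

lemma unbounded_interval:
  assumes "\<not> bounded (S :: real set)" shows "\<not> bdd_above S \<or> \<not> bdd_below S"
proof (rule ccontr)
  assume "\<not> ?thesis"
  then obtain u l where "\<And>x. x \<in> S \<Longrightarrow> x \<le> u" "\<And>x. x \<in> S \<Longrightarrow> l \<le> x" unfolding bdd_above_def bdd_below_def by blast
  then have "S \<subseteq> {l..u}" by auto
  then show False using assms bounded_closed_interval bounded_subset by blast
qed

text \<open>
  If the interval is not compact, then no branch domain is bounded, since the closure of a
  bounded one is a compact set mapped onto the interval. Two disjoint unbounded intervals are
  half-lines in opposite directions, so the interval is the whole line, which is not the image
  of a closed half-line under a continuous injection.
\<close>

lemma compact_I: "compact I"
proof (rule ccontr)
  assume nc: "\<not> compact I"
  have unb: "\<not> bounded P" if P: "P \<in> \<P>" for P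
  proof
    assume "bounded P"
    then have "compact (closure P)" by (simp add: compact_closure)
    moreover obtain g where "continuous_on (closure P) g" "g ` closure P = I" by (rule branch_extension[OF P])
    ultimately have "compact I" using compact_continuous_image by blast
    then show False using nc by simp
  qed
  have above: "x \<in> S" if h: "is_interval S" "\<not> bdd_above S" "y \<in> S" "y \<le> x" for x y and S :: "real set"
  proof -
    obtain z where z: "z \<in> S" "x < z" using h(2) unfolding bdd_above_def by (meson not_le)
    show ?thesis by (rule mem_is_interval_1_I[OF h(1,3) z(1) h(4) less_imp_le[OF z(2)]])
  qed
  have below: "x \<in> S" if h: "is_interval S" "\<not> bdd_below S" "y \<in> S" "x \<le> y" for x y and S :: "real set"
  proof -
    obtain z where z: "z \<in> S" "z < x" using h(2) unfolding bdd_below_def by (meson not_le)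
    show ?thesis by (rule mem_is_interval_1_I[OF h(1) z(1) h(3) less_imp_le[OF z(2)] h(4)])
  qed
  obtain P0 Q0 where PQ0: "P0 \<in> \<P>" "Q0 \<in> \<P>" "P0 \<noteq> Q0" using two_branches by blast
  have not_above: "\<not> (\<not> bdd_above P \<and> \<not> bdd_above Q)" if h: "P \<in> \<P>" "Q \<in> \<P>" "P \<noteq> Q" for P Q
  proof
    assume *: "\<not> bdd_above P \<and> \<not> bdd_above Q"
    obtain p q where "p \<in> P" "q \<in> Q" using P_nonempty h(1,2) by blast
    then have "max p q \<in> P \<inter> Q"
      using above[of P p "max p q"] above[of Q q "max p q"] partition_intervals h * by simp
    then show False using P_disjoint[OF h] by blast
  qed
  have not_below: "\<not> (\<not> bdd_below P \<and> \<not> bdd_below Q)" if h: "P \<in> \<P>" "Q \<in> \<P>" "P \<noteq> Q" for P Q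
  proof
    assume *: "\<not> bdd_below P \<and> \<not> bdd_below Q"
    obtain p q where "p \<in> P" "q \<in> Q" using P_nonempty h(1,2) by blast
    then have "min p q \<in> P \<inter> Q"
      using below[of P p "min p q"] below[of Q q "min p q"] partition_intervals h * by simp
    then show False using P_disjoint[OF h] by blast
  qed
  have "\<exists>P\<in>\<P>. \<exists>Q\<in>\<P>. P \<noteq> Q \<and> \<not> bdd_above P \<and> \<not> bdd_below Q"
  proof (cases "bdd_above P0")
    case True
    then have 1: "\<not> bdd_below P0" using unbounded_interval[OF unb[OF PQ0(1)]] by simp
    then have "bdd_below Q0" using not_below[OF PQ0] by simp
    then have 2: "\<not> bdd_above Q0" using unbounded_interval[OF unb[OF PQ0(2)]] by simp
    show ?thesis by (rule bexI[OF _ PQ0(2)], rule bexI[OF _ PQ0(1)]) (simp add: 1 2 PQ0(3)[symmetric])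
  next
    case False
    then have "bdd_above Q0" using not_above[OF PQ0] by simp
    then have 2: "\<not> bdd_below Q0" using unbounded_interval[OF unb[OF PQ0(2)]] by simp
    show ?thesis by (rule bexI[OF _ PQ0(1)], rule bexI[OF _ PQ0(2)]) (simp add: False 2 PQ0(3))
  qed
  then obtain P Q where PQ: "P \<in> \<P>" "Q \<in> \<P>" "P \<noteq> Q" "\<not> bdd_above P" "\<not> bdd_below Q"
    by (elim bexE conjE)
  have I: "x \<in> I" for x
  proof -
    obtain p q where "p \<in> P" "q \<in> Q" using P_nonempty PQ(1,2) by blast
    then have "max p x \<in> P" "min q x \<in> Q" using above[of P] below[of Q] partition_intervals PQ by auto
    then have "max p x \<in> I" "min q x \<in> I" using P_sub PQ(1,2) by blast+
    then show ?thesis using mem_is_interval_1_I[OF interval, of "min q x" "max p x" x] by simp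
  qed
  have bb: "bdd_below P" using not_below[OF PQ(1-3)] PQ(5) by simp
  let ?S = "closure P"
  have Sint: "is_interval ?S"
    using partition_intervals[OF PQ(1)] by (simp add: is_interval_convex_1 convex_closure)
  obtain l where l: "\<And>x. x \<in> P \<Longrightarrow> l \<le> x" using bb unfolding bdd_below_def by blast
  have "?S \<subseteq> {l..}" using l by (intro closure_minimal) auto
  then have bbS: "bdd_below ?S" by (meson bdd_below_Ici bdd_below_mono)
  have Sne: "?S \<noteq> {}" using P_nonempty[OF PQ(1)] by simp
  define p where "p = Inf ?S"
  have p: "p \<in> ?S" unfolding p_def by (rule closed_contains_Inf[OF Sne bbS]) simp
  have "?S - {p} = ?S \<inter> {p<..}"
    using cInf_lower[OF _ bbS] unfolding p_def by (auto simp: less_le)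
  then have Sp: "is_interval (?S - {p})" using Sint by (simp add: is_interval_Int is_interval_oi)
  obtain g where g: "continuous_on ?S g" "inj_on g ?S" "g ` ?S = I" by (rule branch_extension[OF PQ(1)])
  have "g p - 1 \<in> g ` ?S" "g p + 1 \<in> g ` ?S" using I g(3) by auto
  then obtain u v where "u \<in> ?S" "g u = g p - 1" "v \<in> ?S" "g v = g p + 1" by auto
  then show False using endpoint_extremal[OF Sp g(1,2) p, of u v] by simp
qed

text \<open>
  The extension of a branch to the closure of its domain is monotone, so it takes the values \<open>a\<close>
  and \<open>b\<close> at the endpoints of the domain and all interior values strictly inside.
\<close>

lemma branch_structure:
  assumes I: "I = {a..b}" "a < b" and P: "P \<in> \<P>"
  shows "\<And>y. y \<in> {a<..<b} \<Longrightarrow> \<exists>!x. x \<in> P \<and> f x = y"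
    "\<And>x. x \<in> P \<Longrightarrow> f x \<in> {a<..<b} \<Longrightarrow> x \<in> {a<..<b}"
proof -
  obtain g where g: "\<And>x. x \<in> P \<Longrightarrow> g x = f x" "continuous_on (closure P) g" "inj_on g (closure P)" "g ` closure P = I"
    by (rule branch_extension[OF P]) (rule that; blast)
  have conv: "convex P" using partition_intervals[OF P] by (simp add: is_interval_convex_1)
  have PI: "P \<subseteq> {a..b}" using P_sub[OF P] I by simp
  have clI: "closure P \<subseteq> {a..b}" using PI by (intro closure_minimal) auto
  have "compact (closure P)" using PI bounded_closed_interval bounded_subset by (metis compact_closure)
  moreover have "connected (closure P)" by (intro convex_connected convex_closure conv)
  ultimately obtain p r where pr: "closure P = {p..r}" using connected_compact_interval_1 by metis
  have "p < r"
  proof (rule ccontr)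
    assume "\<not> p < r"
    then have "closure P \<subseteq> {p}" using pr by auto
    then have "I \<subseteq> {g p}" using g(4) by blast
    then have "a = g p" "b = g p" using I by auto
    then show False using I(2) by simp
  qed
  have ipr: "{p<..<r} \<subseteq> P" using convex_interior_closure[OF conv] pr interior_subset[of P] by simp
  have ends: "a \<le> p" "r \<le> b" using clI pr \<open>p < r\<close> by auto
  have gp: "g p \<notin> {a<..<b}" and gr: "g r \<notin> {a<..<b}"
  proof -
    have mem: "p \<in> closure P" "r \<in> closure P" using pr \<open>p < r\<close> by auto
    have ag: "a \<in> g ` closure P" and bg: "b \<in> g ` closure P" unfolding g(4) using I by simp_all
    obtain u where u: "u \<in> closure P" "g u = a" using ag by (rule imageE) simp
    obtain v where v: "v \<in> closure P" "g v = b" using bg by (rule imageE) simp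
    note uv = u v
    have "closure P - {p} = {p<..r}" "closure P - {r} = {p..<r}" unfolding pr by auto
    then have ivl: "is_interval (closure P - {p})" "is_interval (closure P - {r})"
      by (simp_all only: is_interval_oc is_interval_co)
    have "\<not> (a < g p \<and> g p < b)" "\<not> (a < g r \<and> g r < b)"
      using endpoint_extremal[OF ivl(1) g(2,3) mem(1) uv(1,3)] endpoint_extremal[OF ivl(2) g(2,3) mem(2) uv(1,3)]
      unfolding uv(2,4) by blast+
    then show "g p \<notin> {a<..<b}" "g r \<notin> {a<..<b}" by simp_all
  qed
  show "\<exists>!x. x \<in> P \<and> f x = y" if y: "y \<in> {a<..<b}" for y
  proof -
    have "y \<in> g ` closure P" using g(4) I y by auto
    then obtain x where x: "x \<in> closure P" "g x = y" by auto
    have "x \<noteq> p" "x \<noteq> r" using x gp gr y by auto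
    then have xP: "x \<in> P" using x(1) pr ipr by auto
    show ?thesis
    proof (rule ex1I[of _ x])
      show "x \<in> P \<and> f x = y" using xP x g(1) by simp
      fix x' assume x': "x' \<in> P \<and> f x' = y"
      then have "g x' = g x" using g(1) x by simp
      then show "x' = x" using g(3) x(1) x' closure_subset unfolding inj_on_def by blast
    qed
  qed
  show "x \<in> {a<..<b}" if x: "x \<in> P" "f x \<in> {a<..<b}" for x
  proof -
    have "x \<in> {p..r}" using x(1) closure_subset pr by blast
    moreover have "x \<noteq> p" "x \<noteq> r" using g(1)[OF x(1)] x(2) gp gr by auto
    ultimately show ?thesis using ends by auto
  qed
qed

lemma coding_exists:
  "\<exists>a b c \<alpha> H Cg dist_const. I = {a..b} \<and> acip_coding a b \<P> f \<phi> c \<alpha> H \<mu> Cg dist_const"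
proof -
  have "connected I" using interval by (rule is_interval_connected)
  then obtain a b where I: "I = {a..b}" using compact_I connected_compact_interval_1 by metis
  obtain u0 v0 where "u0 \<in> I" "v0 \<in> I" "u0 < v0" using I_two_points by blast
  then have ab: "a < b" unfolding I by auto
  obtain c where c: "1 < c" "\<And>P x y. P \<in> \<P> \<Longrightarrow> x \<in> P \<Longrightarrow> y \<in> P \<Longrightarrow> c * \<bar>x - y\<bar> \<le> \<bar>f x - f y\<bar>"
    using expansion by blast
  obtain \<alpha> H where H: "0 < \<alpha>" "0 \<le> H" "\<And>P x y. P \<in> \<P> \<Longrightarrow> x \<in> P \<Longrightarrow> y \<in> P \<Longrightarrow> \<bar>\<phi> x - \<phi> y\<bar> \<le> H * \<bar>x - y\<bar> powr \<alpha>"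
    using uniform_holder[OF finite_partition(1) _ potential_holder ab] P_sub I by metis
  interpret B: branch_coding a b \<P> f \<phi> c \<alpha> H
  proof
    show "a < b" by (rule ab)
    show "finite \<P>" by (rule finite_partition(1))
    show "partition_on {a..b} \<P>" using finite_partition(2) I by simp
    show "\<And>x. x \<in> {a..b} \<Longrightarrow> f x \<in> {a..b}" using f_I I by simp
    show "x \<in> {a<..<b}" if "x \<in> {a..b}" "f x \<in> {a<..<b}" for x
      using P_cover[of x] branch_structure(2)[OF I ab] that I by blast
    show "\<exists>!x. x \<in> P \<and> f x = y" if "P \<in> \<P>" "y \<in> {a<..<b}" for P y
      using branch_structure(1)[OF I ab] that by blast
  qed (use c H in blast)+
  obtain C0 where C0: "0 < C0" "\<And>n P x. 1 \<le> n \<Longrightarrow> P \<in> cylinders I \<P> f n \<Longrightarrow> x \<in> P \<Longrightarrow>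
      1 / C0 \<le> measure \<mu> P / exp (birkhoff_sum f \<phi> n x) \<and> measure \<mu> P / exp (birkhoff_sum f \<phi> n x) \<le> C0"
    using gibbs by metis
  define Cg where "Cg = max 1 C0"
  have Cg: "1 \<le> Cg" "C0 \<le> Cg" by (auto simp: Cg_def)
  have gibbs': "exp (birkhoff_sum f \<phi> n x) \<le> Cg * measure \<mu> {z \<in> {a..b}. B.same n x z} \<and>
      measure \<mu> {z \<in> {a..b}. B.same n x z} \<le> Cg * exp (birkhoff_sum f \<phi> n x)" if x: "x \<in> {a..b}" for n x
  proof (cases "n = 0")
    case True
    then have "B.same n x z" for z by (simp add: B.same_def)
    then have "{z \<in> {a..b}. B.same n x z} = {a..b}" by blast
    then have 1: "measure \<mu> {z \<in> {a..b}. B.same n x z} = 1" using prob_space unfolding space_I I by (simp only:)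
    show ?thesis unfolding 1 using True Cg(1) by (simp add: birkhoff_sum_def)
  next
    case False
    let ?m = "measure \<mu> {z \<in> {a..b}. B.same n x z}" and ?e = "exp (birkhoff_sum f \<phi> n x)"
    have "1 / C0 \<le> ?m / ?e \<and> ?m / ?e \<le> C0"
    proof (rule C0(2))
      show "1 \<le> n" using False by simp
      show "{z \<in> {a..b}. B.same n x z} \<in> cylinders I \<P> f n" unfolding I by (rule B.cell_cylinder[OF x])
      show "x \<in> {z \<in> {a..b}. B.same n x z}" using x B.same_refl by blast
    qed
    then have "?e \<le> C0 * ?m" "?m \<le> C0 * ?e" using C0(1) by (auto simp: field_simps)
    moreover have "C0 * ?m \<le> Cg * ?m" "C0 * ?e \<le> Cg * ?e" using Cg(2) by (intro mult_right_mono; simp)+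
    ultimately show ?thesis by linarith
  qed
  interpret G: gibbs_measure a b \<P> f \<phi> c \<alpha> H \<mu> Cg
  proof
    show "sets \<mu> = sets (restrict_space borel {a..b})" using sets_borel I by simp
    show "P \<in> sets \<mu>" if P: "P \<in> \<P>" for P
      unfolding sets_borel using real_interval_borel_measurable[OF partition_intervals[OF P]] P_sub[OF P] I_borel
      by (simp add: sets_restrict_space_iff)
  qed (use invariant Cg gibbs' in blast)+
  have cs: "is_interval {z \<in> {a..b}. B.same n x z}" "(f ^^ n) differentiable_on {z \<in> {a..b}. B.same n x z}"
    if "x \<in> {a..b}" for n x
    using B.cell_structure[OF partition_intervals f_diff that] by blast+
  obtain K where K: "\<And>n P x y. 1 \<le> n \<Longrightarrow> P \<in> cylinders I \<P> f n \<Longrightarrow> x \<in> P \<Longrightarrow> y \<in> P \<Longrightarrow>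
     \<bar>deriv_on P (f ^^ n) x\<bar> / \<bar>deriv_on P (f ^^ n) y\<bar> \<le> K"
    using bounded_distortion by metis
  define dist_const where "dist_const = max 1 K"
  have dist_const: "1 \<le> dist_const" "K \<le> dist_const" by (auto simp: dist_const_def)
  have dist: "\<bar>(f ^^ n) u - (f ^^ n) v\<bar> * \<bar>u' - v'\<bar> \<le> dist_const * \<bar>(f ^^ n) u' - (f ^^ n) v'\<bar> * \<bar>u - v\<bar>"
    if x: "x \<in> {a..b}" and uv: "u \<in> G.cell n x" "v \<in> G.cell n x" "u' \<in> G.cell n x" "v' \<in> G.cell n x" for n x u v u' v'
  proof (cases "n = 0 \<or> u = v \<or> u' = v'")
    case True
    then consider "n = 0" | "u = v" | "u' = v'" by blast
    then show ?thesis
    proof cases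
      case 1
      have "1 * (\<bar>u - v\<bar> * \<bar>u' - v'\<bar>) \<le> dist_const * (\<bar>u - v\<bar> * \<bar>u' - v'\<bar>)" using dist_const(1) by (intro mult_right_mono) auto
      then show ?thesis using 1 by (simp add: mult_ac)
    qed (use dist_const(1) in simp_all)
  next
    case False
    let ?C = "{z \<in> {a..b}. B.same n x z}" and ?d = "\<lambda>z. \<bar>deriv_on {z \<in> {a..b}. B.same n x z} (f ^^ n) z\<bar>"
    have mv: "\<exists>z\<in>?C. \<bar>(f ^^ n) s - (f ^^ n) t\<bar> = \<bar>s - t\<bar> * ?d z" if st: "s \<in> ?C" "t \<in> ?C" "s \<noteq> t" for s t
    proof -
      consider "s < t" | "t < s" using st(3) by linarith
      then show ?thesis
      proof cases
        case 1
        obtain z where z: "z \<in> ?C" "(f ^^ n) t - (f ^^ n) s = (t - s) * deriv_on ?C (f ^^ n) z"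
          using mvt_within[OF cs[OF x] st(1,2) 1] by blast
        have "\<bar>(f ^^ n) t - (f ^^ n) s\<bar> = \<bar>t - s\<bar> * ?d z" unfolding z(2) by (rule abs_mult)
        then have "\<bar>(f ^^ n) s - (f ^^ n) t\<bar> = \<bar>s - t\<bar> * ?d z"
          unfolding abs_minus_commute[of s t] abs_minus_commute[of "(f ^^ n) s"] .
        then show ?thesis using z(1) by blast
      next
        case 2
        obtain z where z: "z \<in> ?C" "(f ^^ n) s - (f ^^ n) t = (s - t) * deriv_on ?C (f ^^ n) z"
          using mvt_within[OF cs[OF x] st(2,1) 2] by blast
        have "\<bar>(f ^^ n) s - (f ^^ n) t\<bar> = \<bar>s - t\<bar> * ?d z" unfolding z(2) by (rule abs_mult)
        then show ?thesis using z(1) by blast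
      qed
    qed
    have uvC: "u \<in> ?C" "v \<in> ?C" "u' \<in> ?C" "v' \<in> ?C" using uv unfolding G.cell_def by blast+
    obtain z where z: "z \<in> ?C" "\<bar>(f ^^ n) u - (f ^^ n) v\<bar> = \<bar>u - v\<bar> * ?d z" using mv[OF uvC(1,2)] False by blast
    obtain z' where z': "z' \<in> ?C" "\<bar>(f ^^ n) u' - (f ^^ n) v'\<bar> = \<bar>u' - v'\<bar> * ?d z'" using mv[OF uvC(3,4)] False by blast
    have "B.same n u' v'" using uvC B.same_trans[OF B.same_sym] by blast
    then have "c ^ n * \<bar>u' - v'\<bar> \<le> \<bar>u' - v'\<bar> * ?d z'" using B.same_contract[of u' v' n] uvC z'(2) by simp
    moreover have "0 < c ^ n * \<bar>u' - v'\<bar>" using c(1) False by simp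
    ultimately have "0 < \<bar>u' - v'\<bar> * ?d z'" by linarith
    then have d0: "0 < ?d z'" by (simp add: zero_less_mult_iff)
    have "?d z / ?d z' \<le> K"
    proof (rule K[OF _ _ z(1) z'(1)])
      show "1 \<le> n" using False by simp
      show "{z \<in> {a..b}. B.same n x z} \<in> cylinders I \<P> f n" unfolding I by (rule B.cell_cylinder[OF x])
    qed
    then have "?d z \<le> K * ?d z'" using d0 by (simp add: divide_le_eq)
    also have "\<dots> \<le> dist_const * ?d z'" using dist_const(2) by (intro mult_right_mono) auto
    finally have "(\<bar>u - v\<bar> * \<bar>u' - v'\<bar>) * ?d z \<le> (\<bar>u - v\<bar> * \<bar>u' - v'\<bar>) * (dist_const * ?d z')"
      by (intro mult_left_mono) auto
    then show ?thesis unfolding z(2) z'(2) by (simp only: mult_ac)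
  qed
  have "acip_coding a b \<P> f \<phi> c \<alpha> H \<mu> Cg dist_const"
  proof
    show "is_interval (G.cell n x)" if "x \<in> {a..b}" for n x using cs(1)[OF that] unfolding G.cell_def .
    show "continuous_on (G.cell n x) (f ^^ n)" if "x \<in> {a..b}" for n x
      using differentiable_imp_continuous_on[OF cs(2)[OF that]] unfolding G.cell_def .
    show "1 \<le> dist_const" by (rule dist_const)
    show "absolutely_continuous (restrict_space lborel {a..b}) \<mu>" using ac I by simp
  qed (rule dist)
  then show ?thesis using I by blast
qed

text \<open>
  Every ball around a point of the support has positive measure, so a positive proportion of
  visits means at least one visit.
\<close>

lemma cover_le_blanket:
  assumes e: "\<theta> > 0" and d: "0 < d"
  shows "expected_time \<mu> (cover_time f I d) \<le> expected_time \<mu> (blanket_time f \<mu> \<theta> d)"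
  unfolding expected_time_def
proof (rule nn_integral_mono)
  fix x
  have "cover_time f I d x \<le> blanket_time f \<mu> \<theta> d x"
    unfolding cover_time_def blanket_time_def
  proof (rule INF_superset_mono[OF _ order_refl], rule subsetI, rule CollectI)
    fix N assume "N \<in> {N. 1 \<le> N \<and> (\<forall>y\<in>measure_support \<mu>. \<theta> * measure \<mu> (ball y d \<inter> space \<mu>)
            \<le> 1 / real N * (\<Sum>i<N. indicator (ball y d) ((f ^^ i) x)))}"
    then have N: "1 \<le> N" "\<And>y. y \<in> I \<Longrightarrow> \<theta> * measure \<mu> (ball y d \<inter> space \<mu>)
            \<le> 1 / real N * (\<Sum>i<N. indicator (ball y d) ((f ^^ i) x))" using fully_supported by auto
    have "\<exists>x'\<in>(\<lambda>i. (f ^^ i) x) ` {..<N}. x' \<in> ball y d" if y: "y \<in> I" for y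
    proof (rule ccontr)
      assume "\<not> ?thesis"
      then have "(\<Sum>i<N. indicator (ball y d) ((f ^^ i) x)) = (0::real)" by (intro sum.neutral) (auto simp: indicator_def)
      then have "\<theta> * measure \<mu> (ball y d \<inter> space \<mu>) \<le> 0" using N(2)[OF y] by simp
      moreover have "0 < measure \<mu> (ball y d \<inter> space \<mu>)"
        using y fully_supported d unfolding measure_support_def by (metis (mono_tags, lifting) centre_in_ball mem_Collect_eq open_ball)
      ultimately show False using e by (simp add: mult_le_0_iff)
    qed
    then show "1 \<le> N \<and> delta_dense_in d ((\<lambda>i. (f ^^ i) x) ` {..<N}) I" using N(1) by (simp add: delta_dense_in_def)
  qed
  then show "ennreal_of_enat (cover_time f I d x) \<le> ennreal_of_enat (blanket_time f \<mu> \<theta> d x)"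
    by (subst ennreal_of_enat_le_iff)
qed

end

theorem corollary1p4:
  fixes I :: "real set" and \<P> :: "real set set" and f \<phi> :: "real \<Rightarrow> real"
    and \<mu> :: "real measure"
  assumes "gibbs_system I \<P> f \<mu> \<phi>"
    and "absolutely_continuous (restrict_space lborel I) \<mu>"
  shows "\<exists>C \<delta>\<^sub>0 :: real. 1 \<le> C \<and> 0 < \<delta>\<^sub>0 \<and> \<delta>\<^sub>0 < 1 \<and>
    (\<forall>\<epsilon> \<delta>. 0 < \<epsilon> \<and> \<epsilon> < 1 \<and> 0 < \<delta> \<and> \<delta> < \<delta>\<^sub>0 \<longrightarrow>
       ennreal (1 / C * (1 / \<delta> * ln (1 / \<delta>)))
         \<le> expected_time \<mu> (blanket_time f \<mu> (1 - \<epsilon>) \<delta>) \<and>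
       expected_time \<mu> (blanket_time f \<mu> (1 - \<epsilon>) \<delta>)
         \<le> ennreal (C / \<epsilon> ^ 3 * (1 / \<delta> * ln (1 / \<delta>))) \<and>
       ennreal (1 / C) * expected_time \<mu> (cover_time f I \<delta>)
         \<le> expected_time \<mu> (blanket_time f \<mu> (1 - \<epsilon>) \<delta>) \<and>
       expected_time \<mu> (blanket_time f \<mu> (1 - \<epsilon>) \<delta>)
         \<le> ennreal (C / \<epsilon> ^ 3) * expected_time \<mu> (cover_time f I \<delta>))"
proof -
  interpret S: acip_gibbs_system I \<P> f \<mu> \<phi>
    using assms by (intro acip_gibbs_system.intro acip_gibbs_system_axioms.intro)
  obtain a b c \<alpha> H Cg dist_const where I: "I = {a..b}" and coding: "acip_coding a b \<P> f \<phi> c \<alpha> H \<mu> Cg dist_const"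
    using S.coding_exists by blast
  obtain dens where "gibbs_coding a b \<P> f \<phi> c \<alpha> H \<mu> Cg dens"
    using acip_coding.gibbs_coding_exists[OF coding] by blast
  then interpret G: gibbs_coding a b \<P> f \<phi> c \<alpha> H \<mu> Cg dens .
  obtain C1 where C1: "1 \<le> C1" "\<And>e d. 0 < e \<Longrightarrow> e < 1 \<Longrightarrow> 0 < d \<Longrightarrow> d \<le> exp (-1) \<Longrightarrow> d \<le> b - a \<Longrightarrow>
     expected_time \<mu> (blanket_time f \<mu> (1 - e) d) \<le> ennreal (C1 / e ^ 3 * (1 / d * ln (1 / d)))"
    using G.blanket_expectation S.fully_supported I by blast
  obtain C2 d0 where C2: "1 \<le> C2" "0 < d0" "\<And>d. 0 < d \<Longrightarrow> d < d0 \<Longrightarrow>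
     ennreal (1 / C2 * (1 / d * ln (1 / d))) \<le> expected_time \<mu> (cover_time f I d)"
    using G.cover_expectation unfolding I by blast
  define C where "C = C1 * C2"
  define D where "D = min d0 (min (exp (-1)) (b - a))"
  have C: "1 \<le> C" "C1 \<le> C" "C2 \<le> C"
    using C1(1) C2(1) mult_mono[of 1 C1 1 C2] mult_left_mono[of 1 C2 C1] mult_right_mono[of 1 C1 C2] by (simp_all add: C_def)
  have D: "0 < D" "D \<le> d0" "D \<le> exp (-1)" "D \<le> b - a" using C2(2) G.ab by (auto simp: D_def)
  have "exp (-1) < (1::real)" by simp
  then have D1: "D < 1" using D(3) by linarith
  show ?thesis
  proof (rule exI[of _ C], rule exI[of _ D], intro conjI C(1) D(1) D1 allI impI)
    fix \<epsilon> \<delta> :: real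
    assume as: "0 < \<epsilon> \<and> \<epsilon> < 1 \<and> 0 < \<delta> \<and> \<delta> < D"
    let ?X = "1 / \<delta> * ln (1 / \<delta>)"
    let ?B = "expected_time \<mu> (blanket_time f \<mu> (1 - \<epsilon>) \<delta>)" and ?E = "expected_time \<mu> (cover_time f I \<delta>)"
    have X: "0 \<le> ?X" using as D1 by (intro mult_nonneg_nonneg ln_ge_zero) auto
    have EB: "?E \<le> ?B" by (rule S.cover_le_blanket) (use as in auto)
    have lo: "ennreal (1 / C2 * ?X) \<le> ?E" using C2(3) as D by simp
    have up: "?B \<le> ennreal (C1 / \<epsilon> ^ 3 * ?X)" using C1(2) as D by simp
    have "1 / C * ?X \<le> 1 / C2 * ?X" using C C2(1) X by (intro mult_right_mono divide_left_mono) auto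
    then have "ennreal (1 / C * ?X) \<le> ennreal (1 / C2 * ?X)" by (rule ennreal_leI)
    then show "ennreal (1 / C * ?X) \<le> ?B" using lo EB by (meson order_trans)
    have "C1 / \<epsilon> ^ 3 * ?X \<le> C / \<epsilon> ^ 3 * ?X" using C as X by (intro mult_right_mono divide_right_mono) auto
    then have "ennreal (C1 / \<epsilon> ^ 3 * ?X) \<le> ennreal (C / \<epsilon> ^ 3 * ?X)" by (rule ennreal_leI)
    then show "?B \<le> ennreal (C / \<epsilon> ^ 3 * ?X)" using up by (meson order_trans)
    have "ennreal (1 / C) * ?E \<le> ennreal 1 * ?E" using C(1) by (intro mult_right_mono ennreal_leI) auto
    then show "ennreal (1 / C) * ?E \<le> ?B" using EB by simp
    have "C1 / \<epsilon> ^ 3 * ?X = C / \<epsilon> ^ 3 * (1 / C2 * ?X)" using C2(1) by (simp add: C_def)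
    then have "ennreal (C1 / \<epsilon> ^ 3 * ?X) = ennreal (C / \<epsilon> ^ 3) * ennreal (1 / C2 * ?X)"
    proof (subst ennreal_mult[symmetric])
      show "0 \<le> C / \<epsilon> ^ 3" using C as by simp
      show "0 \<le> 1 / C2 * ?X" by (rule mult_nonneg_nonneg[OF _ X]) (use C2(1) in simp)
    qed simp
    also have "\<dots> \<le> ennreal (C / \<epsilon> ^ 3) * ?E" using lo by (rule mult_left_mono) simp
    finally show "?B \<le> ennreal (C / \<epsilon> ^ 3) * ?E" using up by (meson order_trans)
  qed
qed

end
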